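(* The following hold. 1. For every $1<p<\infty$, $\mathbb{T}^H_p$ is not locally quasi-convex and, so, not reflexive. 2. $\mathbb{T}^H_1$ is reflexive and, hence, locally quasi-convex. 3. $\mathbb{T}^H_0$ is reflexive and, hence, locally quasi-convex. It is not a QI-group. 4. For every $1<p<\infty$, $(\mathbb{T}^H_p)^{\wedge}$ is topologically isomorphic to $(\mathbb{T}^H_0)^{\wedge}$ and, hence, reflexive. 5. $(\mathbb{T}^H_0)^{\wedge}=(\mathbb{Z}_0^{\infty},\mathbf{e})$ (as topological groups). 6. $(\mathbb{T}^H_1)^{\wedge}$ is algebraically isomorphic to $\mathbb{Z}^{\infty}_b$.
   Context: Groups: $\mathbb{T}=\{z\in\mathbb{C}:|z|=1\}$. For $1\le p<\infty$, $\mathbb{T}^H_p:=\{(z_n)\in\mathbb{T}^{\infty}:\ \sum_{n=1}^\infty|1-z_n|^p<\infty\}$ with metric $d_p((z_n),(w_n))=\left(\sum_n|z_n-w_n|^p\right)^{1/p}$; $\mathbb{T}^H_0:=\{(z_n)\in\mathbb{T}^\infty:\ z_n\to1\}$ with metric $d_0((z_n),(w_n))=\sup_n|z_n-w_n|$. With coordinatewise multiplication these are Polish groups. $\mathbb{Z}^\infty_b$ is the group (under coordinatewise addition) of all bounded integer sequences $(n_1,n_2,\dots)$, and $\mathbb{Z}^\infty_0$ is the group of all finitely supported integer sequences. Let $e_n\in\mathbb{Z}_0^\infty$ be the sequence with $1$ at position $n$ and $0$ elsewhere, and $\mathbf{e}=\{e_n\}$. $(\mathbb{Z}_0^\infty,\mathbf{e})$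 denotes $\mathbb{Z}_0^\infty$ equipped with the finest Hausdorff group topology for which $e_n$ converges to zero. In item 5, an element $(n_1,\dots,n_k,0,\dots)\in\mathbb{Z}_0^\infty$ is identified with the character $(z_n)\mapsto z_1^{n_1}\cdots z_k^{n_k}$. Duality: for an abelian topological group $G$, $G^\wedge$ is the group of continuous homomorphisms (characters) $G\to\mathbb{T}$ with the compact-open topology; $(\chi,g)$ denotes the value of $\chi$ at $g$. $G$ is (Pontryagin) reflexive if the canonical homomorphism $\alpha_G:G\to G^{\wedge\wedge}$, $g\mapsto(\chi\mapsto(\chi,g))$, is a topological isomorphism. A subset $A\subset G$ is quasi-convex if for every $g\in G\setminus A$ there is $\chi\in A^{\triangleright}:=\{\chi\in G^\wedge:\ \mathrm{Re}(\chi,h)\ge 0\ \forall h\in A\}$ with $\mathrm{Re}(\chi,g)<0$. $G$ is locally quasi-convex if it has a neighborhood basis of the neutral element consisting of quasi-convex sets. QI-groups: for a Borel probability measure $\mu$ on a Polish group $X$ and $g\in X$, $\mu_g(E):=\mu(g^{-1}E)$ for Borel $E$; $\sim$ denotes equivalence of measures and $\perp$ mutual singularity; $E(\mu):=\{g\in X:\mu_g\sim\mu\}$. A Polish group $G$ is a QI-group (group of quasi-invariance) if there exist a locally compact Polish group $X$ and a Borel probability measure $\mu$ on $X$ such that $G$ is continuously embedded in $X$ (there is a continuous injective homomorphism $G\to X$, by which $G$ is identified, as an abstract group, with a subgroup of $X$), $E(\mu)=G$, and $\mu_g\perp\mu$ for all $g\in X\setminus E(\mu)$. *)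

theory Defs
  imports "HOL-Analysis.Analysis" "HOL-Probability.Probability" "HOL-Algebra.Group"
begin

section \<open>Topological groups\<close>

record 'a tgroup = "'a monoid" +
  topo :: "'a topology"

definition topological_group :: "('a, 'b) tgroup_scheme \<Rightarrow> bool" where
  "topological_group G \<longleftrightarrow>
     group G \<and> topspace (topo G) = carrier G \<and>
     continuous_map (prod_topology (topo G) (topo G)) (topo G) (\<lambda>(x, y). x \<otimes>\<^bsub>G\<^esub> y) \<and>
     continuous_map (topo G) (topo G) (\<lambda>x. inv\<^bsub>G\<^esub> x)"

definition polish_group :: "('a, 'b) tgroup_scheme \<Rightarrow> bool" where
  "polish_group G \<longleftrightarrow>
     topological_group G \<and> completely_metrizable_space (topo G) \<and> separable_space (topo G)"

definition topological_iso ::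
    "('a, 'c) tgroup_scheme \<Rightarrow> ('b, 'd) tgroup_scheme \<Rightarrow> ('a \<Rightarrow> 'b) \<Rightarrow> bool" where
  "topological_iso G H f \<longleftrightarrow> f \<in> iso G H \<and> homeomorphic_map (topo G) (topo H) f"

definition with_topology :: "'a monoid \<Rightarrow> 'a topology \<Rightarrow> 'a tgroup" where
  "with_topology G T = \<lparr>carrier = carrier G, mult = mult G, one = one G, topo = T\<rparr>"


section \<open>Pontryagin duality\<close>

definition circle :: "complex tgroup" where
  "circle = \<lparr>carrier = sphere 0 1, mult = (*), one = 1, topo = top_of_set (sphere 0 1)\<rparr>"

text \<open>Characters are taken to be undefined outside the carrier, so that equality of
  characters is equality of functions on \<open>G\<close>.\<close>

definition characters :: "('a, 'b) tgroup_scheme \<Rightarrow> ('a \<Rightarrow> complex) set" where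
  "characters G =
     {\<xi> \<in> hom G circle \<inter> extensional (carrier G). continuous_map (topo G) (topo circle) \<xi>}"

text \<open>The sets below are a subbasis of the compact-open topology; \<open>K = {}\<close> shows that they
  cover all characters.\<close>

definition dual :: "('a, 'b) tgroup_scheme \<Rightarrow> ('a \<Rightarrow> complex) tgroup" where
  "dual G =
     \<lparr>carrier = characters G,
      mult = (\<lambda>\<xi> \<psi>. \<lambda>g\<in>carrier G. \<xi> g * \<psi> g),
      one = (\<lambda>g\<in>carrier G. 1),
      topo = topology_generated_by
        {{\<xi> \<in> characters G. \<xi> ` K \<subseteq> U} | K U. compactin (topo G) K \<and> openin (topo circle) U}\<rparr>"

definition canonical_map ::
    "('a, 'b) tgroup_scheme \<Rightarrow> 'a \<Rightarrow> ('a \<Rightarrow> complex) \<Rightarrow> complex" where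
  "canonical_map G g = (\<lambda>\<xi>\<in>carrier (dual G). \<xi> g)"

definition reflexive :: "('a, 'b) tgroup_scheme \<Rightarrow> bool" where
  "reflexive G \<longleftrightarrow> topological_iso G (dual (dual G)) (canonical_map G)"

definition polar :: "('a, 'b) tgroup_scheme \<Rightarrow> 'a set \<Rightarrow> ('a \<Rightarrow> complex) set" where
  "polar G A = {\<xi> \<in> carrier (dual G). \<forall>h\<in>A. Re (\<xi> h) \<ge> 0}"

definition quasi_convex :: "('a, 'b) tgroup_scheme \<Rightarrow> 'a set \<Rightarrow> bool" where
  "quasi_convex G A \<longleftrightarrow>
     A \<subseteq> carrier G \<and> (\<forall>g\<in>carrier G - A. \<exists>\<xi>\<in>polar G A. Re (\<xi> g) < 0)"

text \<open>Neighbourhoods need not be open.\<close>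

definition locally_quasi_convex :: "('a, 'b) tgroup_scheme \<Rightarrow> bool" where
  "locally_quasi_convex G \<longleftrightarrow>
     (\<forall>U. openin (topo G) U \<and> \<one>\<^bsub>G\<^esub> \<in> U \<longrightarrow>
        (\<exists>A V. quasi_convex G A \<and> openin (topo G) V \<and> \<one>\<^bsub>G\<^esub> \<in> V \<and> V \<subseteq> A \<and> A \<subseteq> U))"


section \<open>Groups of quasi-invariance\<close>

definition borel_of :: "'a topology \<Rightarrow> 'a measure" where
  "borel_of T = sigma (topspace T) {U. openin T U}"

text \<open>For Borel \<open>E\<close> the value on \<open>E\<close> is \<open>\<mu> {x. g x \<in> E} = \<mu> (g\<inverse> E)\<close>.\<close>

definition translate_measure :: "('a, 'b) tgroup_scheme \<Rightarrow> 'a measure \<Rightarrow> 'a \<Rightarrow> 'a measure" where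
  "translate_measure X \<mu> g = distr \<mu> \<mu> (\<lambda>x. g \<otimes>\<^bsub>X\<^esub> x)"

definition equivalent_measures :: "'a measure \<Rightarrow> 'a measure \<Rightarrow> bool" where
  "equivalent_measures M N \<longleftrightarrow> absolutely_continuous M N \<and> absolutely_continuous N M"

definition mutually_singular :: "'a measure \<Rightarrow> 'a measure \<Rightarrow> bool" where
  "mutually_singular M N \<longleftrightarrow>
     (\<exists>E \<in> sets M \<inter> sets N. emeasure M E = 0 \<and> emeasure N (space N - E) = 0)"

definition quasi_invariance_set :: "('a, 'b) tgroup_scheme \<Rightarrow> 'a measure \<Rightarrow> 'a set" where
  "quasi_invariance_set X \<mu> =
     {g \<in> carrier X. equivalent_measures (translate_measure X \<mu> g) \<mu>}"

text \<open>HOL cannot quantify over types inside a formula, so the type of the elements of the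
  ambient group \<open>X\<close> is a parameter. In a statement \<open>\<not> QI_group TYPE('x) G\<close> the free type
  variable is universally quantified, so this excludes every \<open>X\<close>.\<close>

definition QI_group :: "'x itself \<Rightarrow> ('a, 'b) tgroup_scheme \<Rightarrow> bool" where
  "QI_group TYPE('x) G \<longleftrightarrow>
     polish_group G \<and>
     (\<exists>(X :: 'x tgroup) \<mu> \<iota>.
        polish_group X \<and> locally_compact_space (topo X) \<and>
        sets \<mu> = sets (borel_of (topo X)) \<and> prob_space \<mu> \<and>
        \<iota> \<in> hom G X \<and> inj_on \<iota> (carrier G) \<and> continuous_map (topo G) (topo X) \<iota> \<and>
        quasi_invariance_set X \<mu> = \<iota> ` carrier G \<and>
        (\<forall>g \<in> carrier X - quasi_invariance_set X \<mu>.
           mutually_singular (translate_measure X \<mu> g) \<mu>))"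


section \<open>The groups of sequences in the circle\<close>

text \<open>Sequences are indexed from 0.\<close>

definition TH_carrier :: "real \<Rightarrow> (nat \<Rightarrow> complex) set" where
  "TH_carrier p = {z. (\<forall>n. cmod (z n) = 1) \<and> summable (\<lambda>n. cmod (1 - z n) powr p)}"

definition TH_dist :: "real \<Rightarrow> (nat \<Rightarrow> complex) \<Rightarrow> (nat \<Rightarrow> complex) \<Rightarrow> real" where
  "TH_dist p z w = (\<Sum>n. cmod (z n - w n) powr p) powr (1 / p)"

definition TH :: "real \<Rightarrow> (nat \<Rightarrow> complex) tgroup" where
  "TH p = \<lparr>carrier = TH_carrier p, mult = (\<lambda>z w n. z n * w n), one = (\<lambda>n. 1),
           topo = Metric_space.mtopology (TH_carrier p) (TH_dist p)\<rparr>"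

definition TH0_carrier :: "(nat \<Rightarrow> complex) set" where
  "TH0_carrier = {z. (\<forall>n. cmod (z n) = 1) \<and> z \<longlonglongrightarrow> 1}"

text \<open>\<open>Metric_space\<close> requires non-negativity for all arguments, while the supremum of an unbounded
  set of reals is unspecified; hence the case distinction.\<close>

definition TH0_dist :: "(nat \<Rightarrow> complex) \<Rightarrow> (nat \<Rightarrow> complex) \<Rightarrow> real" where
  "TH0_dist z w =
     (if z \<in> TH0_carrier \<and> w \<in> TH0_carrier then (SUP n. cmod (z n - w n)) else 0)"

definition TH0 :: "(nat \<Rightarrow> complex) tgroup" where
  "TH0 = \<lparr>carrier = TH0_carrier, mult = (\<lambda>z w n. z n * w n), one = (\<lambda>n. 1),
          topo = Metric_space.mtopology TH0_carrier TH0_dist\<rparr>"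


section \<open>The groups of integer sequences\<close>

definition Zb :: "(nat \<Rightarrow> int) monoid" where
  "Zb = \<lparr>carrier = {a. \<exists>B. \<forall>k. \<bar>a k\<bar> \<le> B}, mult = (\<lambda>a b k. a k + b k), one = (\<lambda>k. 0)\<rparr>"

definition Z0 :: "(nat \<Rightarrow> int) monoid" where
  "Z0 = \<lparr>carrier = {a. finite {k. a k \<noteq> 0}}, mult = (\<lambda>a b k. a k + b k), one = (\<lambda>k. 0)\<rparr>"

definition unit_seq :: "nat \<Rightarrow> nat \<Rightarrow> int" where
  "unit_seq n = (\<lambda>k. if k = n then 1 else 0)"

definition null_group_topology :: "'a monoid \<Rightarrow> (nat \<Rightarrow> 'a) \<Rightarrow> 'a topology \<Rightarrow> bool" where
  "null_group_topology G u T \<longleftrightarrow>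
     topological_group (with_topology G T) \<and> Hausdorff_space T \<and> limitin T u \<one>\<^bsub>G\<^esub> sequentially"

definition finest_null_group_topology :: "'a monoid \<Rightarrow> (nat \<Rightarrow> 'a) \<Rightarrow> 'a topology \<Rightarrow> bool" where
  "finest_null_group_topology G u T \<longleftrightarrow>
     null_group_topology G u T \<and>
     (\<forall>S. null_group_topology G u S \<longrightarrow> (\<forall>U. openin S U \<longrightarrow> openin T U))"

lemma finest_null_group_topology_unique:
  assumes "finest_null_group_topology G u S" "finest_null_group_topology G u T"
  shows "S = T"
  using assms unfolding finest_null_group_topology_def by (metis topology_eq)

definition Z0_character :: "(nat \<Rightarrow> int) \<Rightarrow> (nat \<Rightarrow> complex) \<Rightarrow> complex" where
  "Z0_character a = (\<lambda>z\<in>carrier TH0. \<Prod>k | a k \<noteq> 0. z k powi a k)"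

end

(*
  For a flat group G (TH0, or TH p with p > 1) every character is a finitely supported integer vector a, and
  testing a against angle vectors t with |t k| <= w k and sum |t k| <= 2 shows that the compact-open topology
  is given by the neighbourhoods {a. sum |a k| w k < 1}, w a null sequence. This does not depend on G, and it
  is the finest group topology with unit_seq n -> 0 by a halving argument on neighbourhoods of 0. It also bounds
  the l1-norm on the polar of each ball of TH p, so that (cis s, ..., cis s, 1, ...) lies in the bipolar of the
  ball for a fixed s and any number of entries; hence TH p is not locally quasi-convex.

  TH0 and TH 1 are reflexive because their topologies are recovered from the compact sets {unit_seq n} + {0}
  and {0,1}^N of characters; for the latter, if all subproducts of a finite family in the circle are close to 1,
  then the total length of the arguments is small.

  If TH0 were a group of quasi-invariance in X, then by lower semicontinuity of total variation the image of TH0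
  would be a countable union of closed subsets of X, so by Baire one of them contains a translate of a ball. By
  local compactness the image of the infinite product (cis c) on I, c = 2 pi / m, is approximated by elements of
  this closed set for every set I of indices, so that the limit is the image of an m-torsion element of TH0. There
  are only countably many of these, but the limits for different I cannot be covered by countably many points.
*)
theory Submission
  imports Defs
begin

section \<open>Topological groups and the compact-open topology\<close>

text \<open>Local quasi-convexity holds in every dual group, so its failure for \<open>TH p\<close>
  excludes reflexivity; behind this is the bound |w^2 - 1| >= sqrt 2 |w - 1| for unit w with Re w >=
  0. Flatness is what separates p > 1 from p = 1: for angles bounded by c one has |t|^p <= c^(p-1)
  |t|, so vectors of bounded l1-norm become small in l^p as c does, whereas in l^1 they do not.
  Accordingly a character of \<open>TH 1\<close> is constrained in one coordinate at a time only,
  and all bounded exponent sequences survive. The l1-bound 2 on test vectors exceeds pi/2, the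
  largest phase that a sign condition on real parts allows; 4 bounds the difference of two test
  vectors. In the last part X is an arbitrary locally compact Polish group, so the only handle on it
  is a sequence that stays in a compact neighbourhood of 1. Angles 2 pi / m are used because their
  products over arbitrary index sets have order dividing m, a property that limits inherit. The
  dichotomy between quasi-invariance and singularity is what puts the closed sets inside the image
  of \<open>TH0\<close>.\<close>

lemma topological_groupD:
  assumes "topological_group G"
  shows "group G" "topspace (topo G) = carrier G"
    "continuous_map (prod_topology (topo G) (topo G)) (topo G) (\<lambda>(x, y). x \<otimes>\<^bsub>G\<^esub> y)"
    "continuous_map (topo G) (topo G) (\<lambda>x. inv\<^bsub>G\<^esub> x)"
  using assms by (auto simp: topological_group_def)

lemma continuous_map_group_mult:
  assumes "topological_group G" "continuous_map X (topo G) f" "continuous_map X (topo G) g"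
  shows "continuous_map X (topo G) (\<lambda>x. f x \<otimes>\<^bsub>G\<^esub> g x)"
  using continuous_map_compose[OF continuous_map_pairedI[OF assms(2,3)]
      topological_groupD(3)[OF assms(1)]]
  by (simp add: o_def)

lemma continuous_map_left_mult:
  assumes "topological_group G" "a \<in> carrier G"
  shows "continuous_map (topo G) (topo G) (\<lambda>x. a \<otimes>\<^bsub>G\<^esub> x)"
  using assms by (intro continuous_map_group_mult) (auto simp: topological_groupD(2))

lemma continuous_map_right_mult:
  assumes "topological_group G" "a \<in> carrier G"
  shows "continuous_map (topo G) (topo G) (\<lambda>x. x \<otimes>\<^bsub>G\<^esub> a)"
  using assms by (intro continuous_map_group_mult) (auto simp: topological_groupD(2))

lemma continuous_map_nat_pow:
  assumes "topological_group G"
  shows "continuous_map (topo G) (topo G) (\<lambda>x. x [^]\<^bsub>G\<^esub> (n::nat))"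
proof (induction n)
  case 0
  interpret group G using assms by (rule topological_groupD)
  show ?case by (simp add: topological_groupD(2)[OF assms])
next
  case (Suc n)
  interpret group G using assms by (rule topological_groupD)
  show ?case
    using continuous_map_group_mult[OF assms Suc, of "\<lambda>x. x"] by simp
qed

text \<open>Left translations are homeomorphisms, so a neighbourhood found at the identity can be
  carried to every point. Used for adjoints, canonical maps and their inverses.\<close>

lemma hom_continuous_at_one:
  assumes G: "topological_group G" and H: "topological_group H" and f: "f \<in> hom G H"
    and 1: "\<And>V. openin (topo H) V \<Longrightarrow> \<one>\<^bsub>H\<^esub> \<in> V \<Longrightarrow>
       \<exists>U. openin (topo G) U \<and> \<one>\<^bsub>G\<^esub> \<in> U \<and> f ` U \<subseteq> V"
  shows "continuous_map (topo G) (topo H) f"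
proof -
  interpret G: group G using G by (rule topological_groupD)
  interpret H: group H using H by (rule topological_groupD)
  interpret group_hom G H f
    using f by unfold_locales
  note tG = topological_groupD(2)[OF G] and tH = topological_groupD(2)[OF H]
  have "\<exists>U. openin (topo G) U \<and> x \<in> U \<and> (\<forall>y\<in>U. f y \<in> V)"
    if x: "x \<in> carrier G" and V: "openin (topo H) V" "f x \<in> V" for x V
  proof -
    define V' where "V' = {y \<in> topspace (topo H). f x \<otimes>\<^bsub>H\<^esub> y \<in> V}"
    have "openin (topo H) V'"
      unfolding V'_def
      by (rule openin_continuous_map_preimage[OF continuous_map_left_mult[OF H] V(1)]) (use x in auto)
    moreover have "\<one>\<^bsub>H\<^esub> \<in> V'"
      using x V by (simp add: V'_def tH)
    ultimately obtain U where U: "openin (topo G) U" "\<one>\<^bsub>G\<^esub> \<in> U" "f ` U \<subseteq> V'"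
      using 1 by blast
    define U' where "U' = {y \<in> topspace (topo G). inv\<^bsub>G\<^esub> x \<otimes>\<^bsub>G\<^esub> y \<in> U}"
    have "openin (topo G) U'"
      unfolding U'_def
      by (rule openin_continuous_map_preimage[OF continuous_map_left_mult[OF G] U(1)]) (use x in auto)
    moreover have "x \<in> U'"
      using x U by (simp add: U'_def tG)
    moreover have "f y \<in> V" if y: "y \<in> U'" for y
    proof -
      have yG: "y \<in> carrier G" and "f (inv\<^bsub>G\<^esub> x \<otimes>\<^bsub>G\<^esub> y) \<in> V'"
        using y U by (auto simp: U'_def tG)
      then have "f x \<otimes>\<^bsub>H\<^esub> (inv\<^bsub>H\<^esub> (f x) \<otimes>\<^bsub>H\<^esub> f y) \<in> V"
        using x by (simp add: V'_def)
      then show ?thesis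
        using x yG by (simp flip: H.m_assoc)
    qed
    ultimately show ?thesis by blast
  qed
  then show ?thesis
    unfolding continuous_map_eq_topcontinuous_at topcontinuous_at_def
    using f by (auto simp: tG tH hom_def)
qed

lemma topological_isoI:
  assumes "topspace (topo G) = carrier G" "topspace (topo H) = carrier H"
    and "f \<in> hom G H" "continuous_map (topo G) (topo H) f" "continuous_map (topo H) (topo G) g"
    and "\<And>x. x \<in> carrier G \<Longrightarrow> g (f x) = x" "\<And>y. y \<in> carrier H \<Longrightarrow> f (g y) = y"
  shows "topological_iso G H f"
proof -
  have "homeomorphic_maps (topo G) (topo H) f g"
    using assms by (simp add: homeomorphic_maps_def)
  then have *: "homeomorphic_map (topo G) (topo H) f"
    by (rule homeomorphic_maps_imp_map)
  then have "bij_betw f (carrier G) (carrier H)"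
    using homeomorphic_imp_injective_map[OF *] homeomorphic_imp_surjective_map[OF *] assms(1,2)
    by (simp add: bij_betw_def)
  with * assms show ?thesis
    by (simp add: topological_iso_def iso_def)
qed

lemma topological_isoE:
  assumes iso: "topological_iso G H f" and G: "group G"
    and tG: "topspace (topo G) = carrier G" and tH: "topspace (topo H) = carrier H"
  obtains g where "topological_iso H G g" "f \<in> hom G H" "g \<in> hom H G"
    "continuous_map (topo G) (topo H) f" "continuous_map (topo H) (topo G) g"
    "\<And>x. x \<in> carrier G \<Longrightarrow> g (f x) = x" "\<And>y. y \<in> carrier H \<Longrightarrow> f (g y) = y"
proof -
  let ?g = "inv_into (carrier G) f"
  have f: "f \<in> iso G H" and h: "homeomorphic_map (topo G) (topo H) f"
    using iso by (auto simp: topological_iso_def)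
  have b: "bij_betw f (carrier G) (carrier H)" and fh: "f \<in> hom G H"
    using f by (auto simp: iso_def)
  have gh: "?g \<in> hom H G"
    using group.iso_set_sym[OF G f] by (simp add: iso_def)
  \<comment> \<open>The topological inverse \<open>k\<close> may differ from \<open>inv_into\<close>
    off the carrier; on it the two agree, which gives one inverse that is both a homomorphism and
    continuous.\<close>
  obtain k where k: "homeomorphic_maps (topo G) (topo H) f k"
    using h homeomorphic_map_maps by blast
  have eq: "k y = ?g y" if "y \<in> carrier H" for y
  proof -
    have "k y \<in> carrier G" "f (k y) = y"
      using k that tG tH by (auto simp: homeomorphic_maps_def continuous_map_def)
    then show ?thesis
      using b by (metis bij_betw_inv_into_left)
  qed
  have cg: "continuous_map (topo H) (topo G) ?g"
    using k eq by (auto simp: homeomorphic_maps_def tH intro: continuous_map_eq)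
  have fg: "?g (f x) = x" if "x \<in> carrier G" for x
    using b that by (rule bij_betw_inv_into_left)
  have gf: "f (?g y) = y" if "y \<in> carrier H" for y
    using b that by (rule bij_betw_inv_into_right)
  have cf: "continuous_map (topo G) (topo H) f"
    using h by (rule homeomorphic_imp_continuous_map)
  have "topological_iso H G ?g"
    by (rule topological_isoI[OF tH tG gh cg cf gf fg])
  with that[of ?g] gh fh cg cf fg gf show thesis by blast
qed

lemma topological_iso_trans:
  assumes "topological_iso G H f" "topological_iso H K g"
  shows "topological_iso G K (g \<circ> f)"
  using assms homeomorphic_map_compose
  by (auto simp: topological_iso_def intro: iso_set_trans)

text \<open>Compositions built from inverses agree with \<open>canonical_map\<close> only on the
  carrier, and values elsewhere are irrelevant to being an isomorphism.\<close>

lemma topological_iso_cong: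
  assumes iso: "topological_iso G H f" and eq: "\<And>x. x \<in> carrier G \<Longrightarrow> f x = g x"
    and tG: "topspace (topo G) = carrier G" and G: "group G"
  shows "topological_iso G H g"
proof -
  have "homeomorphic_map (topo G) (topo H) g"
    using iso homeomorphic_map_eq[of "topo G" "topo H" f g] eq tG by (auto simp: topological_iso_def)
  moreover have "f \<in> iso G H" using iso by (simp add: topological_iso_def)
  then have "bij_betw g (carrier G) (carrier H)" "f \<in> hom G H"
    using eq by (auto simp: iso_def cong: bij_betw_cong)
  moreover have "g \<in> hom G H"
    using \<open>f \<in> hom G H\<close> eq group.is_monoid[OF G]
    by (auto simp: hom_def Pi_def monoid.m_closed)
  ultimately show ?thesis by (simp add: topological_iso_def iso_def)
qed

section \<open>The circle group and characters\<close>

lemma topspace_circle [simp]: "topspace (topo circle) = sphere 0 1"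
  and carrier_circle [simp]: "carrier circle = sphere 0 1"
  and mult_circle [simp]: "x \<otimes>\<^bsub>circle\<^esub> y = x * y"
  and one_circle [simp]: "\<one>\<^bsub>circle\<^esub> = 1"
  by (auto simp: circle_def)

lemma group_circle: "group circle"
proof (rule groupI)
  fix x assume x: "x \<in> carrier circle"
  then have "inverse x \<in> carrier circle" "inverse x * x = 1"
    by (auto simp: norm_inverse intro!: left_inverse)
  then show "\<exists>y\<in>carrier circle. y \<otimes>\<^bsub>circle\<^esub> x = \<one>\<^bsub>circle\<^esub>" by auto
qed (auto simp: norm_mult)

lemma continuous_map_circle:
  "continuous_map X (topo circle) f \<longleftrightarrow> continuous_map X euclidean f \<and> (\<forall>x\<in>topspace X. cmod (f x) = 1)"
  by (auto simp: circle_def continuous_map_in_subtopology)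

lemma characters_iff:
  assumes "topspace (topo G) = carrier G"
  shows "\<xi> \<in> characters G \<longleftrightarrow>
    \<xi> \<in> extensional (carrier G) \<and> (\<forall>x\<in>carrier G. cmod (\<xi> x) = 1) \<and>
    (\<forall>x\<in>carrier G. \<forall>y\<in>carrier G. \<xi> (x \<otimes>\<^bsub>G\<^esub> y) = \<xi> x * \<xi> y) \<and> continuous_map (topo G) euclidean \<xi>"
  using assms by (auto simp: characters_def hom_def continuous_map_circle)

lemma
  assumes "\<xi> \<in> characters G"
  shows character_norm: "x \<in> carrier G \<Longrightarrow> cmod (\<xi> x) = 1"
    and character_mult: "x \<in> carrier G \<Longrightarrow> y \<in> carrier G \<Longrightarrow> \<xi> (x \<otimes>\<^bsub>G\<^esub> y) = \<xi> x * \<xi> y"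
    and character_continuous: "continuous_map (topo G) euclidean \<xi>"
    and character_extensional: "\<xi> \<in> extensional (carrier G)"
  using assms by (auto simp: characters_def hom_def continuous_map_circle Pi_def)

lemma character_group_hom:
  assumes "group G" "\<xi> \<in> characters G"
  shows "group_hom G circle \<xi>"
  using assms group_circle by (auto simp: group_hom_def group_hom_axioms_def characters_def)

lemma character_one:
  assumes "group G" "\<xi> \<in> characters G"
  shows "\<xi> \<one>\<^bsub>G\<^esub> = 1"
  using group_hom.hom_one[OF character_group_hom[OF assms]] by simp

lemma pow_circle: "cmod x = 1 \<Longrightarrow> x [^]\<^bsub>circle\<^esub> (n::nat) = x ^ n"
  by (induction n) (auto simp: nat_pow_def circle_def)

lemma character_pow:
  assumes "group G" "\<xi> \<in> characters G" "x \<in> carrier G"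
  shows "\<xi> (x [^]\<^bsub>G\<^esub> (n::nat)) = \<xi> x ^ n"
  using group_hom.hom_nat_pow[OF character_group_hom[OF assms(1,2)] assms(3)] pow_circle
    character_norm[OF assms(2,3)] by simp

section \<open>Neighbourhoods in the compact-open topology\<close>

lemma carrier_dual [simp]: "carrier (dual G) = characters G"
  and mult_dual: "\<xi> \<otimes>\<^bsub>dual G\<^esub> \<psi> = (\<lambda>g\<in>carrier G. \<xi> g * \<psi> g)"
  and one_dual: "\<one>\<^bsub>dual G\<^esub> = (\<lambda>g\<in>carrier G. 1)"
  by (auto simp: dual_def)

text \<open>Uniform balls over compact sets. By \<open>openin_dual\<close> they describe the
  compact-open topology; that they contain an open set around the centre
  (\<open>char_near_open\<close>) is used in place of their openness.\<close>

definition char_near ::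
    "('a, 'b) tgroup_scheme \<Rightarrow> 'a set \<Rightarrow> ('a \<Rightarrow> complex) \<Rightarrow> real \<Rightarrow> ('a \<Rightarrow> complex) set" where
  "char_near G K \<xi> \<epsilon> = {\<psi> \<in> characters G. \<forall>g\<in>K. cmod (\<psi> g - \<xi> g) < \<epsilon>}"

lemma compactin_character_image:
  assumes "\<xi> \<in> characters G" "compactin (topo G) K"
  shows "compact (\<xi> ` K)"
  using image_compactin[OF assms(2) character_continuous[OF assms(1)]] by simp

text \<open>Cover the compact image of \<open>K\<close> under \<open>\<xi>\<close> by finitely many
  balls of radius \<open>\<epsilon>/4\<close>. The part of \<open>K\<close> that
  \<open>\<xi>\<close> sends into one of the closed balls is compact and gives a subbasic set; a
  character in all these sets stays within \<open>\<epsilon>/2 + \<epsilon>/4\<close> of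
  \<open>\<xi>\<close> on \<open>K\<close>.\<close>

lemma char_near_open:
  assumes \<xi>: "\<xi> \<in> characters G" and K: "compactin (topo G) K" and e: "\<epsilon> > 0"
  obtains S where "openin (topo (dual G)) S" "\<xi> \<in> S" "S \<subseteq> char_near G K \<xi> \<epsilon>"
proof -
  have "\<xi> ` K \<subseteq> (\<Union>c\<in>\<xi> ` K. ball c (\<epsilon>/4))"
    using e by force
  then obtain D where D: "D \<subseteq> \<xi> ` K" "finite D" "\<xi> ` K \<subseteq> (\<Union>c\<in>D. ball c (\<epsilon>/4))"
    using compactE_image[OF compactin_character_image[OF \<xi> K], of "\<xi> ` K" "\<lambda>c. ball c (\<epsilon>/4)"] by blast
  define Kc where "Kc c = K \<inter> {x \<in> topspace (topo G). \<xi> x \<in> cball c (\<epsilon>/4)}" for c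
  have Kc: "compactin (topo G) (Kc c)" for c
    unfolding Kc_def using character_continuous[OF \<xi>]
    by (intro compact_Int_closedin K closedin_continuous_map_preimage) auto
  define Sc where "Sc c = {\<psi> \<in> characters G. \<psi> ` Kc c \<subseteq> sphere 0 1 \<inter> ball c (\<epsilon>/2)}" for c
  \<comment> \<open>The subbasic set for the empty compact set keeps the intersection inside
    \<open>characters G\<close> when \<open>D\<close> is empty.\<close>
  define S where "S = \<Inter> (insert {\<psi> \<in> characters G. \<psi> ` {} \<subseteq> sphere 0 1} (Sc ` D))"
  have "openin (topo (dual G)) (Sc c)" for c
    unfolding dual_def tgroup.simps Sc_def
    by (rule topology_generated_by_Basis)
      (use Kc[of c] openin_open_Int[of "ball c (\<epsilon>/2)" "sphere 0 1"] in \<open>auto simp only: circle_def tgroup.simps open_ball\<close>)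
  moreover have "openin (topo (dual G)) {\<psi> \<in> characters G. \<psi> ` {} \<subseteq> sphere 0 1}"
    unfolding dual_def tgroup.simps
    by (rule topology_generated_by_Basis, rule CollectI, rule exI[of _ "{}"], rule exI[of _ "sphere 0 1"])
      (use openin_topspace[of "topo circle"] in auto)
  ultimately have "openin (topo (dual G)) S"
    unfolding S_def using D(2) by (intro openin_Inter) auto
  moreover have "\<xi> \<in> S"
    using \<xi> e character_norm[OF \<xi>] compactin_subset_topspace[OF K]
      continuous_map_image_subset_topspace[of "topo G" "topo circle" \<xi>]
    by (auto simp: S_def Sc_def Kc_def characters_def continuous_map_def Pi_def dist_norm)
  moreover have "S \<subseteq> char_near G K \<xi> \<epsilon>"
  proof
    fix \<psi> assume \<psi>: "\<psi> \<in> S"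
    have "cmod (\<psi> g - \<xi> g) < \<epsilon>" if g: "g \<in> K" for g
    proof -
      obtain c where c: "c \<in> D" "\<xi> g \<in> ball c (\<epsilon>/4)" using D(3) g by blast
      then have "g \<in> Kc c"
        using g compactin_subset_topspace[OF K] by (auto simp: Kc_def)
      then have "\<psi> g \<in> ball c (\<epsilon>/2)" using \<psi> c(1) by (auto simp: S_def Sc_def image_subset_iff simp del: mem_ball)
      then have "dist (\<psi> g) (\<xi> g) < \<epsilon>"
        using c(2) dist_triangle[of "\<psi> g" "\<xi> g" c] e by (simp add: dist_commute)
      then show ?thesis by (simp add: dist_norm)
    qed
    then show "\<psi> \<in> char_near G K \<xi> \<epsilon>"
      using \<psi> by (auto simp: char_near_def S_def)
  qed
  ultimately show thesis using that by blast
qed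

text \<open>One direction is \<open>char_near_open\<close>. The other is an induction on the
  generation of the topology: a subbasic set contains a uniform ball because the compact image of
  \<open>K\<close> has a positive distance from the complement of \<open>T\<close>, and
  intersections are handled by uniting the compact sets.\<close>

lemma openin_dual:
  "openin (topo (dual G)) S \<longleftrightarrow>
     S \<subseteq> characters G \<and>
     (\<forall>\<xi>\<in>S. \<exists>K \<epsilon>. compactin (topo G) K \<and> \<epsilon> > 0 \<and> char_near G K \<xi> \<epsilon> \<subseteq> S)"
    (is "_ \<longleftrightarrow> ?P S")
proof
  assume "?P S"
  then have "\<exists>T. openin (topo (dual G)) T \<and> \<xi> \<in> T \<and> T \<subseteq> S" if "\<xi> \<in> S" for \<xi>
    using that char_near_open[of \<xi> G] by (metis subset_iff)
  then show "openin (topo (dual G)) S"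
    by (subst openin_subopen) blast
next
  assume "openin (topo (dual G)) S"
  then have "generate_topology_on
      {{\<xi> \<in> characters G. \<xi> ` K \<subseteq> U} | K U. compactin (topo G) K \<and> openin (topo circle) U} S"
    by (simp add: dual_def openin_topology_generated_by_iff)
  then show "?P S"
  proof induction
    case Empty
    then show ?case by simp
  next
    case (Int a b)
    show ?case
    proof (intro conjI ballI)
      fix \<xi> assume "\<xi> \<in> a \<inter> b"
      then obtain K1 e1 K2 e2 where *: "compactin (topo G) K1" "e1 > 0" "char_near G K1 \<xi> e1 \<subseteq> a"
        "compactin (topo G) K2" "e2 > 0" "char_near G K2 \<xi> e2 \<subseteq> b"
        using Int.IH by (meson IntD1 IntD2)
      have "char_near G (K1 \<union> K2) \<xi> (min e1 e2) \<subseteq> char_near G K1 \<xi> e1 \<inter> char_near G K2 \<xi> e2"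
        by (auto simp: char_near_def)
      then show "\<exists>K \<epsilon>. compactin (topo G) K \<and> \<epsilon> > 0 \<and> char_near G K \<xi> \<epsilon> \<subseteq> a \<inter> b"
        using * by (intro exI[of _ "K1 \<union> K2"] exI[of _ "min e1 e2"]) (auto intro: compactin_Un)
    qed (use Int.IH in auto)
  next
    case (UN A)
    then show ?case by (meson Sup_least Union_iff Sup_upper order_trans)
  next
    case (Basis s)
    then obtain K U where s: "s = {\<xi> \<in> characters G. \<xi> ` K \<subseteq> U}"
      and K: "compactin (topo G) K" and U: "openin (topo circle) U" by blast
    obtain T where T: "open T" "U = sphere 0 1 \<inter> T"
      using U by (auto simp: circle_def openin_open)
    have "\<exists>\<epsilon>>0. char_near G K \<xi> \<epsilon> \<subseteq> s" if "\<xi> \<in> s" for \<xi>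
    proof -
      have \<xi>: "\<xi> \<in> characters G" "\<xi> ` K \<subseteq> T" using that T s by auto
      obtain e where e: "e > 0" "(\<Union>x\<in>\<xi> ` K. ball x e) \<subseteq> T"
        using compact_subset_open_imp_ball_epsilon_subset[OF compactin_character_image[OF \<xi>(1) K] T(1) \<xi>(2)]
        by metis
      have "char_near G K \<xi> e \<subseteq> s"
      proof
        fix \<psi> assume \<psi>: "\<psi> \<in> char_near G K \<xi> e"
        then have "\<psi> g \<in> ball (\<xi> g) e" if "g \<in> K" for g
          using that by (auto simp: char_near_def dist_norm norm_minus_commute)
        then have "\<psi> g \<in> T" if "g \<in> K" for g
          using that e(2) by blast
        moreover have "\<psi> g \<in> sphere 0 1" if "g \<in> K" for g
          using \<psi> that compactin_subset_topspace[OF K]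
          by (auto simp: char_near_def characters_def continuous_map_def Pi_def)
        ultimately show "\<psi> \<in> s"
          using \<psi> T(2) by (auto simp: s char_near_def)
      qed
      with e(1) show ?thesis by blast
    qed
    with K show ?case by (auto simp: s)
  qed
qed

lemma topspace_dual [simp]: "topspace (topo (dual G)) = characters G"
proof
  show "topspace (topo (dual G)) \<subseteq> characters G"
    using openin_dual[of G "topspace (topo (dual G))"] by auto
  have "openin (topo (dual G)) (characters G)"
    by (subst openin_dual) (auto simp: char_near_def intro!: exI[of _ "{}"] exI[of _ 1])
  then show "characters G \<subseteq> topspace (topo (dual G))" by (rule openin_subset)
qed

section \<open>The dual as a topological group\<close>

lemma dual_mult_character:
  assumes "topological_group G" "\<xi> \<in> characters G" "\<psi> \<in> characters G"
  shows "(\<lambda>g\<in>carrier G. \<xi> g * \<psi> g) \<in> characters G"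
proof -
  interpret group G using assms(1) by (rule topological_groupD)
  note t = topological_groupD(2)[OF assms(1)]
  have "continuous_map (topo G) euclidean ((\<lambda>(x::complex, y). x * y) \<circ> (\<lambda>g. (\<xi> g, \<psi> g)))"
    using assms(2,3)[THEN character_continuous]
    by (intro continuous_map_compose[of _ "prod_topology euclidean euclidean"] continuous_map_pairedI)
      (auto simp: euclidean_product_topology case_prod_beta intro!: continuous_intros)
  then have "continuous_map (topo G) euclidean (\<lambda>g. \<xi> g * \<psi> g)"
    by (simp add: o_def)
  then have "continuous_map (topo G) euclidean (\<lambda>g\<in>carrier G. \<xi> g * \<psi> g)"
    by (rule continuous_map_eq) (simp add: t)
  then show ?thesis
    using assms(2,3) by (auto simp: characters_iff t norm_mult)
qed

lemma dual_one_character: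
  assumes "topological_group G"
  shows "(\<lambda>g\<in>carrier G. 1) \<in> characters G"
proof -
  interpret group G using assms(1) by (rule topological_groupD)
  note t = topological_groupD(2)[OF assms(1)]
  have "continuous_map (topo G) euclidean (\<lambda>g\<in>carrier G. 1::complex)"
    by (rule continuous_map_eq[of _ _ "\<lambda>g. 1"]) (simp_all add: t)
  then show ?thesis
    by (auto simp: characters_iff t)
qed

lemma dual_cnj_character:
  assumes "topological_group G" "\<xi> \<in> characters G"
  shows "(\<lambda>g\<in>carrier G. cnj (\<xi> g)) \<in> characters G"
proof -
  interpret group G using assms(1) by (rule topological_groupD)
  note t = topological_groupD(2)[OF assms(1)]
  have "continuous_map (topo G) euclidean (cnj \<circ> \<xi>)"
    using character_continuous[OF assms(2)]
    by (rule continuous_map_compose) (simp add: continuous_on_cnj continuous_on_id)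
  then have "continuous_map (topo G) euclidean (\<lambda>g\<in>carrier G. cnj (\<xi> g))"
    by (rule continuous_map_eq) (simp add: t)
  then show ?thesis
    using assms(2) by (auto simp: characters_iff t)
qed

lemma cnj_mult_self: "cmod z = 1 \<Longrightarrow> cnj z * z = 1"
  using complex_norm_square[of z] by (simp add: mult.commute)

lemma
  assumes G: "topological_group G"
  shows comm_group_dual: "comm_group (dual G)"
    and inv_dual: "\<xi> \<in> characters G \<Longrightarrow> inv\<^bsub>dual G\<^esub> \<xi> = (\<lambda>g\<in>carrier G. cnj (\<xi> g))"
proof -
  have left_inv: "(\<lambda>g\<in>carrier G. cnj (\<xi> g)) \<otimes>\<^bsub>dual G\<^esub> \<xi> = \<one>\<^bsub>dual G\<^esub>" if "\<xi> \<in> characters G" for \<xi>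
    using that by (auto simp: mult_dual one_dual fun_eq_iff cnj_mult_self character_norm)
  show *: "comm_group (dual G)"
  proof (rule comm_groupI)
    fix \<xi> assume "\<xi> \<in> carrier (dual G)"
    then show "\<exists>\<psi>\<in>carrier (dual G). \<psi> \<otimes>\<^bsub>dual G\<^esub> \<xi> = \<one>\<^bsub>dual G\<^esub>"
      using left_inv dual_cnj_character[OF G] by (intro bexI[of _ "\<lambda>g\<in>carrier G. cnj (\<xi> g)"]) auto
    show "\<one>\<^bsub>dual G\<^esub> \<otimes>\<^bsub>dual G\<^esub> \<xi> = \<xi>"
      using \<open>\<xi> \<in> carrier (dual G)\<close> character_extensional[of \<xi> G]
      by (intro extensionalityI[of _ "carrier G"]) (auto simp: mult_dual one_dual)
  next
    interpret G: group G using G by (rule topological_groupD)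
    fix \<xi> \<psi> \<eta> assume "\<xi> \<in> carrier (dual G)" "\<psi> \<in> carrier (dual G)" "\<eta> \<in> carrier (dual G)"
    show "\<xi> \<otimes>\<^bsub>dual G\<^esub> \<psi> \<otimes>\<^bsub>dual G\<^esub> \<eta> = \<xi> \<otimes>\<^bsub>dual G\<^esub> (\<psi> \<otimes>\<^bsub>dual G\<^esub> \<eta>)"
      by (auto simp: mult_dual fun_eq_iff)
  qed (use dual_mult_character[OF G] dual_one_character[OF G] in
      \<open>auto simp: mult_dual one_dual mult.commute\<close>)
  interpret comm_group "dual G" by (rule *)
  show "inv\<^bsub>dual G\<^esub> \<xi> = (\<lambda>g\<in>carrier G. cnj (\<xi> g))" if "\<xi> \<in> characters G"
    using inv_equality[OF left_inv[OF that]] that dual_cnj_character[OF G] by simp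
qed

text \<open>Values of characters have modulus 1, so multiplication is 1-Lipschitz in each factor and
  half of \<open>e\<close> over the same compact set suffices; inversion is conjugation and
  preserves distances.\<close>

lemma topological_group_dual:
  assumes G: "topological_group G"
  shows "topological_group (dual G)"
proof -
  interpret G: group G using G by (rule topological_groupD)
  interpret D: comm_group "dual G" using G by (rule comm_group_dual)
  have sub: "x \<in> carrier G" if "compactin (topo G) K" "x \<in> K" for K x
    using that compactin_subset_topspace topological_groupD(2)[OF G] by fastforce
  have "\<exists>U V. openin (topo (dual G)) U \<and> openin (topo (dual G)) V \<and> \<xi> \<in> U \<and> \<psi> \<in> V \<and>
      (\<forall>u\<in>U. \<forall>v\<in>V. u \<otimes>\<^bsub>dual G\<^esub> v \<in> S)"
    if S: "openin (topo (dual G)) S" and c: "\<xi> \<in> characters G" "\<psi> \<in> characters G"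
      and in_S: "\<xi> \<otimes>\<^bsub>dual G\<^esub> \<psi> \<in> S" for S \<xi> \<psi>
  proof -
    obtain K e where K: "compactin (topo G) K" "e > 0" "char_near G K (\<xi> \<otimes>\<^bsub>dual G\<^esub> \<psi>) e \<subseteq> S"
      using S in_S by (auto simp: openin_dual)
    obtain U where U: "openin (topo (dual G)) U" "\<xi> \<in> U" "U \<subseteq> char_near G K \<xi> (e/2)"
      using char_near_open[OF c(1) K(1), of "e/2"] K(2) by auto
    obtain V where V: "openin (topo (dual G)) V" "\<psi> \<in> V" "V \<subseteq> char_near G K \<psi> (e/2)"
      using char_near_open[OF c(2) K(1), of "e/2"] K(2) by auto
    have "u \<otimes>\<^bsub>dual G\<^esub> v \<in> S" if "u \<in> U" "v \<in> V" for u v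
    proof -
      have u: "u \<in> characters G" "\<And>g. g \<in> K \<Longrightarrow> cmod (u g - \<xi> g) < e/2"
        and v: "v \<in> characters G" "\<And>g. g \<in> K \<Longrightarrow> cmod (v g - \<psi> g) < e/2"
        using that U(3) V(3) by (auto simp: char_near_def)
      have "cmod (u g * v g - \<xi> g * \<psi> g) < e" if g: "g \<in> K" for g
      proof -
        have "u g * v g - \<xi> g * \<psi> g = u g * (v g - \<psi> g) + (u g - \<xi> g) * \<psi> g"
          by (simp add: algebra_simps)
        also have "cmod \<dots> \<le> cmod (v g - \<psi> g) + cmod (u g - \<xi> g)"
          using character_norm[OF u(1) sub[OF K(1) g]] character_norm[OF c(2) sub[OF K(1) g]]
          by (metis (no_types, lifting) mult.right_neutral mult_1 norm_mult norm_triangle_ineq)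
        finally show ?thesis using u(2)[OF g] v(2)[OF g] by simp
      qed
      then have "u \<otimes>\<^bsub>dual G\<^esub> v \<in> char_near G K (\<xi> \<otimes>\<^bsub>dual G\<^esub> \<psi>) e"
        using dual_mult_character[OF G u(1) v(1)] sub[OF K(1)]
        by (auto simp: char_near_def mult_dual)
      with K(3) show ?thesis by blast
    qed
    with U V show ?thesis by blast
  qed
  note mult = this
  have "\<exists>U. openin (prod_topology (topo (dual G)) (topo (dual G))) U \<and> x \<in> U \<and>
        (\<forall>y\<in>U. (\<lambda>(\<xi>, \<psi>). \<xi> \<otimes>\<^bsub>dual G\<^esub> \<psi>) y \<in> S)"
    if x: "x \<in> characters G \<times> characters G" and S: "openin (topo (dual G)) S"
      "(\<lambda>(\<xi>, \<psi>). \<xi> \<otimes>\<^bsub>dual G\<^esub> \<psi>) x \<in> S" for x S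
  proof -
    obtain U V where "openin (topo (dual G)) U" "openin (topo (dual G)) V" "fst x \<in> U" "snd x \<in> V"
      "\<forall>u\<in>U. \<forall>v\<in>V. u \<otimes>\<^bsub>dual G\<^esub> v \<in> S"
      using mult[OF S(1), of "fst x" "snd x"] x S(2) by (auto simp: case_prod_beta)
    then show ?thesis
      by (intro exI[of _ "U \<times> V"]) (auto simp: openin_prod_Times_iff mem_Times_iff)
  qed
  then have 1: "continuous_map (prod_topology (topo (dual G)) (topo (dual G))) (topo (dual G))
      (\<lambda>(\<xi>, \<psi>). \<xi> \<otimes>\<^bsub>dual G\<^esub> \<psi>)"
    unfolding continuous_map_eq_topcontinuous_at topcontinuous_at_def
    using D.m_closed by auto
  have 2: "continuous_map (topo (dual G)) (topo (dual G)) (\<lambda>\<xi>. inv\<^bsub>dual G\<^esub> \<xi>)"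
    unfolding continuous_map
  proof (intro conjI allI impI)
    fix S assume S: "openin (topo (dual G)) S"
    let ?T = "{\<xi> \<in> topspace (topo (dual G)). inv\<^bsub>dual G\<^esub> \<xi> \<in> S}"
    show "openin (topo (dual G)) ?T"
      unfolding openin_dual
    proof (intro conjI ballI)
      fix \<xi> assume "\<xi> \<in> ?T"
      then have \<xi>: "\<xi> \<in> characters G" "inv\<^bsub>dual G\<^esub> \<xi> \<in> S" by auto
      obtain K e where K: "compactin (topo G) K" "e > 0" "char_near G K (inv\<^bsub>dual G\<^esub> \<xi>) e \<subseteq> S"
        using S \<xi> by (auto simp: openin_dual)
      have "inv\<^bsub>dual G\<^esub> \<psi> \<in> S" if "\<psi> \<in> char_near G K \<xi> e" for \<psi>
      proof -
        have "cmod (cnj (\<psi> g) - cnj (\<xi> g)) < e" if "g \<in> K" for g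
          using that \<open>\<psi> \<in> char_near G K \<xi> e\<close>
          by (metis (mono_tags, lifting) char_near_def complex_cnj_diff complex_mod_cnj mem_Collect_eq)
        then have "inv\<^bsub>dual G\<^esub> \<psi> \<in> char_near G K (inv\<^bsub>dual G\<^esub> \<xi>) e"
          using that dual_cnj_character[OF G] \<xi> sub[OF K(1)]
          by (auto simp: char_near_def inv_dual[OF G])
        with K(3) show ?thesis by blast
      qed
      then show "\<exists>K \<epsilon>. compactin (topo G) K \<and> \<epsilon> > 0 \<and> char_near G K \<xi> \<epsilon> \<subseteq> ?T"
        using K by (intro exI[of _ K] exI[of _ e]) (auto simp: char_near_def)
    qed auto
  qed (use D.inv_closed in auto)
  show ?thesis
    unfolding topological_group_def using 1 2 D.is_group by simp
qed

section \<open>Adjoint homomorphisms\<close>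

definition dual_map :: "('a, 'b) tgroup_scheme \<Rightarrow> ('a \<Rightarrow> 'c) \<Rightarrow> ('c \<Rightarrow> complex) \<Rightarrow> 'a \<Rightarrow> complex" where
  "dual_map G f \<chi>' = (\<lambda>g\<in>carrier G. \<chi>' (f g))"

text \<open>Continuity of the adjoint: \<open>f\<close> maps a compact set \<open>K\<close> to a
  compact set, and a character close to 1 on the image has an adjoint close to 1 on
  \<open>K\<close>.\<close>

lemma
  assumes G: "topological_group G" and H: "topological_group H"
    and f: "f \<in> hom G H" "continuous_map (topo G) (topo H) f"
  shows dual_map_character: "\<xi> \<in> characters H \<Longrightarrow> dual_map G f \<xi> \<in> characters G"
    and dual_map_hom: "dual_map G f \<in> hom (dual H) (dual G)"
    and dual_map_continuous: "continuous_map (topo (dual H)) (topo (dual G)) (dual_map G f)"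
proof -
  interpret G: group G using G by (rule topological_groupD)
  note tG = topological_groupD(2)[OF G] and tH = topological_groupD(2)[OF H]
  have fc: "f g \<in> carrier H" if "g \<in> carrier G" for g
    using f(1) that by (auto simp: hom_def)
  have fm: "f (x \<otimes>\<^bsub>G\<^esub> y) = f x \<otimes>\<^bsub>H\<^esub> f y" if "x \<in> carrier G" "y \<in> carrier G" for x y
    using f(1) that by (auto simp: hom_def)
  show ch: "dual_map G f \<xi> \<in> characters G" if "\<xi> \<in> characters H" for \<xi>
  proof -
    have "continuous_map (topo G) euclidean (\<xi> \<circ> f)"
      using f(2) character_continuous[OF that] by (rule continuous_map_compose)
    then have "continuous_map (topo G) euclidean (dual_map G f \<xi>)"
      by (rule continuous_map_eq) (simp add: tG dual_map_def)
    then show ?thesis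
      using that fc fm by (auto simp: characters_iff tG tH dual_map_def)
  qed
  show hom: "dual_map G f \<in> hom (dual H) (dual G)"
    using ch fc by (auto simp: hom_def mult_dual dual_map_def fun_eq_iff)
  show "continuous_map (topo (dual H)) (topo (dual G)) (dual_map G f)"
  proof (rule hom_continuous_at_one[OF topological_group_dual[OF H] topological_group_dual[OF G] hom])
    fix V assume "openin (topo (dual G)) V" "\<one>\<^bsub>dual G\<^esub> \<in> V"
    then obtain K e where K: "compactin (topo G) K" "e > 0" "char_near G K \<one>\<^bsub>dual G\<^esub> e \<subseteq> V"
      by (auto simp: openin_dual)
    have sub: "K \<subseteq> carrier G"
      using compactin_subset_topspace[OF K(1)] tG by simp
    have "compactin (topo H) (f ` K)"
      using image_compactin[OF K(1) f(2)] .
    moreover have "\<one>\<^bsub>dual H\<^esub> \<in> characters H"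
      using dual_one_character[OF H] by (simp add: one_dual)
    ultimately obtain U where U: "openin (topo (dual H)) U" "\<one>\<^bsub>dual H\<^esub> \<in> U"
      "U \<subseteq> char_near H (f ` K) \<one>\<^bsub>dual H\<^esub> e"
      using char_near_open K(2) by metis
    have "dual_map G f \<xi> \<in> char_near G K \<one>\<^bsub>dual G\<^esub> e" if "\<xi> \<in> U" for \<xi>
    proof -
      have \<xi>: "\<xi> \<in> characters H" "\<And>g. g \<in> K \<Longrightarrow> cmod (\<xi> (f g) - \<one>\<^bsub>dual H\<^esub> (f g)) < e"
        using U(3) that by (auto simp: char_near_def)
      then show ?thesis
        using ch sub fc by (auto simp: char_near_def dual_map_def one_dual subset_iff)
    qed
    with U K(3) show "\<exists>U. openin (topo (dual H)) U \<and> \<one>\<^bsub>dual H\<^esub> \<in> U \<and> dual_map G f ` U \<subseteq> V"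
      by blast
  qed
qed

lemma character_eqI:
  assumes "\<xi> \<in> characters G" "\<psi> \<in> characters G" "\<And>g. g \<in> carrier G \<Longrightarrow> \<xi> g = \<psi> g"
  shows "\<xi> = \<psi>"
  using assms character_extensional by (intro extensionalityI[of _ "carrier G"]) auto

lemma topological_iso_dual:
  assumes G: "topological_group G" and H: "topological_group H" and iso: "topological_iso G H f"
  shows "topological_iso (dual H) (dual G) (dual_map G f)"
proof -
  obtain g where g: "f \<in> hom G H" "g \<in> hom H G"
    "continuous_map (topo G) (topo H) f" "continuous_map (topo H) (topo G) g"
    "\<And>x. x \<in> carrier G \<Longrightarrow> g (f x) = x" "\<And>y. y \<in> carrier H \<Longrightarrow> f (g y) = y"
    using topological_isoE[OF iso] G H by (metis topological_groupD(1,2))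
  have fc: "f x \<in> carrier H" if "x \<in> carrier G" for x using g(1) that by (auto simp: hom_def)
  have gc: "g x \<in> carrier G" if "x \<in> carrier H" for x using g(2) that by (auto simp: hom_def)
  show ?thesis
  proof (rule topological_isoI[where g="dual_map H g"])
    fix \<xi> assume \<xi>: "\<xi> \<in> carrier (dual H)"
    then show "dual_map H g (dual_map G f \<xi>) = \<xi>"
      by (intro character_eqI[of _ H] dual_map_character[OF G H g(1,3)] dual_map_character[OF H G g(2,4)])
        (auto simp: dual_map_def gc g)
  next
    fix \<xi> assume \<xi>: "\<xi> \<in> carrier (dual G)"
    then show "dual_map G f (dual_map H g \<xi>) = \<xi>"
      by (intro character_eqI[of _ G] dual_map_character[OF G H g(1,3)] dual_map_character[OF H G g(2,4)])
        (auto simp: dual_map_def fc g)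
  qed (use dual_map_hom[OF G H g(1,3)] dual_map_continuous[OF G H g(1,3)] dual_map_continuous[OF H G g(2,4)] in auto)
qed

section \<open>The canonical map into the bidual\<close>

lemma canonical_map_apply: "\<xi> \<in> characters G \<Longrightarrow> canonical_map G g \<xi> = \<xi> g"
  by (simp add: canonical_map_def)

text \<open>Evaluation at \<open>g\<close> is continuous because singletons are compact.\<close>

lemma
  assumes G: "topological_group G"
  shows canonical_map_character: "g \<in> carrier G \<Longrightarrow> canonical_map G g \<in> characters (dual G)"
    and canonical_map_hom: "canonical_map G \<in> hom G (dual (dual G))"
proof -
  interpret G: group G using G by (rule topological_groupD)
  interpret D: comm_group "dual G" using G by (rule comm_group_dual)
  note tG = topological_groupD(2)[OF G]
  note T = topological_group_dual[OF G]
  show ch: "canonical_map G g \<in> characters (dual G)" if g: "g \<in> carrier G" for g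
  proof -
    have "continuous_map (topo (dual G)) euclidean (\<lambda>\<xi>. \<xi> g)"
      unfolding continuous_map_eq_topcontinuous_at topcontinuous_at_def
    proof (intro ballI conjI allI impI)
      fix \<xi> V assume \<xi>: "\<xi> \<in> topspace (topo (dual G))" and V: "openin euclidean V \<and> \<xi> g \<in> V"
      then obtain e where e: "e > 0" "ball (\<xi> g) e \<subseteq> V"
        by (auto simp: open_contains_ball)
      obtain U where "openin (topo (dual G)) U" "\<xi> \<in> U" "U \<subseteq> char_near G {g} \<xi> e"
        using char_near_open[of \<xi> G "{g}" e] \<xi> e g tG by auto
      moreover have "\<psi> g \<in> V" if "\<psi> \<in> char_near G {g} \<xi> e" for \<psi>
        using that e(2) by (auto simp: char_near_def dist_norm norm_minus_commute subset_iff)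
      ultimately show "\<exists>U. openin (topo (dual G)) U \<and> \<xi> \<in> U \<and> (\<forall>y\<in>U. y g \<in> V)" by blast
    qed auto
    then have "continuous_map (topo (dual G)) euclidean (canonical_map G g)"
      by (rule continuous_map_eq) (simp add: canonical_map_apply)
    then show ?thesis
      using g D.m_closed character_norm
      by (auto simp: characters_iff canonical_map_def mult_dual)
  qed
  show "canonical_map G \<in> hom G (dual (dual G))"
    using ch by (auto simp: hom_def mult_dual canonical_map_def fun_eq_iff character_mult)
qed

text \<open>Continuity amounts to equicontinuity of a compact set \<open>C\<close> of characters at
  the identity. In a metrizable group a failure produces a sequence \<open>g\<close> converging to
  1; together with its limit it is compact, so \<open>C\<close> is covered by finitely many uniform
  balls over it, and the finitely many centres tend to 1 simultaneously along
  \<open>g\<close>.\<close>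

lemma canonical_map_continuous:
  assumes G: "topological_group G" and met: "metrizable_space (topo G)"
  shows "continuous_map (topo G) (topo (dual (dual G))) (canonical_map G)"
proof (rule hom_continuous_at_one[OF G topological_group_dual[OF topological_group_dual[OF G]] canonical_map_hom[OF G]])
  interpret G: group G using G by (rule topological_groupD)
  note tG = topological_groupD(2)[OF G]
  obtain M d where "Metric_space M d" and topo: "topo G = Metric_space.mtopology M d"
    using met by (auto simp: metrizable_space_def)
  then interpret Metric_space M d by simp
  have M: "M = carrier G"
    using tG topo by simp
  fix V assume "openin (topo (dual (dual G))) V" "\<one>\<^bsub>dual (dual G)\<^esub> \<in> V"
  then obtain C e where C: "compactin (topo (dual G)) C" "e > 0"
    "char_near (dual G) C \<one>\<^bsub>dual (dual G)\<^esub> e \<subseteq> V"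
    by (auto simp: openin_dual[of "dual G"])
  have C_sub: "C \<subseteq> characters G"
    using compactin_subset_topspace[OF C(1)] by simp
  have "\<exists>r>0. \<forall>g\<in>mball \<one>\<^bsub>G\<^esub> r. \<forall>\<xi>\<in>C. cmod (\<xi> g - 1) < e"
  proof (rule ccontr)
    assume contr: "\<not> ?thesis"
    have "\<exists>g\<in>mball \<one>\<^bsub>G\<^esub> (inverse (Suc n)). \<exists>\<xi>\<in>C. \<not> cmod (\<xi> g - 1) < e" for n
      using contr by (metis inverse_positive_iff_positive of_nat_0_less_iff zero_less_Suc)
    then obtain g \<xi> where g: "\<And>n. g n \<in> mball \<one>\<^bsub>G\<^esub> (inverse (Suc n))"
      and \<xi>: "\<And>n. \<xi> n \<in> C" "\<And>n. \<not> cmod (\<xi> n (g n) - 1) < e"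
      by metis
    have gM: "range g \<subseteq> M" using g by auto
    have lim: "limitin mtopology g \<one>\<^bsub>G\<^esub> sequentially"
      unfolding limitin_metric_dist_null
    proof (intro conjI)
      show "((\<lambda>n. d (g n) \<one>\<^bsub>G\<^esub>) \<longlongrightarrow> 0) sequentially"
      proof (rule tendsto_sandwich[OF _ _ tendsto_const LIMSEQ_inverse_real_of_nat])
        show "\<forall>\<^sub>F n in sequentially. d (g n) \<one>\<^bsub>G\<^esub> \<le> inverse (real (Suc n))"
          using g by (auto simp: commute less_imp_le)
      qed simp
    qed (use gM M in \<open>auto simp: image_subset_iff\<close>)
    have K: "compactin (topo G) (insert \<one>\<^bsub>G\<^esub> (range g))"
      using compactin_sequence_with_limit[OF lim] gM topo by simp
    have "\<exists>U. openin (topo (dual G)) U \<and> \<eta> \<in> U \<and> U \<subseteq> char_near G (insert \<one>\<^bsub>G\<^esub> (range g)) \<eta> (e/2)"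
      if "\<eta> \<in> C" for \<eta>
      using char_near_open[OF _ K, of \<eta> "e/2"] that C C_sub by (metis half_gt_zero subsetD)
    then obtain U where U: "\<And>\<eta>. \<eta> \<in> C \<Longrightarrow> openin (topo (dual G)) (U \<eta>)" "\<And>\<eta>. \<eta> \<in> C \<Longrightarrow> \<eta> \<in> U \<eta>"
       "\<And>\<eta>. \<eta> \<in> C \<Longrightarrow> U \<eta> \<subseteq> char_near G (insert \<one>\<^bsub>G\<^esub> (range g)) \<eta> (e/2)"
      by metis
    have "C \<subseteq> \<Union>(U ` C)" "\<And>S. S \<in> U ` C \<Longrightarrow> openin (topo (dual G)) S"
      using U(1,2) by auto
    then obtain F where F: "finite F" "F \<subseteq> U ` C" "C \<subseteq> \<Union>F"
      using compactinD[OF C(1), of "U ` C"] by auto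
    then obtain D where D: "finite D" "D \<subseteq> C" "C \<subseteq> (\<Union>\<eta>\<in>D. U \<eta>)"
      by (metis finite_subset_image)
    have "\<forall>\<^sub>F n in sequentially. cmod (\<eta> (g n) - 1) < e/2" if "\<eta> \<in> D" for \<eta>
    proof -
      have \<eta>: "\<eta> \<in> characters G" using that D C_sub by auto
      have "limitin euclidean (\<eta> \<circ> g) (\<eta> \<one>\<^bsub>G\<^esub>) sequentially"
        using continuous_map_limit[OF character_continuous[OF \<eta>]] lim topo by simp
      then have "(\<lambda>n. \<eta> (g n)) \<longlonglongrightarrow> 1"
        using character_one[OF G.is_group \<eta>] by (simp add: o_def)
      then show ?thesis
        using tendstoD[of "\<lambda>n. \<eta> (g n)" 1 sequentially "e/2"] C(2) by (simp add: dist_norm)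
    qed
    then have "\<forall>\<^sub>F n in sequentially. \<forall>\<eta>\<in>D. cmod (\<eta> (g n) - 1) < e/2"
      using D(1) by (simp add: eventually_ball_finite)
    then obtain n where n: "\<And>\<eta>. \<eta> \<in> D \<Longrightarrow> cmod (\<eta> (g n) - 1) < e/2"
      by (auto simp: eventually_sequentially)
    obtain \<eta> where \<eta>: "\<eta> \<in> D" "\<xi> n \<in> U \<eta>" using D(3) \<xi>(1) by blast
    then have "cmod (\<xi> n (g n) - \<eta> (g n)) < e/2"
      using U(3)[of \<eta>] D(2) by (auto simp: char_near_def subset_iff)
    with n[OF \<eta>(1)] have "cmod (\<xi> n (g n) - 1) < e"
      using norm_triangle_ineq[of "\<xi> n (g n) - \<eta> (g n)" "\<eta> (g n) - 1"] by simp
    with \<xi>(2) show False by blast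
  qed
  then obtain r where r: "r > 0" "\<And>g \<xi>. g \<in> mball \<one>\<^bsub>G\<^esub> r \<Longrightarrow> \<xi> \<in> C \<Longrightarrow> cmod (\<xi> g - 1) < e"
    by blast
  have "canonical_map G g \<in> char_near (dual G) C \<one>\<^bsub>dual (dual G)\<^esub> e" if g: "g \<in> mball \<one>\<^bsub>G\<^esub> r" for g
  proof -
    have "canonical_map G g \<in> characters (dual G)"
      using canonical_map_character[OF G, of g] iffD1[OF in_mball g] M by blast
    moreover have "cmod (canonical_map G g \<xi> - \<one>\<^bsub>dual (dual G)\<^esub> \<xi>) < e" if "\<xi> \<in> C" for \<xi>
      using r(2)[OF g that] C_sub that by (auto simp: canonical_map_def one_dual[of "dual G"])
    ultimately show ?thesis by (simp add: char_near_def)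
  qed
  then have "canonical_map G ` mball \<one>\<^bsub>G\<^esub> r \<subseteq> V" using C(3) by blast
  then show "\<exists>U. openin (topo G) U \<and> \<one>\<^bsub>G\<^esub> \<in> U \<and> canonical_map G ` U \<subseteq> V"
    using r(1) G.one_closed unfolding topo M[symmetric] by (intro exI[of _ "mball \<one>\<^bsub>G\<^esub> r"]) simp
qed

text \<open>Naturality: transporting \<open>canonical_map G\<close> along \<open>f\<close> and its
  second adjoint gives \<open>canonical_map H\<close>.\<close>

lemma reflexive_topological_iso:
  assumes G: "topological_group G" and H: "topological_group H"
    and iso: "topological_iso G H f" and refl: "reflexive G"
  shows "reflexive H"
proof -
  note tG = topological_groupD(2)[OF G] and tH = topological_groupD(2)[OF H]
  obtain g where g: "topological_iso H G g" "g \<in> hom H G" "\<And>y. y \<in> carrier H \<Longrightarrow> f (g y) = y"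
    using topological_isoE[OF iso topological_groupD(1)[OF G] tG tH] by metis
  have gc: "g y \<in> carrier G" if "y \<in> carrier H" for y
    using g(2) that by (auto simp: hom_def)
  have f: "f \<in> hom G H" "continuous_map (topo G) (topo H) f"
    using iso by (auto simp: topological_iso_def iso_def homeomorphic_imp_continuous_map)
  have "topological_iso G (dual (dual G)) (canonical_map G)"
    using refl by (simp add: reflexive_def)
  moreover have "topological_iso (dual (dual G)) (dual (dual H)) (dual_map (dual H) (dual_map G f))"
    using topological_iso_dual[OF topological_group_dual[OF H] topological_group_dual[OF G]]
      topological_iso_dual[OF G H iso] by blast
  ultimately have "topological_iso H (dual (dual H)) (dual_map (dual H) (dual_map G f) \<circ> (canonical_map G \<circ> g))"
    using topological_iso_trans[OF topological_iso_trans[OF g(1)]] by blast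
  moreover have "(dual_map (dual H) (dual_map G f) \<circ> (canonical_map G \<circ> g)) y = canonical_map H y"
    if "y \<in> carrier H" for y
    using that g(3) gc dual_map_character[OF G H f]
    by (auto simp: dual_map_def canonical_map_def fun_eq_iff)
  ultimately show ?thesis
    unfolding reflexive_def
    by (rule topological_iso_cong) (use topological_groupD[OF H] in auto)
qed

text \<open>The triangle identity makes the adjoint of \<open>canonical_map G\<close> a left inverse
  of \<open>canonical_map (dual G)\<close>. For reflexive \<open>G\<close> this adjoint is a
  topological isomorphism, so the canonical map of the dual is its inverse.\<close>

lemma reflexive_dual:
  assumes G: "topological_group G" and refl: "reflexive G"
  shows "reflexive (dual G)"
proof -
  note T1 = topological_group_dual[OF G]
  note T3 = topological_group_dual[OF topological_group_dual[OF T1]]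
  note ch = canonical_map_character[OF T1]
  have "topological_iso (dual (dual (dual G))) (dual G) (dual_map G (canonical_map G))"
    using topological_iso_dual[OF G topological_group_dual[OF T1]] refl unfolding reflexive_def by blast
  then obtain g where g: "topological_iso (dual G) (dual (dual (dual G))) g"
      "\<And>x. x \<in> characters (dual (dual G)) \<Longrightarrow> g (dual_map G (canonical_map G) x) = x"
    using topological_isoE[OF _ topological_groupD(1)[OF T3]] by (metis carrier_dual topspace_dual)
  have "g \<xi> = canonical_map (dual G) \<xi>" if \<xi>: "\<xi> \<in> characters G" for \<xi>
  proof -
    have "dual_map G (canonical_map G) (canonical_map (dual G) \<xi>) = \<xi>"
      using \<xi> canonical_map_character[OF G] character_extensional[OF \<xi>]
      by (intro extensionalityI[of _ "carrier G"]) (auto simp: dual_map_def canonical_map_def)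
    then show ?thesis
      using g(2)[of "canonical_map (dual G) \<xi>"] ch[of \<xi>] \<xi> by simp
  qed
  then show ?thesis
    unfolding reflexive_def
    by (intro topological_iso_cong[OF g(1)]) (use topological_groupD[OF T1] in auto)
qed

section \<open>Local quasi-convexity of dual groups\<close>

lemma norm_diff_one_le_double:
  assumes "cmod w = 1" "Re w \<ge> 0"
  shows "sqrt 2 * cmod (w - 1) \<le> cmod (w ^ 2 - 1)"
proof -
  have "(cmod (w + 1))\<^sup>2 = (cmod w)\<^sup>2 + 2 * Re w + 1"
    unfolding cmod_power2 by (simp add: power2_eq_square algebra_simps)
  then have "(cmod (w + 1))\<^sup>2 \<ge> 2" using assms by simp
  then have "cmod (w + 1) \<ge> sqrt 2" by (rule real_le_lsqrt[rotated]) auto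
  moreover have "cmod (w ^ 2 - 1) = cmod (w + 1) * cmod (w - 1)"
    by (simp add: power2_eq_square algebra_simps flip: norm_mult)
  ultimately show ?thesis by (simp add: mult_right_mono)
qed

text \<open>In \<open>w ^ 2 - 1 = (w + 1) * (w - 1)\<close> the first factor has modulus at least
  \<open>sqrt 2\<close> when \<open>Re w \<ge> 0\<close>. So each squaring of a point of the right
  half-plane stretches its distance to 1 by that factor, while distances on the circle never exceed
  2.\<close>

lemma norm_diff_one_le_powers:
  assumes "cmod z = 1" "\<And>i. i < n \<Longrightarrow> Re (z ^ 2 ^ i) \<ge> 0"
  shows "sqrt 2 ^ n * cmod (z - 1) \<le> 2"
proof -
  have "sqrt 2 ^ n * cmod (z - 1) \<le> cmod (z ^ 2 ^ n - 1)"
    using assms(2)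
  proof (induction n)
    case (Suc n)
    have "sqrt 2 ^ Suc n * cmod (z - 1) \<le> sqrt 2 * cmod (z ^ 2 ^ n - 1)"
      using Suc by simp
    also have "\<dots> \<le> cmod ((z ^ 2 ^ n) ^ 2 - 1)"
      using Suc.prems[of n] assms(1) by (intro norm_diff_one_le_double) (auto simp: norm_power)
    finally show ?case by (simp add: mult.commute flip: power_mult)
  qed simp
  also have "\<dots> \<le> 2"
    using norm_triangle_ineq4[of "z ^ 2 ^ n" 1] assms(1) by (simp add: norm_power)
  finally show ?thesis .
qed

text \<open>The separating characters are the evaluations at points of \<open>K\<close>.\<close>

lemma polar_dual_quasi_convex:
  assumes G: "topological_group G" and K: "K \<subseteq> carrier G"
  shows "quasi_convex (dual G) (polar G K)"
  unfolding quasi_convex_def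
proof (intro conjI ballI)
  fix \<xi> assume "\<xi> \<in> carrier (dual G) - polar G K"
  then obtain g where g: "\<xi> \<in> characters G" "g \<in> K" "Re (\<xi> g) < 0"
    by (auto simp: polar_def not_le)
  then have "canonical_map G g \<in> polar (dual G) (polar G K)"
    using canonical_map_character[OF G, of g] K by (auto simp: polar_def canonical_map_def)
  moreover have "Re (canonical_map G g \<xi>) < 0" using g by (simp add: canonical_map_apply)
  ultimately show "\<exists>\<psi>\<in>polar (dual G) (polar G K). Re (\<psi> \<xi>) < 0" by blast
qed (auto simp: polar_def)

text \<open>A polar controls only signs of real parts. Adding the powers of the points of
  \<open>K\<close> with exponents \<open>2 ^ i\<close>, \<open>i < n\<close>, to the compact set
  turns this into control of distances, and polars are quasi-convex.\<close>

lemma locally_quasi_convex_dual: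
  assumes G: "topological_group G"
  shows "locally_quasi_convex (dual G)"
  unfolding locally_quasi_convex_def
proof (intro allI impI)
  interpret G: group G using G by (rule topological_groupD)
  note tG = topological_groupD(2)[OF G]
  fix U assume "openin (topo (dual G)) U \<and> \<one>\<^bsub>dual G\<^esub> \<in> U"
  then obtain K e where K: "compactin (topo G) K" "e > 0" "char_near G K \<one>\<^bsub>dual G\<^esub> e \<subseteq> U"
    by (auto simp: openin_dual)
  have K_sub: "K \<subseteq> carrier G" using compactin_subset_topspace[OF K(1)] tG by simp
  \<comment> \<open>\<open>2 / sqrt 2 ^ n\<close> is the distance bound provided by
    \<open>norm_diff_one_le_powers\<close>.\<close>
  obtain n where n: "2 / e < sqrt 2 ^ n"
    using real_arch_pow[of "sqrt 2" "2 / e"] by auto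
  define K' where "K' = (\<Union>i<n. (\<lambda>g. g [^]\<^bsub>G\<^esub> (2 ^ i :: nat)) ` K)"
  have "compactin (topo G) K'"
    unfolding K'_def
    by (intro compactin_Union) (auto intro: image_compactin[OF K(1) continuous_map_nat_pow[OF G]])
  moreover have one: "\<one>\<^bsub>dual G\<^esub> \<in> characters G"
    using dual_one_character[OF G] by (simp add: one_dual)
  ultimately obtain V where V: "openin (topo (dual G)) V" "\<one>\<^bsub>dual G\<^esub> \<in> V"
      "V \<subseteq> char_near G K' \<one>\<^bsub>dual G\<^esub> 1"
    using char_near_open[of "\<one>\<^bsub>dual G\<^esub>" G K' 1] by auto
  have K'_sub: "K' \<subseteq> carrier G" using K_sub by (auto simp: K'_def)
  have "V \<subseteq> polar G K'"
  proof
    fix \<xi> assume "\<xi> \<in> V"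
    then have \<xi>: "\<xi> \<in> characters G" "\<And>g. g \<in> K' \<Longrightarrow> cmod (\<xi> g - 1) < 1"
      using V(3) K'_sub by (auto simp: char_near_def one_dual subset_iff)
    have "Re (\<xi> g) \<ge> 0" if "g \<in> K'" for g
      using \<xi>(2)[OF that] abs_Re_le_cmod[of "\<xi> g - 1"] by simp
    then show "\<xi> \<in> polar G K'" using \<xi>(1) by (simp add: polar_def)
  qed
  moreover have "polar G K' \<subseteq> U"
  proof
    fix \<xi> assume "\<xi> \<in> polar G K'"
    then have \<xi>: "\<xi> \<in> characters G" "\<And>g. g \<in> K' \<Longrightarrow> Re (\<xi> g) \<ge> 0"
      by (auto simp: polar_def)
    have "cmod (\<xi> g - 1) < e" if g: "g \<in> K" for g
    proof -
      have gG: "g \<in> carrier G" using g K_sub by auto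
      have "Re (\<xi> g ^ 2 ^ i) \<ge> 0" if "i < n" for i
      proof -
        have "g [^]\<^bsub>G\<^esub> (2 ^ i :: nat) \<in> K'" using that g by (auto simp: K'_def)
        then show ?thesis
          using \<xi>(2) character_pow[OF G.is_group \<xi>(1) gG] by metis
      qed
      then have "sqrt 2 ^ n * cmod (\<xi> g - 1) \<le> 2"
        using norm_diff_one_le_powers character_norm[OF \<xi>(1) gG] by blast
      moreover have "sqrt 2 ^ n * e > 2" using n K(2) by (simp add: field_simps)
      ultimately have "sqrt 2 ^ n * cmod (\<xi> g - 1) < sqrt 2 ^ n * e" by linarith
      then show ?thesis by simp
    qed
    then have "\<xi> \<in> char_near G K \<one>\<^bsub>dual G\<^esub> e"
      using \<xi>(1) K_sub by (auto simp: char_near_def one_dual subset_iff)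
    then show "\<xi> \<in> U" using K(3) by blast
  qed
  ultimately show "\<exists>A V. quasi_convex (dual G) A \<and> openin (topo (dual G)) V \<and>
      \<one>\<^bsub>dual G\<^esub> \<in> V \<and> V \<subseteq> A \<and> A \<subseteq> U"
    using V polar_dual_quasi_convex[OF G K'_sub] by blast
qed

lemma quasi_convex_topological_iso:
  assumes G: "topological_group G" and H: "topological_group H"
    and iso: "topological_iso G H f" and A: "quasi_convex G A"
  shows "quasi_convex H (f ` A)"
proof -
  note tG = topological_groupD(2)[OF G] and tH = topological_groupD(2)[OF H]
  obtain g where g: "f \<in> hom G H" "g \<in> hom H G" "continuous_map (topo H) (topo G) g"
      "\<And>x. x \<in> carrier G \<Longrightarrow> g (f x) = x" "\<And>y. y \<in> carrier H \<Longrightarrow> f (g y) = y"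
    using topological_isoE[OF iso topological_groupD(1)[OF G] tG tH] by metis
  have gc: "g y \<in> carrier G" if "y \<in> carrier H" for y
    using g(2) that by (auto simp: hom_def)
  have fc: "f y \<in> carrier H" if "y \<in> carrier G" for y
    using g(1) that by (auto simp: hom_def)
  have AG: "A \<subseteq> carrier G" using A by (simp add: quasi_convex_def)
  show ?thesis
    unfolding quasi_convex_def
  proof (intro conjI ballI)
    fix y assume y: "y \<in> carrier H - f ` A"
    then have "g y \<in> carrier G - A" using gc g(5) by (metis Diff_iff image_eqI)
    then obtain \<xi> where \<xi>: "\<xi> \<in> polar G A" "Re (\<xi> (g y)) < 0"
      using A by (auto simp: quasi_convex_def)
    then have "dual_map H g \<xi> \<in> polar H (f ` A)"
      using dual_map_character[OF H G g(2,3)] AG fc g(4) by (auto simp: polar_def dual_map_def subset_iff)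
    moreover have "Re (dual_map H g \<xi> y) < 0" using \<xi> y by (simp add: dual_map_def)
    ultimately show "\<exists>\<xi>\<in>polar H (f ` A). Re (\<xi> y) < 0" by blast
  qed (use AG fc in auto)
qed

lemma locally_quasi_convex_topological_iso:
  assumes G: "topological_group G" and H: "topological_group H"
    and iso: "topological_iso G H f" and lqc: "locally_quasi_convex G"
  shows "locally_quasi_convex H"
  unfolding locally_quasi_convex_def
proof (intro allI impI)
  note tG = topological_groupD(2)[OF G] and tH = topological_groupD(2)[OF H]
  have f: "f \<in> hom G H" and hf: "homeomorphic_map (topo G) (topo H) f"
    using iso by (auto simp: topological_iso_def iso_def)
  have one: "f \<one>\<^bsub>G\<^esub> = \<one>\<^bsub>H\<^esub>"
    using f topological_groupD(1)[OF G] topological_groupD(1)[OF H] by (rule hom_one)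
  fix U assume U: "openin (topo H) U \<and> \<one>\<^bsub>H\<^esub> \<in> U"
  define U' where "U' = {x \<in> topspace (topo G). f x \<in> U}"
  have "openin (topo G) U'"
    unfolding U'_def using U hf homeomorphic_imp_continuous_map openin_continuous_map_preimage by metis
  moreover have "\<one>\<^bsub>G\<^esub> \<in> U'"
    using U one topological_groupD(1)[OF G] tG by (simp add: U'_def group.is_monoid monoid.one_closed)
  ultimately obtain A V where AV: "quasi_convex G A" "openin (topo G) V" "\<one>\<^bsub>G\<^esub> \<in> V" "V \<subseteq> A" "A \<subseteq> U'"
    using lqc unfolding locally_quasi_convex_def by meson
  have "openin (topo H) (f ` V)"
    using AV(2) hf homeomorphic_imp_open_map open_map_def by metis
  moreover have "\<one>\<^bsub>H\<^esub> \<in> f ` V" using AV(3) one by force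
  moreover have "f ` V \<subseteq> f ` A" "f ` A \<subseteq> U" using AV by (auto simp: U'_def)
  ultimately show "\<exists>A V. quasi_convex H A \<and> openin (topo H) V \<and> \<one>\<^bsub>H\<^esub> \<in> V \<and> V \<subseteq> A \<and> A \<subseteq> U"
    using quasi_convex_topological_iso[OF G H iso AV(1)] by blast
qed

text \<open>A reflexive group is topologically isomorphic to its bidual, which is the dual of a
  group.\<close>

lemma reflexive_imp_locally_quasi_convex:
  assumes G: "topological_group G" and refl: "reflexive G"
  shows "locally_quasi_convex G"
proof -
  note D1 = topological_group_dual[OF G]
  note D2 = topological_group_dual[OF D1]
  obtain g where "topological_iso (dual (dual G)) G g"
    using refl topological_isoE[OF _ topological_groupD(1)[OF G] topological_groupD(2)[OF G], of "dual (dual G)"]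
    unfolding reflexive_def by (metis carrier_dual topspace_dual)
  then show ?thesis
    by (rule locally_quasi_convex_topological_iso[OF D2 G _ locally_quasi_convex_dual[OF D1]])
qed

section \<open>Characters of the circle\<close>

text \<open>Integrating the functional equation over an interval of length \<open>c\<close> gives
  \<open>f x * k = F (x + c) - F x\<close> with the constant \<open>k = F c - F 0\<close>, so
  \<open>f\<close> is differentiable and its derivative is a multiple of \<open>f\<close>. The
  domain of \<open>F\<close> is longer by 1 to make room for the shift by \<open>c\<close>.\<close>

lemma continuous_exponential_eq_exp:
  fixes f :: "real \<Rightarrow> complex"
  assumes cont: "continuous_on UNIV f" and add: "\<And>s t. f (s + t) = f s * f t"
    and f0: "f 0 = 1" and L: "L \<ge> 0"
  obtains c where "\<And>t. t \<in> {0..L} \<Longrightarrow> f t = exp (c * of_real t)"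
proof -
  have "continuous_on {0..L + 1} f" using cont continuous_on_subset by blast
  then obtain F where F: "\<And>x. x \<in> {0..L + 1} \<Longrightarrow> (F has_vector_derivative f x) (at x within {0..L + 1})"
    by (rule antiderivative_continuous) (rule that)
  have F_sub: "(F has_vector_derivative f x) (at x within S)" if "x \<in> {0..L + 1}" "S \<subseteq> {0..L + 1}" for x S
    using F[OF that(1)] that(2) by (rule has_vector_derivative_within_subset)
  obtain c where c: "c \<in> {0..1}" "F c \<noteq> F 0"
  proof -
    \<comment> \<open>Otherwise the one-sided derivative of \<open>F\<close> at 0 would be both
      \<open>f 0 = 1\<close> and 0.\<close>
    have "\<not> (\<forall>c\<in>{0..1}. F c = F 0)"
    proof
      assume eq: "\<forall>c\<in>{0..1}. F c = F 0"
      have "(F has_vector_derivative f 0) (at 0 within {0..1})"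
        using L by (intro F_sub) auto
      moreover have "(F has_vector_derivative 0) (at 0 within {0..1})"
      proof (rule has_vector_derivative_transform[of 0 "{0..1}" F "\<lambda>_. F 0"])
        show "F x = F 0" if "x \<in> {0..1}" for x using eq that by blast
      qed auto
      ultimately have "f 0 = 0"
        by (intro vector_derivative_unique_within[of 0 "{0..1}" F]) (auto simp: trivial_limit_within islimpt_Icc)
      with f0 show False by simp
    qed
    with that show thesis by blast
  qed
  define k where "k = F c - F 0"
  have shift: "f x * k = F (x + c) - F x" if x: "x \<in> {0..L}" for x
  proof -
    define h where "h s = F (x + s) - f x * F s" for s
    have "(h has_vector_derivative 0) (at s within {0..c})" if s: "s \<in> {0..c}" for s
    proof -
      have "((F \<circ> (\<lambda>s. x + s)) has_vector_derivative (1 *\<^sub>R f (x + s))) (at s within {0..c})"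
        by (rule vector_diff_chain_within) (use x s c in \<open>auto intro!: derivative_eq_intros F_sub\<close>)
      moreover have "(F has_vector_derivative f s) (at s within {0..c})"
        using s c L by (intro F_sub) auto
      ultimately have "((\<lambda>s. (F \<circ> (\<lambda>s. x + s)) s - f x * F s) has_vector_derivative (1 *\<^sub>R f (x + s) - f x * f s))
          (at s within {0..c})"
        by (intro derivative_intros)
      then show ?thesis by (simp add: h_def[abs_def] add)
    qed
    then obtain e where e: "\<And>s. s \<in> {0..c} \<Longrightarrow> h s = e"
      using has_vector_derivative_zero_constant[of "{0..c}" h] by auto
    have "h c = h 0" using e[of c] e[of 0] c by simp
    then show ?thesis by (simp add: h_def k_def algebra_simps)
  qed
  have k: "k \<noteq> 0" using c by (simp add: k_def)
  define l where "l = (f c - 1) / k"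
  have der: "(f has_vector_derivative (l * f x)) (at x within {0..L})" if x: "x \<in> {0..L}" for x
  proof -
    have "((F \<circ> (\<lambda>s. s + c)) has_vector_derivative (1 *\<^sub>R f (x + c))) (at x within {0..L})"
      by (rule vector_diff_chain_within) (use x c in \<open>auto intro!: derivative_eq_intros F_sub\<close>)
    moreover have "(F has_vector_derivative f x) (at x within {0..L})"
      using x by (intro F_sub) auto
    ultimately have "((\<lambda>s. ((F \<circ> (\<lambda>s. s + c)) s - F s) / k) has_vector_derivative ((1 *\<^sub>R f (x + c) - f x) / k))
          (at x within {0..L})"
      by (intro derivative_intros)
    moreover have "(1 *\<^sub>R f (x + c) - f x) / k = l * f x"
      by (simp add: add l_def algebra_simps diff_divide_distrib)
    ultimately have "((\<lambda>s. ((F \<circ> (\<lambda>s. s + c)) s - F s) / k) has_vector_derivative (l * f x))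
          (at x within {0..L})" by simp
    moreover have "f y = ((F \<circ> (\<lambda>s. s + c)) y - F y) / k" if "y \<in> {0..L}" for y
      using shift[OF that] k by (simp add: field_simps)
    ultimately show ?thesis
      by (intro has_vector_derivative_transform[OF x, of f "\<lambda>s. ((F \<circ> (\<lambda>s. s + c)) s - F s) / k"])
  qed
  \<comment> \<open>Dividing \<open>f\<close> by the expected solution leaves a function with
    derivative 0.\<close>
  define h where "h t = exp (- l * of_real t) * f t" for t
  have "(h has_vector_derivative 0) (at x within {0..L})" if x: "x \<in> {0..L}" for x
  proof -
    have "((\<lambda>t. exp (- l * of_real t)) has_vector_derivative (- l * exp (- l * of_real x))) (at x within {0..L})"
      by (rule has_vector_derivative_real_field[of "\<lambda>z. exp (- l * z)"]) (auto intro!: derivative_eq_intros)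
    from has_vector_derivative_mult[OF this der[OF x]] show ?thesis
      by (simp add: h_def[abs_def] algebra_simps)
  qed
  then obtain e where e: "\<And>x. x \<in> {0..L} \<Longrightarrow> h x = e"
    using has_vector_derivative_zero_constant[of "{0..L}" h] by auto
  have "f t = exp (l * of_real t)" if "t \<in> {0..L}" for t
  proof -
    have "h t = h 0" using e[OF that] e[of 0] L by simp
    then show ?thesis by (simp add: h_def f0 exp_minus field_simps)
  qed
  with that show thesis by blast
qed

text \<open>Pulled back along \<open>cis\<close>, the map is an exponential on
  \<open>{0..2*pi}\<close>, an interval that already covers the circle. Its value 1 at
  \<open>2 * pi\<close> forces \<open>c\<close> to be \<open>\<i>\<close> times an integer.\<close>

lemma circle_endomorphism_powi:
  fixes \<phi> :: "complex \<Rightarrow> complex"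
  assumes cont: "continuous_on (sphere 0 1) \<phi>"
    and mult: "\<And>u v. cmod u = 1 \<Longrightarrow> cmod v = 1 \<Longrightarrow> \<phi> (u * v) = \<phi> u * \<phi> v"
    and nz: "\<phi> 1 \<noteq> 0"
  obtains m :: int where "\<And>u. cmod u = 1 \<Longrightarrow> \<phi> u = u powi m"
proof -
  have one: "\<phi> 1 = 1" using mult[of 1 1] nz by simp
  have "continuous_on UNIV (\<lambda>t. \<phi> (cis t))"
    by (intro continuous_on_compose2[OF cont] continuous_intros) auto
  then obtain c where c: "\<And>t. t \<in> {0..2*pi} \<Longrightarrow> \<phi> (cis t) = exp (c * of_real t)"
    using continuous_exponential_eq_exp[of "\<lambda>t. \<phi> (cis t)" "2 * pi"] mult one
    by (auto simp flip: cis_mult)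
  have "exp (c * of_real (2 * pi)) = 1"
    using c[of "2*pi"] one by simp
  then obtain m :: int where m: "Re (c * of_real (2 * pi)) = 0" "Im (c * of_real (2 * pi)) = of_int (2 * m) * pi"
    using exp_eq_1 by auto
  then have c_eq: "c = \<i> * of_int m"
    by (simp add: complex_eq_iff)
  have "\<phi> u = u powi m" if u1: "cmod u = 1" for u
  proof -
    obtain t where t: "0 \<le> t" "t < 2 * pi" "u = Complex (cos t) (sin t)"
      using complex_unimodular_polar[OF u1] by blast
    then have u: "u = cis t" by (simp add: complex_eq_iff)
    have "\<phi> u = cis (of_int m * t)"
      using c[of t] t(1,2) by (simp add: u c_eq cis_conv_exp algebra_simps)
    then show ?thesis by (simp add: u cis_power_int)
  qed
  with that show thesis by blast
qed

lemma norm_powi_unit: "cmod u = 1 \<Longrightarrow> cmod (u powi m) = 1"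
  by (simp add: norm_power_int)

lemma norm_power_diff_one_le:
  assumes "cmod u = 1"
  shows "cmod (u ^ n - 1) \<le> real n * cmod (u - 1)"
  using norm_power_diff[of u 1 n] assms by simp

lemma norm_powi_diff_one_le:
  assumes "cmod u = 1"
  shows "cmod (u powi m - 1) \<le> \<bar>of_int m\<bar> * cmod (u - 1)"
proof (cases "m \<ge> 0")
  case True
  then show ?thesis
    using norm_power_diff_one_le[OF assms, of "nat m"] by (simp add: power_int_def)
next
  case False
  have "cmod (inverse u - 1) = cmod (u - 1)"
  proof -
    have "u \<noteq> 0" using assms by auto
    then have "inverse u - 1 = - (u - 1) * inverse u" by (simp add: field_simps)
    then show ?thesis using assms by (simp add: norm_mult norm_inverse norm_minus_commute)
  qed
  then show ?thesis
    using norm_power_diff_one_le[of "inverse u" "nat (- m)"] assms False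
    by (simp add: power_int_def norm_inverse)
qed

lemma norm_prod_powi_diff_one_le:
  assumes "\<And>k. k \<in> F \<Longrightarrow> cmod (z k) = 1"
  shows "cmod ((\<Prod>k\<in>F. z k powi a k) - 1) \<le> (\<Sum>k\<in>F. \<bar>of_int (a k)\<bar> * cmod (z k - 1))"
proof -
  have "cmod ((\<Prod>k\<in>F. z k powi a k) - (\<Prod>k\<in>F. 1)) \<le> (\<Sum>k\<in>F. cmod (z k powi a k - 1))"
    using assms by (intro norm_prod_diff) (auto simp: norm_powi_unit)
  also have "\<dots> \<le> (\<Sum>k\<in>F. \<bar>of_int (a k)\<bar> * cmod (z k - 1))"
    using assms by (intro sum_mono norm_powi_diff_one_le)
  finally show ?thesis by simp
qed

section \<open>Groups of sequences in the circle\<close>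

definition single_seq :: "nat \<Rightarrow> complex \<Rightarrow> nat \<Rightarrow> complex" where
  "single_seq k u = (\<lambda>j. if j = k then u else 1)"

definition trunc :: "nat \<Rightarrow> (nat \<Rightarrow> complex) \<Rightarrow> nat \<Rightarrow> complex" where
  "trunc n z = (\<lambda>k. if k < n then z k else 1)"

text \<open>Common form of \<open>TH p\<close> and \<open>TH0\<close>, so that what depends only on
  a few properties of the metric is proved once.\<close>

definition seq_group :: "(nat \<Rightarrow> complex) set \<Rightarrow> ((nat \<Rightarrow> complex) \<Rightarrow> (nat \<Rightarrow> complex) \<Rightarrow> real) \<Rightarrow> (nat \<Rightarrow> complex) tgroup" where
  "seq_group C d = \<lparr>carrier = C, mult = (\<lambda>z w n. z n * w n), one = (\<lambda>n. 1), topo = Metric_space.mtopology C d\<rparr>"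

lemma seq_group_simps [simp]:
  "carrier (seq_group C d) = C" "z \<otimes>\<^bsub>seq_group C d\<^esub> w = (\<lambda>n. z n * w n)"
  "\<one>\<^bsub>seq_group C d\<^esub> = (\<lambda>n. 1)" "topo (seq_group C d) = Metric_space.mtopology C d"
  by (simp_all add: seq_group_def)

text \<open>\<open>coord_le\<close> and \<open>single_le\<close> make the coordinates and the
  coordinate embeddings of the circle continuous. Since truncations are nonexpansive and approximate
  the identity, characters are determined by their restrictions to single coordinates, and the
  approximation is uniform on compact sets.\<close>

locale circle_sequences = Metric_space C d
  for C :: "(nat \<Rightarrow> complex) set" and d :: "(nat \<Rightarrow> complex) \<Rightarrow> (nat \<Rightarrow> complex) \<Rightarrow> real" +
  assumes unit: "z \<in> C \<Longrightarrow> cmod (z k) = 1"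
    and one_mem: "(\<lambda>k. 1) \<in> C"
    and mult_mem: "z \<in> C \<Longrightarrow> w \<in> C \<Longrightarrow> (\<lambda>k. z k * w k) \<in> C"
    and cnj_mem: "z \<in> C \<Longrightarrow> (\<lambda>k. cnj (z k)) \<in> C"
    and single_mem: "cmod u = 1 \<Longrightarrow> single_seq k u \<in> C"
    and invariant: "x \<in> C \<Longrightarrow> z \<in> C \<Longrightarrow> w \<in> C \<Longrightarrow> d (\<lambda>k. x k * z k) (\<lambda>k. x k * w k) = d z w"
    and coord_le: "z \<in> C \<Longrightarrow> w \<in> C \<Longrightarrow> cmod (z k - w k) \<le> d z w"
    and single_le: "cmod u = 1 \<Longrightarrow> cmod v = 1 \<Longrightarrow> d (single_seq k u) (single_seq k v) \<le> cmod (u - v)"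
    and trunc_le: "z \<in> C \<Longrightarrow> w \<in> C \<Longrightarrow> d (trunc n z) (trunc n w) \<le> d z w"
    and trunc_tendsto: "z \<in> C \<Longrightarrow> (\<lambda>n. d (trunc n z) z) \<longlonglongrightarrow> 0"
begin

abbreviation G where "G \<equiv> seq_group C d"

lemma trunc_Suc: "trunc (Suc n) z = (\<lambda>k. trunc n z k * single_seq n (z n) k)"
  by (auto simp: trunc_def single_seq_def fun_eq_iff less_Suc_eq)

lemma trunc_mem: "z \<in> C \<Longrightarrow> trunc n z \<in> C"
proof (induction n)
  case 0
  then show ?case using one_mem by (simp add: trunc_def)
next
  case (Suc n)
  then show ?case unfolding trunc_Suc using mult_mem single_mem unit by blast
qed

lemma group_G: "group G"
proof (rule groupI)
  fix z assume z: "z \<in> carrier G"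
  then have "(\<lambda>k. cnj (z k)) \<otimes>\<^bsub>G\<^esub> z = \<one>\<^bsub>G\<^esub>"
    using unit by (auto simp: cnj_mult_self)
  then show "\<exists>y\<in>carrier G. y \<otimes>\<^bsub>G\<^esub> z = \<one>\<^bsub>G\<^esub>"
    using z cnj_mem by auto
qed (use one_mem mult_mem in \<open>auto simp: mult.assoc\<close>)

lemma inv_G: assumes "z \<in> C" shows "inv\<^bsub>G\<^esub> z = (\<lambda>k. cnj (z k))"
proof -
  have "(\<lambda>k. cnj (z k)) \<otimes>\<^bsub>G\<^esub> z = \<one>\<^bsub>G\<^esub>"
    using unit assms by (auto simp: cnj_mult_self)
  then show ?thesis
    using group.inv_equality[OF group_G] assms cnj_mem by auto
qed

lemma dist_one: assumes "z \<in> C" "w \<in> C" shows "d z w = d (\<lambda>k. cnj (w k) * z k) (\<lambda>k. 1)"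
proof -
  have "d z w = d (\<lambda>k. cnj (w k) * z k) (\<lambda>k. cnj (w k) * w k)"
    using invariant[OF cnj_mem[OF assms(2)] assms] by simp
  then show ?thesis using assms unit by (simp add: cnj_mult_self)
qed

lemma dist_mult:
  assumes "x \<in> C" "y \<in> C" "z \<in> C" "w \<in> C"
  shows "d (\<lambda>k. x k * y k) (\<lambda>k. z k * w k) \<le> d x z + d y w"
proof -
  have "d (\<lambda>k. x k * y k) (\<lambda>k. z k * w k) \<le> d (\<lambda>k. x k * y k) (\<lambda>k. x k * w k) + d (\<lambda>k. x k * w k) (\<lambda>k. z k * w k)"
    using assms mult_mem by (intro triangle) auto
  also have "d (\<lambda>k. x k * y k) (\<lambda>k. x k * w k) = d y w" using assms by (intro invariant)
  also have "d (\<lambda>k. x k * w k) (\<lambda>k. z k * w k) = d x z"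
    using invariant[of w x z] assms by (simp add: mult.commute)
  finally show ?thesis by simp
qed

lemma dist_cnj:
  assumes "z \<in> C" "w \<in> C"
  shows "d (\<lambda>k. cnj (z k)) (\<lambda>k. cnj (w k)) = d z w"
proof -
  have "d (\<lambda>k. (z k * w k) * cnj (z k)) (\<lambda>k. (z k * w k) * cnj (w k)) = d (\<lambda>k. cnj (z k)) (\<lambda>k. cnj (w k))"
    using assms by (intro invariant mult_mem cnj_mem)
  moreover have "z k * w k * cnj (z k) = w k" "z k * w k * cnj (w k) = z k" for k
    using cnj_mult_self[OF unit[OF assms(1)]] cnj_mult_self[OF unit[OF assms(2)]]
    by (simp_all add: mult.commute mult.left_commute)
  ultimately show ?thesis by (simp add: commute)
qed

lemma topological_group_G: "topological_group G"
proof -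
  interpret P: Metric_space12 C d C d by unfold_locales
  have "continuous_map (prod_topology mtopology mtopology) mtopology (\<lambda>(x, y). \<lambda>k. x k * y k)"
    unfolding P.mtopology_prod_metric[symmetric] P.Prod_metric.metric_continuous_map[OF Metric_space_axioms]
  proof (intro conjI ballI allI impI)
    fix p e assume p: "p \<in> C \<times> C" and e: "(0::real) < e"
    obtain a b where ab: "p = (a, b)" "a \<in> C" "b \<in> C" using p by auto
    show "\<exists>\<delta>>0. \<forall>q. q \<in> C \<times> C \<and> prod_dist d d p q < \<delta> \<longrightarrow>
        d ((\<lambda>(x, y). \<lambda>k. x k * y k) p) ((\<lambda>(x, y). \<lambda>k. x k * y k) q) < e"
    proof (intro exI[of _ "e/2"] conjI allI impI)
      fix q assume q: "q \<in> C \<times> C \<and> prod_dist d d p q < e/2"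
      obtain x y where xy: "q = (x, y)" "x \<in> C" "y \<in> C" using q by auto
      have "d a x \<le> prod_dist d d p q" "d b y \<le> prod_dist d d p q"
        unfolding ab(1) xy(1) prod_dist_def by simp_all
      then show "d ((\<lambda>(x, y). \<lambda>k. x k * y k) p) ((\<lambda>(x, y). \<lambda>k. x k * y k) q) < e"
        using dist_mult[OF ab(2,3) xy(2,3)] q by (simp add: ab xy)
    qed (use e in auto)
  qed (use mult_mem in auto)
  moreover have "continuous_map mtopology mtopology (\<lambda>z. inv\<^bsub>G\<^esub> z)"
    unfolding metric_continuous_map[OF Metric_space_axioms]
    using dist_cnj by (auto simp: inv_G cnj_mem)
  ultimately show ?thesis
    using group_G by (simp add: topological_group_def)
qed

lemma metrizable_G: "metrizable_space (topo G)"
  by (simp add: metrizable_space_mtopology)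

text \<open>Nonexpansive maps that converge pointwise converge uniformly on totally bounded sets:
  pass to a point of a finite net at distance less than \<open>e/3\<close>.\<close>

lemma compact_tail:
  assumes K: "compactin mtopology K" and e: "e > 0"
  shows "\<exists>N. \<forall>n\<ge>N. \<forall>z\<in>K. d (trunc n z) z < e"
proof -
  obtain D where D: "finite D" "D \<subseteq> K" "K \<subseteq> (\<Union>x\<in>D. mball x (e/3))"
    using compactin_imp_mtotally_bounded[OF K] e unfolding mtotally_bounded_def
    by (meson divide_pos_pos zero_less_numeral)
  have DC: "x \<in> C" if "x \<in> D" for x
    using that D(2) compactin_subset_topspace[OF K] by auto
  have "\<forall>\<^sub>F n in sequentially. \<forall>x\<in>D. d (trunc n x) x < e/3"
    using D(1) order_tendstoD(2)[OF trunc_tendsto[OF DC], of _ "e/3"] e by (intro eventually_ball_finite) auto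
  then obtain N where N: "\<And>n x. n \<ge> N \<Longrightarrow> x \<in> D \<Longrightarrow> d (trunc n x) x < e/3"
    by (auto simp: eventually_sequentially)
  have "d (trunc n z) z < e" if n: "n \<ge> N" and z: "z \<in> K" for n z
  proof -
    obtain x where x: "x \<in> D" "z \<in> C" "d x z < e/3" using D(3) z by force
    have "d (trunc n z) z \<le> d (trunc n z) (trunc n x) + d (trunc n x) z"
      using x DC by (intro triangle trunc_mem) auto
    also have "d (trunc n x) z \<le> d (trunc n x) x + d x z"
      using x DC by (intro triangle trunc_mem) auto
    finally show ?thesis
      using trunc_le[OF x(2) DC[OF x(1)], of n] N[OF n x(1)] x(3) commute[of x z] by simp
  qed
  then show ?thesis by blast
qed

lemma character_tendsto:
  assumes "\<xi> \<in> characters G" "z \<in> C"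
  shows "(\<lambda>n. \<xi> (trunc n z)) \<longlonglongrightarrow> \<xi> z"
proof -
  have "limitin mtopology (\<lambda>n. trunc n z) z sequentially"
    unfolding limitin_metric_dist_null using assms trunc_mem trunc_tendsto by auto
  then have "limitin euclidean (\<xi> \<circ> (\<lambda>n. trunc n z)) (\<xi> z) sequentially"
    using character_continuous[OF assms(1)] continuous_map_limit by fastforce
  then show ?thesis by (simp add: o_def)
qed

lemma character_trunc:
  assumes "\<xi> \<in> characters G" "z \<in> C"
  shows "\<xi> (trunc n z) = (\<Prod>k<n. \<xi> (single_seq k (z k)))"
proof (induction n)
  case 0
  then show ?case using character_one[OF group_G assms(1)] by (simp add: trunc_def)
next
  case (Suc n)
  have "\<xi> (trunc (Suc n) z) = \<xi> (trunc n z \<otimes>\<^bsub>G\<^esub> single_seq n (z n))"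
    by (simp add: trunc_Suc)
  also have "\<dots> = \<xi> (trunc n z) * \<xi> (single_seq n (z n))"
    using assms(2) trunc_mem single_mem unit by (intro character_mult[OF assms(1)]) simp_all
  finally show ?case using Suc by simp
qed

lemma character_single:
  assumes "\<xi> \<in> characters G"
  obtains m :: int where "\<And>u. cmod u = 1 \<Longrightarrow> \<xi> (single_seq k u) = u powi m"
proof (rule circle_endomorphism_powi[of "\<lambda>u. \<xi> (single_seq k u)"])
  have "continuous_map (top_of_set (sphere 0 1)) mtopology (single_seq k)"
    unfolding continuous_map_to_metric
  proof (intro ballI allI impI)
    fix u e assume u: "u \<in> topspace (top_of_set (sphere (0::complex) 1))" and e: "(0::real) < e"
    show "\<exists>U. openin (top_of_set (sphere 0 1)) U \<and> u \<in> U \<and> (\<forall>v\<in>U. single_seq k v \<in> mball (single_seq k u) e)"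
      using u e single_mem single_le[of u _ k]
      by (intro exI[of _ "sphere 0 1 \<inter> ball u e"])
        (auto simp: openin_open_Int dist_norm intro: le_less_trans[OF single_le])
  qed
  then have "continuous_map (top_of_set (sphere 0 1)) euclidean (\<xi> \<circ> single_seq k)"
    using character_continuous[OF assms] by (intro continuous_map_compose) auto
  then show "continuous_on (sphere 0 1) (\<lambda>u. \<xi> (single_seq k u))"
    by (simp add: o_def)
next
  fix u v :: complex assume uv: "cmod u = 1" "cmod v = 1"
  have "single_seq k (u * v) = single_seq k u \<otimes>\<^bsub>G\<^esub> single_seq k v" by (auto simp: single_seq_def)
  then show "\<xi> (single_seq k (u * v)) = \<xi> (single_seq k u) * \<xi> (single_seq k v)"
    using character_mult[OF assms, of "single_seq k u" "single_seq k v"] single_mem uv by simp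
next
  show "\<xi> (single_seq k 1) \<noteq> 0"
    using character_norm[OF assms, of "single_seq k 1"] single_mem[of 1 k] by auto
qed (use that in auto)

text \<open>Continuity along truncations reduces a character to its restrictions to single
  coordinates, and these are powers. Which exponent sequences occur depends on the metric.\<close>

lemma character_exponents:
  assumes "\<xi> \<in> characters G"
  obtains a :: "nat \<Rightarrow> int" where
    "\<And>k u. cmod u = 1 \<Longrightarrow> \<xi> (single_seq k u) = u powi a k"
    "\<And>z n. z \<in> C \<Longrightarrow> \<xi> (trunc n z) = (\<Prod>k<n. z k powi a k)"
    "\<And>z. z \<in> C \<Longrightarrow> (\<lambda>n. \<Prod>k<n. z k powi a k) \<longlonglongrightarrow> \<xi> z"
proof -
  have "\<exists>m :: int. \<forall>u. cmod u = 1 \<longrightarrow> \<xi> (single_seq k u) = u powi m" for k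
    by (rule character_single[OF assms, of k]) blast
  then obtain a :: "nat \<Rightarrow> int" where a: "\<And>k u. cmod u = 1 \<Longrightarrow> \<xi> (single_seq k u) = u powi a k"
    by metis
  show thesis
    using that[of a] a character_trunc[OF assms] character_tendsto[OF assms] unit by auto
qed

end

section \<open>The topology on finitely supported integer sequences\<close>

text \<open>Asking for the sign at all scalings \<open>s\<close> bounds \<open>x\<close> itself and
  not only its residue modulo \<open>2 * pi\<close>.\<close>

lemma cos_scaled_nonneg_imp_le:
  assumes "\<And>s. s \<in> {0..1} \<Longrightarrow> cos (s * x) \<ge> 0"
  shows "\<bar>x\<bar> \<le> pi / 2"
proof (rule ccontr)
  assume x: "\<not> \<bar>x\<bar> \<le> pi / 2"
  \<comment> \<open>A scaling of \<open>\<bar>x\<bar>\<close> that lands in the range between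
    \<open>pi / 2\<close> and \<open>pi\<close>, where the cosine is negative.\<close>
  define y where "y = min \<bar>x\<bar> pi"
  have y: "pi / 2 < y" "y \<le> pi" "y \<le> \<bar>x\<bar>" using x pi_gt_zero by (auto simp: y_def)
  have x0: "\<bar>x\<bar> > 0" using x pi_gt_zero by linarith
  have "cos (y / \<bar>x\<bar> * x) = cos (y / \<bar>x\<bar> * \<bar>x\<bar>)"
    by (cases "x \<ge> 0") auto
  also have "\<dots> = cos y" using x0 by simp
  also have "\<dots> < 0"
    using y cos_lt_zero_pi[of y] pi_gt_zero by linarith
  finally show False using assms[of "y / \<bar>x\<bar>"] y x0 pi_gt_zero by (auto simp: divide_simps)
qed

text \<open>Nonzero integers have modulus at least 1, which is why an \<open>l\<^sup>1\<close>-bound of 2 on the test vectors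
  does no harm: a test vector rescaled to \<open>l\<^sup>1\<close>-norm 2 would already violate the hypothesis.\<close>

lemma weighted_sum_le:
  fixes a :: "nat \<Rightarrow> int" and w :: "nat \<Rightarrow> real"
  assumes F: "finite F" and w: "\<And>k. w k \<ge> 0" and \<eta>: "\<eta> < 2"
    and test: "\<And>t. (\<And>k. k \<notin> F \<Longrightarrow> t k = 0) \<Longrightarrow> (\<And>k. \<bar>t k\<bar> \<le> w k) \<Longrightarrow> (\<Sum>k\<in>F. \<bar>t k\<bar>) \<le> 2 \<Longrightarrow>
       \<bar>\<Sum>k\<in>F. of_int (a k) * t k\<bar> \<le> \<eta>"
  shows "(\<Sum>k\<in>F. \<bar>of_int (a k)\<bar> * w k) \<le> \<eta>"
proof -
  define S where "S = (\<Sum>k\<in>F. if a k = 0 then 0 else w k)"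
  define l where "l = (if S \<le> 2 then 1 else 2 / S)"
  have l: "0 \<le> l" "l \<le> 1" by (auto simp: l_def)
  define t where "t k = (if k \<in> F then l * w k * sgn (of_int (a k)) else 0)" for k
  have t_abs: "\<bar>t k\<bar> = (if k \<in> F \<and> a k \<noteq> 0 then l * w k else 0)" for k
    using w[of k] l by (auto simp: t_def abs_mult abs_sgn_eq)
  have "(\<Sum>k\<in>F. \<bar>t k\<bar>) = l * S"
    unfolding S_def sum_distrib_left by (intro sum.cong) (auto simp: t_abs)
  also have "\<dots> \<le> 2" by (auto simp: l_def)
  finally have "\<bar>\<Sum>k\<in>F. of_int (a k) * t k\<bar> \<le> \<eta>"
    using w l by (intro test) (auto simp: t_abs mult_left_le_one_le, simp add: t_def)
  moreover have "(\<Sum>k\<in>F. of_int (a k) * t k) = l * (\<Sum>k\<in>F. \<bar>of_int (a k)\<bar> * w k)"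
    unfolding sum_distrib_left by (intro sum.cong) (auto simp: t_def abs_sgn algebra_simps)
  ultimately have le: "l * (\<Sum>k\<in>F. \<bar>of_int (a k)\<bar> * w k) \<le> \<eta>" by simp
  have "S \<le> (\<Sum>k\<in>F. \<bar>of_int (a k)\<bar> * w k)"
    unfolding S_def
  proof (intro sum_mono)
    fix k
    have "a k \<noteq> 0 \<Longrightarrow> (1::real) \<le> \<bar>of_int (a k)\<bar>" by linarith
    then show "(if a k = 0 then 0 else w k) \<le> \<bar>of_int (a k)\<bar> * w k"
      using w[of k] mult_right_mono[of 1 "\<bar>of_int (a k)\<bar>" "w k"] by auto
  qed
  then have "l * S \<le> \<eta>" using le l mult_left_mono order_trans by blast
  then have "S \<le> 2" using \<eta> by (auto simp: l_def split: if_splits)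
  with le show ?thesis by (simp add: l_def)
qed

lemma prod_cis_powi: "(\<Prod>k\<in>F. cis (t k) powi a k) = cis (\<Sum>k\<in>F. of_int (a k) * t k)"
  by (induction F rule: infinite_finite_induct) (auto simp: cis_power_int cis_mult)

text \<open>Test vectors remain test vectors under scaling by \<open>s \<in> {0..1}\<close>, so the
  sign condition bounds the phase by \<open>pi / 2\<close>. That this is below 2 is the hypothesis
  of \<open>weighted_sum_le\<close>.\<close>

lemma weighted_sum_le_half_pi:
  fixes a :: "nat \<Rightarrow> int" and w :: "nat \<Rightarrow> real"
  assumes F: "finite F" and w: "\<And>k. w k \<ge> 0"
    and test: "\<And>t. (\<And>k. k \<notin> F \<Longrightarrow> t k = 0) \<Longrightarrow> (\<And>k. \<bar>t k\<bar> \<le> w k) \<Longrightarrow> (\<Sum>k\<in>F. \<bar>t k\<bar>) \<le> 2 \<Longrightarrow>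
       Re (\<Prod>k\<in>F. cis (t k) powi a k) \<ge> 0"
  shows "(\<Sum>k\<in>F. \<bar>of_int (a k)\<bar> * w k) \<le> pi / 2"
proof (rule weighted_sum_le[OF F w])
  show "pi / 2 < 2" using pi_less_4 by simp
  fix t :: "nat \<Rightarrow> real"
  assume t: "\<And>k. k \<notin> F \<Longrightarrow> t k = 0" "\<And>k. \<bar>t k\<bar> \<le> w k" "(\<Sum>k\<in>F. \<bar>t k\<bar>) \<le> 2"
  show "\<bar>\<Sum>k\<in>F. of_int (a k) * t k\<bar> \<le> pi / 2"
  proof (rule cos_scaled_nonneg_imp_le)
    fix s :: real assume s: "s \<in> {0..1}"
    have le: "\<bar>s * t k\<bar> \<le> \<bar>t k\<bar>" for k
      using s by (auto simp: abs_mult mult_left_le_one_le)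
    have "(\<Sum>k\<in>F. \<bar>s * t k\<bar>) \<le> 2"
      using sum_mono[of F "\<lambda>k. \<bar>s * t k\<bar>" "\<lambda>k. \<bar>t k\<bar>"] le t(3) by simp
    then have "Re (\<Prod>k\<in>F. cis (s * t k) powi a k) \<ge> 0"
      using t le by (intro test) (auto intro: order_trans)
    then show "0 \<le> cos (s * (\<Sum>k\<in>F. of_int (a k) * t k))"
      by (simp add: prod_cis_powi sum_distrib_left algebra_simps)
  qed
qed

section \<open>Weighted l1-neighbourhoods on finitely supported integer sequences\<close>

definition null_weights :: "(nat \<Rightarrow> real) \<Rightarrow> bool" where
  "null_weights w \<longleftrightarrow> (\<forall>k. w k \<ge> 0) \<and> w \<longlonglongrightarrow> 0"

definition wsum :: "(nat \<Rightarrow> real) \<Rightarrow> (nat \<Rightarrow> int) \<Rightarrow> real" where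
  "wsum w a = (\<Sum>k | a k \<noteq> 0. \<bar>of_int (a k)\<bar> * w k)"

text \<open>The radius is fixed to 1 because nonnegative multiples of null weights are null weights:
  other radii are absorbed into \<open>w\<close>.\<close>

definition Z0_topology :: "(nat \<Rightarrow> int) topology" where
  "Z0_topology = topology (\<lambda>S. S \<subseteq> carrier Z0 \<and>
     (\<forall>a\<in>S. \<exists>w. null_weights w \<and> (\<forall>b\<in>carrier Z0. wsum w (\<lambda>k. b k - a k) < 1 \<longrightarrow> b \<in> S)))"

lemma carrier_Z0: "a \<in> carrier Z0 \<longleftrightarrow> finite {k. a k \<noteq> 0}"
  and mult_Z0 [simp]: "a \<otimes>\<^bsub>Z0\<^esub> b = (\<lambda>k. a k + b k)"
  and one_Z0 [simp]: "\<one>\<^bsub>Z0\<^esub> = (\<lambda>k. 0)"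
  by (auto simp: Z0_def)

lemma with_topology_simps [simp]:
  "carrier (with_topology M T) = carrier M" "a \<otimes>\<^bsub>with_topology M T\<^esub> b = a \<otimes>\<^bsub>M\<^esub> b"
  "\<one>\<^bsub>with_topology M T\<^esub> = \<one>\<^bsub>M\<^esub>" "topo (with_topology M T) = T"
  by (simp_all add: with_topology_def)

lemma wsum_eq:
  assumes "finite F" "{k. a k \<noteq> 0} \<subseteq> F"
  shows "wsum w a = (\<Sum>k\<in>F. \<bar>of_int (a k)\<bar> * w k)"
  unfolding wsum_def using assms by (intro sum.mono_neutral_left) auto

lemma wsum_mono:
  assumes "\<And>k. v k \<le> w k"
  shows "wsum v a \<le> wsum w a"
  unfolding wsum_def using assms by (intro sum_mono mult_left_mono) auto

lemma wsum_zero [simp]: "wsum w (\<lambda>k. 0) = 0"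
  by (simp add: wsum_def)

lemma wsum_minus: "wsum w (\<lambda>k. - a k) = wsum w a"
  by (simp add: wsum_def)

lemma wsum_scale: "wsum (\<lambda>k. c * w k) a = c * wsum w a"
  by (simp add: wsum_def sum_distrib_left algebra_simps)

lemma wsum_add:
  assumes "a \<in> carrier Z0" "b \<in> carrier Z0" "null_weights w"
  shows "wsum w (\<lambda>k. a k + b k) \<le> wsum w a + wsum w b"
proof -
  let ?F = "{k. a k \<noteq> 0} \<union> {k. b k \<noteq> 0}"
  have F: "finite ?F" using assms by (auto simp: carrier_Z0)
  have "wsum w (\<lambda>k. a k + b k) = (\<Sum>k\<in>?F. \<bar>of_int (a k + b k)\<bar> * w k)"
    by (rule wsum_eq[OF F]) auto
  also have "\<dots> \<le> (\<Sum>k\<in>?F. (\<bar>of_int (a k)\<bar> + \<bar>of_int (b k)\<bar>) * w k)"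
    using assms(3) by (intro sum_mono mult_right_mono) (auto simp: null_weights_def)
  also have "\<dots> = wsum w a + wsum w b"
    by (subst (1 2) wsum_eq[OF F]) (auto simp: algebra_simps sum.distrib)
  finally show ?thesis .
qed

lemma null_weights_scale: "null_weights w \<Longrightarrow> c \<ge> 0 \<Longrightarrow> null_weights (\<lambda>k. c * w k)"
  by (auto simp: null_weights_def intro: tendsto_mult_right_zero)

lemma Z0_closed [simp]:
  "(\<lambda>k. 0) \<in> carrier Z0"
  "a \<in> carrier Z0 \<Longrightarrow> (\<lambda>k. - a k) \<in> carrier Z0"
  "a \<in> carrier Z0 \<Longrightarrow> b \<in> carrier Z0 \<Longrightarrow> (\<lambda>k. a k + b k) \<in> carrier Z0"
  "a \<in> carrier Z0 \<Longrightarrow> b \<in> carrier Z0 \<Longrightarrow> (\<lambda>k. a k - b k) \<in> carrier Z0"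
proof -
  show "(\<lambda>k. 0) \<in> carrier Z0" "a \<in> carrier Z0 \<Longrightarrow> (\<lambda>k. - a k) \<in> carrier Z0"
    by (auto simp: carrier_Z0)
next
  assume "a \<in> carrier Z0" "b \<in> carrier Z0"
  then have F: "finite ({k. a k \<noteq> 0} \<union> {k. b k \<noteq> 0})" by (auto simp: carrier_Z0)
  show "(\<lambda>k. a k + b k) \<in> carrier Z0" "(\<lambda>k. a k - b k) \<in> carrier Z0"
    unfolding carrier_Z0 by (rule finite_subset[OF _ F]; auto)+
qed

lemma openin_Z0:
  "openin Z0_topology S \<longleftrightarrow> S \<subseteq> carrier Z0 \<and>
     (\<forall>a\<in>S. \<exists>w. null_weights w \<and> (\<forall>b\<in>carrier Z0. wsum w (\<lambda>k. b k - a k) < 1 \<longrightarrow> b \<in> S))"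
proof -
  let ?P = "\<lambda>S. S \<subseteq> carrier Z0 \<and>
     (\<forall>a\<in>S. \<exists>w. null_weights w \<and> (\<forall>b\<in>carrier Z0. wsum w (\<lambda>k. b k - a k) < 1 \<longrightarrow> b \<in> S))"
  have "istopology ?P"
    unfolding istopology_def
  proof (intro conjI allI impI)
    fix S T assume ST: "?P S" "?P T"
    show "S \<inter> T \<subseteq> carrier Z0" using ST by auto
    show "\<forall>a\<in>S \<inter> T. \<exists>w. null_weights w \<and> (\<forall>b\<in>carrier Z0. wsum w (\<lambda>k. b k - a k) < 1 \<longrightarrow> b \<in> S \<inter> T)"
    proof
      fix a assume a: "a \<in> S \<inter> T"
      obtain v where v: "null_weights v" "\<And>b. b\<in>carrier Z0 \<Longrightarrow> wsum v (\<lambda>k. b k - a k) < 1 \<Longrightarrow> b \<in> S"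
        using ST(1) a by blast
      obtain w where w: "null_weights w" "\<And>b. b\<in>carrier Z0 \<Longrightarrow> wsum w (\<lambda>k. b k - a k) < 1 \<Longrightarrow> b \<in> T"
        using ST(2) a by blast
      \<comment> \<open>The maximum dominates both weights, so its ball lies in both balls.\<close>
      have "null_weights (\<lambda>k. max (v k) (w k))"
        using v(1) w(1) tendsto_max[of v 0 sequentially w 0] by (auto simp: null_weights_def le_max_iff_disj)
      moreover have "b \<in> S \<inter> T" if "b \<in> carrier Z0" "wsum (\<lambda>k. max (v k) (w k)) (\<lambda>k. b k - a k) < 1" for b
        using that v(2)[of b] w(2)[of b] wsum_mono[of v "\<lambda>k. max (v k) (w k)" "\<lambda>k. b k - a k"]
          wsum_mono[of w "\<lambda>k. max (v k) (w k)" "\<lambda>k. b k - a k"] by force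
      ultimately show "\<exists>w. null_weights w \<and> (\<forall>b\<in>carrier Z0. wsum w (\<lambda>k. b k - a k) < 1 \<longrightarrow> b \<in> S \<inter> T)"
        by blast
    qed
  next
    fix \<K> assume K: "\<forall>K\<in>\<K>. ?P K"
    then show "\<Union>\<K> \<subseteq> carrier Z0" by auto
    show "\<forall>a\<in>\<Union>\<K>. \<exists>w. null_weights w \<and> (\<forall>b\<in>carrier Z0. wsum w (\<lambda>k. b k - a k) < 1 \<longrightarrow> b \<in> \<Union>\<K>)"
    proof
      fix a assume "a \<in> \<Union>\<K>"
      then obtain S where S: "S \<in> \<K>" "a \<in> S" by auto
      then have "\<exists>w. null_weights w \<and> (\<forall>b\<in>carrier Z0. wsum w (\<lambda>k. b k - a k) < 1 \<longrightarrow> b \<in> S)"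
        using K by blast
      then show "\<exists>w. null_weights w \<and> (\<forall>b\<in>carrier Z0. wsum w (\<lambda>k. b k - a k) < 1 \<longrightarrow> b \<in> \<Union>\<K>)"
        using S(1) by blast
    qed
  qed
  then show ?thesis
    unfolding Z0_topology_def by (simp add: topology_inverse')
qed

lemma null_weights_zero: "null_weights (\<lambda>k. 0)"
  by (simp add: null_weights_def)

lemma topspace_Z0 [simp]: "topspace Z0_topology = carrier Z0"
proof
  show "topspace Z0_topology \<subseteq> carrier Z0" using openin_Z0[of "topspace Z0_topology"] by auto
  have "openin Z0_topology (carrier Z0)" unfolding openin_Z0 using null_weights_zero by auto
  then show "carrier Z0 \<subseteq> topspace Z0_topology" by (rule openin_subset)
qed

lemma Z0_ball_open:
  assumes w: "null_weights w" and a: "a \<in> carrier Z0"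
  shows "openin Z0_topology {b \<in> carrier Z0. wsum w (\<lambda>k. b k - a k) < 1}"
  unfolding openin_Z0
proof (intro conjI ballI)
  fix b assume b: "b \<in> {b \<in> carrier Z0. wsum w (\<lambda>k. b k - a k) < 1}"
  \<comment> \<open>The slack left by \<open>b\<close>; the weights divided by \<open>r\<close>
    describe the ball of radius \<open>r\<close> for \<open>w\<close>.\<close>
  define r where "r = 1 - wsum w (\<lambda>k. b k - a k)"
  have r: "r > 0" using b by (simp add: r_def)
  have "wsum w (\<lambda>k. c k - a k) < 1" if c: "c \<in> carrier Z0" "wsum (\<lambda>k. (1/r) * w k) (\<lambda>k. c k - b k) < 1" for c
  proof -
    have "wsum w (\<lambda>k. c k - b k) < r" using c(2) r unfolding wsum_scale by (simp add: field_simps)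
    moreover have "wsum w (\<lambda>k. (c k - b k) + (b k - a k)) \<le> wsum w (\<lambda>k. c k - b k) + wsum w (\<lambda>k. b k - a k)"
      using a b c w by (intro wsum_add) auto
    ultimately show ?thesis by (simp add: r_def)
  qed
  then show "\<exists>v. null_weights v \<and> (\<forall>c\<in>carrier Z0. wsum v (\<lambda>k. c k - b k) < 1 \<longrightarrow>
      c \<in> {b \<in> carrier Z0. wsum w (\<lambda>k. b k - a k) < 1})"
    using null_weights_scale[OF w, of "1/r"] r by (intro exI[of _ "\<lambda>k. (1/r) * w k"]) auto
qed auto

lemma comm_group_Z0: "comm_group (with_topology Z0 T)"
proof (rule comm_groupI)
  fix a assume "a \<in> carrier (with_topology Z0 T)"
  then show "\<exists>b\<in>carrier (with_topology Z0 T). b \<otimes>\<^bsub>with_topology Z0 T\<^esub> a = \<one>\<^bsub>with_topology Z0 T\<^esub>"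
    by (intro bexI[of _ "\<lambda>k. - a k"]) auto
qed (auto simp: algebra_simps)

lemma inv_Z0: assumes "a \<in> carrier Z0" shows "inv\<^bsub>with_topology Z0 T\<^esub> a = (\<lambda>k. - a k)"
proof -
  interpret comm_group "with_topology Z0 T" by (rule comm_group_Z0)
  have "(\<lambda>k. - a k) \<otimes>\<^bsub>with_topology Z0 T\<^esub> a = \<one>\<^bsub>with_topology Z0 T\<^esub>" by simp
  from inv_equality[OF this] show ?thesis using assms by simp
qed

lemma topological_group_Z0: "topological_group (with_topology Z0 Z0_topology)"
proof -
  interpret comm_group "with_topology Z0 Z0_topology" by (rule comm_group_Z0)
  have 1: "continuous_map (prod_topology Z0_topology Z0_topology) Z0_topology (\<lambda>(a, b). \<lambda>k. a k + b k)"
    unfolding continuous_map_eq_topcontinuous_at topcontinuous_at_def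
  proof (intro ballI conjI allI impI)
    fix p V assume p: "p \<in> topspace (prod_topology Z0_topology Z0_topology)"
      and V: "openin Z0_topology V \<and> (\<lambda>(a, b). \<lambda>k. a k + b k) p \<in> V"
    obtain a b where ab: "p = (a, b)" "a \<in> carrier Z0" "b \<in> carrier Z0" using p by auto
    obtain w where w: "null_weights w" "\<And>c. c \<in> carrier Z0 \<Longrightarrow> wsum w (\<lambda>k. c k - (a k + b k)) < 1 \<Longrightarrow> c \<in> V"
      using V ab by (fastforce simp: openin_Z0)
    have w2: "null_weights (\<lambda>k. 2 * w k)" using w(1) null_weights_scale[of w 2] by simp
    define B where "B a = {b \<in> carrier Z0. wsum (\<lambda>k. 2 * w k) (\<lambda>k. b k - a k) < 1}" for a
    have "(\<lambda>k. x k + y k) \<in> V" if xy: "x \<in> B a" "y \<in> B b" for x y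
    proof (rule w(2))
      have "wsum w (\<lambda>k. (x k - a k) + (y k - b k)) \<le> wsum w (\<lambda>k. x k - a k) + wsum w (\<lambda>k. y k - b k)"
        using xy ab w(1) by (intro wsum_add) (auto simp: B_def)
      also have "\<dots> < 1" using xy unfolding B_def wsum_scale by auto
      finally show "wsum w (\<lambda>k. x k + y k - (a k + b k)) < 1"
        by (simp add: algebra_simps)
    qed (use xy in \<open>auto simp: B_def\<close>)
    then show "\<exists>U. openin (prod_topology Z0_topology Z0_topology) U \<and> p \<in> U \<and>
        (\<forall>q\<in>U. (\<lambda>(a, b). \<lambda>k. a k + b k) q \<in> V)"
      using Z0_ball_open[OF w2] ab
      by (intro exI[of _ "B a \<times> B b"]) (auto simp: B_def openin_prod_Times_iff)
  qed auto
  have 2: "continuous_map Z0_topology Z0_topology (\<lambda>a. \<lambda>k. - a k)"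
    unfolding continuous_map
  proof (intro conjI allI impI)
    fix V assume V: "openin Z0_topology V"
    show "openin Z0_topology {a \<in> topspace Z0_topology. (\<lambda>k. - a k) \<in> V}"
      unfolding openin_Z0
    proof (intro conjI ballI)
      fix a assume a: "a \<in> {a \<in> topspace Z0_topology. (\<lambda>k. - a k) \<in> V}"
      then obtain w where w: "null_weights w" "\<And>c. c \<in> carrier Z0 \<Longrightarrow> wsum w (\<lambda>k. c k - - a k) < 1 \<Longrightarrow> c \<in> V"
        using V by (fastforce simp: openin_Z0)
      have "(\<lambda>k. - b k) \<in> V" if "b \<in> carrier Z0" "wsum w (\<lambda>k. b k - a k) < 1" for b
        using that wsum_minus[of w "\<lambda>k. b k - a k"] by (intro w(2)) (auto simp: algebra_simps)
      then show "\<exists>w. null_weights w \<and> (\<forall>b\<in>carrier Z0. wsum w (\<lambda>k. b k - a k) < 1 \<longrightarrow>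
          b \<in> {a \<in> topspace Z0_topology. (\<lambda>k. - a k) \<in> V})"
        using w(1) by auto
    qed auto
  qed auto
  have 3: "continuous_map Z0_topology Z0_topology (\<lambda>a. inv\<^bsub>with_topology Z0 Z0_topology\<^esub> a)"
    by (rule continuous_map_eq[OF 2]) (simp add: inv_Z0)
  have "continuous_map (prod_topology Z0_topology Z0_topology) Z0_topology
      (\<lambda>(a, b). a \<otimes>\<^bsub>with_topology Z0 Z0_topology\<^esub> b)"
    by (rule continuous_map_eq[OF 1]) auto
  with 3 show ?thesis
    unfolding topological_group_def with_topology_simps(4) using is_group topspace_Z0
    by (intro conjI) (assumption | simp)+
qed

section \<open>Characters with finitely many exponents\<close>

definition cis_seq :: "(nat \<Rightarrow> real) \<Rightarrow> nat \<Rightarrow> complex" where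
  "cis_seq t = (\<lambda>k. cis (t k))"

text \<open>\<open>Z0_character\<close> for an arbitrary group of sequences in place of
  \<open>TH0\<close>.\<close>

definition fin_character :: "(nat \<Rightarrow> complex, 'b) tgroup_scheme \<Rightarrow> (nat \<Rightarrow> int) \<Rightarrow> (nat \<Rightarrow> complex) \<Rightarrow> complex" where
  "fin_character G a = (\<lambda>z\<in>carrier G. \<Prod>k | a k \<noteq> 0. z k powi a k)"

lemma prod_powi_support:
  fixes z :: "nat \<Rightarrow> complex"
  assumes "finite F" "{k. a k \<noteq> 0} \<subseteq> F"
  shows "(\<Prod>k | a k \<noteq> 0. z k powi a k) = (\<Prod>k\<in>F. z k powi a k)"
  using assms by (intro prod.mono_neutral_left) auto

lemma power_int_unit_eq_imp_eq:
  fixes m n :: int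
  assumes "\<And>u::complex. cmod u = 1 \<Longrightarrow> u powi m = u powi n"
  shows "m = n"
proof (rule ccontr)
  assume "m \<noteq> n"
  \<comment> \<open>Chosen so that \<open>u powi (m - n) = -1\<close>.\<close>
  define u where "u = cis (pi / of_int (m - n))"
  have "u powi (m - n) = cis pi"
    using \<open>m \<noteq> n\<close> by (simp add: u_def cis_power_int)
  moreover have "u powi (m - n) = u powi m / u powi n"
    by (simp add: u_def power_int_diff)
  moreover have "u powi m = u powi n" "u powi n \<noteq> 0"
    using assms[of u] by (auto simp: u_def)
  ultimately have "1 = cis pi" by (metis divide_self)
  then show False by (simp add: complex_eq_iff)
qed

context circle_sequences
begin

lemma trunc_mem_unit: "(\<And>k. cmod (z k) = 1) \<Longrightarrow> trunc n z \<in> C"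
proof (induction n)
  case 0
  then show ?case using one_mem by (simp add: trunc_def)
next
  case (Suc n)
  then show ?case unfolding trunc_Suc using mult_mem single_mem by blast
qed

text \<open>The metric is invariant, so a Lipschitz estimate at the identity, applied to the
  quotient of two points, gives continuity everywhere.\<close>

lemma characterI:
  assumes ext: "\<xi> \<in> extensional C" and norm: "\<And>z. z \<in> C \<Longrightarrow> cmod (\<xi> z) = 1"
    and mult: "\<And>z w. z \<in> C \<Longrightarrow> w \<in> C \<Longrightarrow> \<xi> (\<lambda>k. z k * w k) = \<xi> z * \<xi> w"
    and lip: "\<And>z. z \<in> C \<Longrightarrow> cmod (\<xi> z - 1) \<le> M * d z (\<lambda>k. 1)"
  shows "\<xi> \<in> characters G"
proof -
  have "cmod (\<xi> z - \<xi> w) \<le> M * d z w" if zw: "z \<in> C" "w \<in> C" for z w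
  proof -
    let ?x = "\<lambda>k. cnj (w k) * z k"
    have x: "?x \<in> C" using zw mult_mem cnj_mem by blast
    have "(\<lambda>k. w k * ?x k) = z"
    proof
      fix k
      have "w k * (cnj (w k) * z k) = (cnj (w k) * w k) * z k" by (simp add: ac_simps)
      then show "w k * ?x k = z k" using zw unit by (simp add: cnj_mult_self)
    qed
    then have "\<xi> z - \<xi> w = \<xi> w * (\<xi> ?x - 1)"
      using mult[OF zw(2) x] by (simp add: algebra_simps)
    then have "cmod (\<xi> z - \<xi> w) = cmod (\<xi> ?x - 1)" using norm[OF zw(2)] by (simp add: norm_mult)
    then show ?thesis using lip[OF x] dist_one[OF zw] by simp
  qed
  note lip' = this
  have "continuous_map mtopology euclidean \<xi>"
    unfolding continuous_map_from_metric
  proof (intro conjI ballI allI impI)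
    fix z U assume z: "z \<in> C" and U: "openin euclidean U \<and> \<xi> z \<in> U"
    then obtain e where e: "e > 0" "ball (\<xi> z) e \<subseteq> U" by (auto simp: open_contains_ball)
    \<comment> \<open>The denominator is positive whatever the sign of \<open>M\<close>.\<close>
    have "\<xi> x \<in> U" if x: "x \<in> C" "d z x < e / (\<bar>M\<bar> + 1)" for x
    proof -
      have "cmod (\<xi> z - \<xi> x) \<le> (\<bar>M\<bar> + 1) * d z x"
        using lip'[OF z x(1)] mult_right_mono[of M "\<bar>M\<bar> + 1" "d z x"] by fastforce
      also have "\<dots> < e" using x(2) by (simp add: field_simps)
      finally show ?thesis using e(2) by (auto simp: dist_norm)
    qed
    then show "\<exists>r>0. \<forall>x. x \<in> C \<and> d z x < r \<longrightarrow> \<xi> x \<in> U"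
      using e(1) by (intro exI[of _ "e / (\<bar>M\<bar> + 1)"]) auto
  qed auto
  then show ?thesis
    using ext norm mult by (subst characters_iff) auto
qed

lemma fin_character_eq:
  assumes "finite F" "{k. a k \<noteq> 0} \<subseteq> F" "z \<in> C"
  shows "fin_character G a z = (\<Prod>k\<in>F. z k powi a k)"
  using assms by (simp add: fin_character_def prod_powi_support)

lemma fin_character_character:
  assumes "a \<in> carrier Z0"
  shows "fin_character G a \<in> characters G"
proof (rule characterI)
  let ?F = "{k. a k \<noteq> 0}"
  fix z assume z: "z \<in> C"
  have "cmod (fin_character G a z - 1) \<le> (\<Sum>k\<in>?F. \<bar>of_int (a k)\<bar> * cmod (z k - 1))"
    unfolding fin_character_def using z unit by (simp add: norm_prod_powi_diff_one_le)
  also have "\<dots> \<le> (\<Sum>k\<in>?F. \<bar>of_int (a k)\<bar> * d z (\<lambda>k. 1))"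
    using coord_le[OF z one_mem] by (intro sum_mono mult_left_mono) auto
  finally show "cmod (fin_character G a z - 1) \<le> (\<Sum>k\<in>?F. \<bar>of_int (a k)\<bar>) * d z (\<lambda>k. 1)"
    by (simp add: sum_distrib_right)
qed (auto simp: fin_character_def norm_powi_unit unit mult_mem power_int_mult_distrib prod.distrib simp flip: prod_norm)

lemma fin_character_single:
  assumes "a \<in> carrier Z0" "cmod u = 1"
  shows "fin_character G a (single_seq k u) = u powi a k"
proof -
  have F: "finite (insert k {k. a k \<noteq> 0})" using assms by (simp add: carrier_Z0)
  have "fin_character G a (single_seq k u) = (\<Prod>j\<in>insert k {k. a k \<noteq> 0}. single_seq k u j powi a j)"
    using assms single_mem by (intro fin_character_eq F) auto
  also have "\<dots> = (\<Prod>j\<in>{k}. single_seq k u j powi a j)"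
    using F by (intro prod.mono_neutral_right) (auto simp: single_seq_def)
  finally show ?thesis by (simp add: single_seq_def)
qed

lemma fin_character_inj: "inj_on (fin_character G) (carrier Z0)"
proof (rule inj_onI)
  fix a b assume ab: "a \<in> carrier Z0" "b \<in> carrier Z0" "fin_character G a = fin_character G b"
  show "a = b"
  proof
    fix k
    show "a k = b k"
      by (rule power_int_unit_eq_imp_eq) (metis ab fin_character_single)
  qed
qed

lemma fin_character_hom: "fin_character G \<in> hom (with_topology Z0 T) (dual G)"
proof (rule homI)
  fix a b assume ab: "a \<in> carrier (with_topology Z0 T)" "b \<in> carrier (with_topology Z0 T)"
  let ?F = "{k. a k \<noteq> 0} \<union> {k. b k \<noteq> 0}"
  have F: "finite ?F" using ab by (simp add: carrier_Z0)
  have "fin_character G (\<lambda>k. a k + b k) z = fin_character G a z * fin_character G b z" if z: "z \<in> C" for z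
  proof -
    have nz: "z k \<noteq> 0" for k using unit[OF z, of k] by auto
    have "{k. a k + b k \<noteq> 0} \<subseteq> ?F" by auto
    then show ?thesis
      using z F by (simp add: fin_character_eq[where F="?F"] power_int_add nz prod.distrib)
  qed
  then show "fin_character G (a \<otimes>\<^bsub>with_topology Z0 T\<^esub> b) = fin_character G a \<otimes>\<^bsub>dual G\<^esub> fin_character G b"
    by (auto simp: mult_dual fun_eq_iff fin_character_def)
qed (use fin_character_character in auto)

end

text \<open>Differences of two test vectors of l1-norm at most 2 must qualify as well; hence the
  bound 4.\<close>

definition small_angles :: "real \<Rightarrow> (nat \<Rightarrow> real) \<Rightarrow> bool" where
  "small_angles c t \<longleftrightarrow> (\<forall>k. \<bar>t k\<bar> \<le> c) \<and> summable (\<lambda>k. \<bar>t k\<bar>) \<and> (\<Sum>k. \<bar>t k\<bar>) \<le> 4"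

text \<open>The number of nonzero angles is unrestricted: once the l1-norm is bounded, only the
  largest angle has to be small. Infinite supports are included because the compact test sets
  contain them.\<close>

locale flat_sequences = circle_sequences +
  assumes flat: "\<delta> > 0 \<Longrightarrow> \<exists>c>0. \<forall>t. small_angles c t \<longrightarrow>
    cis_seq t \<in> C \<and> d (cis_seq t) (\<lambda>k. 1) < \<delta>"
begin

lemma flat_finite:
  assumes "\<delta> > 0"
  obtains c where "c > 0" "\<And>t F. finite F \<Longrightarrow> (\<And>k. k \<notin> F \<Longrightarrow> t k = 0) \<Longrightarrow> (\<And>k. \<bar>t k\<bar> \<le> c) \<Longrightarrow> (\<Sum>k\<in>F. \<bar>t k\<bar>) \<le> 2 \<Longrightarrow>
     cis_seq t \<in> C \<and> d (cis_seq t) (\<lambda>k. 1) < \<delta>"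
proof -
  obtain c where c: "c > 0" "\<And>t. small_angles c t \<Longrightarrow>
    cis_seq t \<in> C \<and> d (cis_seq t) (\<lambda>k. 1) < \<delta>"
    using flat[OF assms] by blast
  have "cis_seq t \<in> C \<and> d (cis_seq t) (\<lambda>k. 1) < \<delta>"
    if F: "finite F" "\<And>k. k \<notin> F \<Longrightarrow> t k = 0" and t: "\<And>k. \<bar>t k\<bar> \<le> c" "(\<Sum>k\<in>F. \<bar>t k\<bar>) \<le> 2" for t F
    using c(2)[of t] t F(2) sums_unique[OF sums_finite[OF F(1), of "\<lambda>k. \<bar>t k\<bar>"]]
      sums_summable[OF sums_finite[OF F(1), of "\<lambda>k. \<bar>t k\<bar>"]] by (auto simp: small_angles_def)
  with c(1) that show thesis by blast
qed

text \<open>\<open>weighted_sum_le_half_pi\<close> with the constant weight \<open>c\<close>. The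
  bound is uniform in \<open>F\<close>; it yields the finite support of exponent sequences and later
  the l1-bound on polars of balls.\<close>

lemma flat_character_bound:
  assumes "\<delta> > 0"
  obtains c where "c > 0" "\<And>a F. finite F \<Longrightarrow>
    (\<And>z. z \<in> C \<Longrightarrow> (\<And>k. k \<notin> F \<Longrightarrow> z k = 1) \<Longrightarrow> d z (\<lambda>k. 1) < \<delta> \<Longrightarrow> Re (\<Prod>k\<in>F. z k powi a k) \<ge> 0) \<Longrightarrow>
    (\<Sum>k\<in>F. \<bar>of_int (a k)\<bar>) * c \<le> pi / 2"
proof -
  obtain c where c: "c > 0" "\<And>t F. finite F \<Longrightarrow> (\<And>k. k \<notin> F \<Longrightarrow> t k = 0) \<Longrightarrow> (\<And>k. \<bar>t k\<bar> \<le> c) \<Longrightarrow> (\<Sum>k\<in>F. \<bar>t k\<bar>) \<le> 2 \<Longrightarrow>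
     cis_seq t \<in> C \<and> d (cis_seq t) (\<lambda>k. 1) < \<delta>"
    using flat_finite[OF assms] by metis
  have "(\<Sum>k\<in>F. \<bar>of_int (a k)\<bar> * c) \<le> pi / 2" if F: "finite F" and
    *: "\<And>z. z \<in> C \<Longrightarrow> (\<And>k. k \<notin> F \<Longrightarrow> z k = 1) \<Longrightarrow> d z (\<lambda>k. 1) < \<delta> \<Longrightarrow> Re (\<Prod>k\<in>F. z k powi a k) \<ge> 0"
    for a :: "nat \<Rightarrow> int" and F
  proof (rule weighted_sum_le_half_pi[OF F])
    fix t :: "nat \<Rightarrow> real" assume t: "\<And>k. k \<notin> F \<Longrightarrow> t k = 0" "\<And>k. \<bar>t k\<bar> \<le> c" "(\<Sum>k\<in>F. \<bar>t k\<bar>) \<le> 2"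
    then show "Re (\<Prod>k\<in>F. cis (t k) powi a k) \<ge> 0"
      using *[of "cis_seq t"] c(2)[OF F, of t] by (simp add: cis_seq_def)
  qed (use c in auto)
  with c(1) that show thesis by (simp add: sum_distrib_right)
qed

text \<open>The initial segments of the exponent sequence have uniformly bounded l1-norms, and each
  nonzero integer contributes at least 1 to them, so only finitely many exponents are
  nonzero.\<close>

lemma character_is_fin_character:
  assumes \<xi>: "\<xi> \<in> characters G"
  obtains a where "a \<in> carrier Z0" "\<xi> = fin_character G a"
proof -
  obtain a where a: "\<And>k u. cmod u = 1 \<Longrightarrow> \<xi> (single_seq k u) = u powi a k"
    "\<And>z n. z \<in> C \<Longrightarrow> \<xi> (trunc n z) = (\<Prod>k<n. z k powi a k)"
    "\<And>z. z \<in> C \<Longrightarrow> (\<lambda>n. \<Prod>k<n. z k powi a k) \<longlonglongrightarrow> \<xi> z"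
    using character_exponents[OF \<xi>] by blast
  have "\<exists>r>0. \<forall>z. z \<in> C \<and> d (\<lambda>k. 1) z < r \<longrightarrow> \<xi> z \<in> ball 1 1"
    using character_continuous[OF \<xi>] character_one[OF group_G \<xi>] one_mem
    unfolding seq_group_simps continuous_map_from_metric by (metis centre_in_ball open_ball open_openin zero_less_one)
  then obtain r where r: "r > 0" "\<And>z. z \<in> C \<Longrightarrow> d z (\<lambda>k. 1) < r \<Longrightarrow> cmod (\<xi> z - 1) < 1"
    by (auto simp: commute dist_norm norm_minus_commute)
  obtain c where c: "c > 0" "\<And>a F. finite F \<Longrightarrow>
    (\<And>z. z \<in> C \<Longrightarrow> (\<And>k. k \<notin> F \<Longrightarrow> z k = 1) \<Longrightarrow> d z (\<lambda>k. 1) < r \<Longrightarrow> Re (\<Prod>k\<in>F. z k powi a k) \<ge> 0) \<Longrightarrow>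
    (\<Sum>k\<in>F. \<bar>of_int (a k)\<bar>) * c \<le> pi / 2"
    using flat_character_bound[OF r(1)] by blast
  have bound: "(\<Sum>k<n. \<bar>of_int (a k)\<bar>) * c \<le> pi / 2" for n
  proof (rule c(2))
    fix z assume z: "z \<in> C" "\<And>k. k \<notin> {..<n} \<Longrightarrow> z k = 1" "d z (\<lambda>k. 1) < r"
    then have "trunc n z = z" by (auto simp: trunc_def fun_eq_iff)
    then have "\<xi> z = (\<Prod>k<n. z k powi a k)" using a(2)[OF z(1), of n] by simp
    moreover have "Re (\<xi> z) \<ge> 0"
      using r(2)[OF z(1,3)] abs_Re_le_cmod[of "\<xi> z - 1"] by simp
    ultimately show "Re (\<Prod>k<n. z k powi a k) \<ge> 0" by simp
  qed auto
  have fin: "finite {k. a k \<noteq> 0}"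
  proof (rule ccontr)
    assume "infinite {k. a k \<noteq> 0}"
    \<comment> \<open>More indices than the bound \<open>pi / (2 * c)\<close> on the l1-norms
      allows.\<close>
    then obtain B where B: "finite B" "card B = Suc (nat \<lceil>pi / (2 * c)\<rceil>)" "B \<subseteq> {k. a k \<noteq> 0}"
      using infinite_arbitrarily_large by blast
    obtain n where n: "B \<subseteq> {..<n}" using B(1) finite_nat_bounded by blast
    have "real (card B) = (\<Sum>k\<in>B. 1)" by simp
    also have "\<dots> \<le> (\<Sum>k\<in>B. \<bar>of_int (a k)\<bar>)"
    proof (rule sum_mono)
      fix k assume "k \<in> B"
      then have "a k \<noteq> 0" using B(3) by auto
      then show "(1::real) \<le> \<bar>of_int (a k)\<bar>" by linarith
    qed
    also have "\<dots> \<le> (\<Sum>k<n. \<bar>of_int (a k)\<bar>)" using n by (intro sum_mono2) auto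
    also have "\<dots> \<le> pi / (2 * c)" using bound[of n] c(1) by (simp add: field_simps)
    finally show False unfolding B(2) by linarith
  qed
  have "\<xi> = fin_character G a"
  proof (rule character_eqI[OF \<xi> fin_character_character])
    fix z assume z: "z \<in> carrier G"
    obtain n where n: "{k. a k \<noteq> 0} \<subseteq> {..<n}" using fin finite_nat_bounded by blast
    have "(\<Prod>k<m. z k powi a k) = fin_character G a z" if "m \<ge> n" for m
      using n that z by (subst fin_character_eq[of "{..<m}"]) auto
    then have "\<forall>\<^sub>F m in sequentially. (\<Prod>k<m. z k powi a k) = fin_character G a z"
      by (auto simp: eventually_sequentially)
    then have "(\<lambda>m. \<Prod>k<m. z k powi a k) \<longlonglongrightarrow> fin_character G a z"
      by (rule tendsto_eventually)
    then show "\<xi> z = fin_character G a z"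
      using a(3) z LIMSEQ_unique by auto
  qed (use fin in \<open>auto simp: carrier_Z0\<close>)
  with that fin show thesis by (auto simp: carrier_Z0)
qed

section \<open>Compact test sets in a flat group\<close>

definition test_angles :: "(nat \<Rightarrow> real) \<Rightarrow> (nat \<Rightarrow> real) set" where
  "test_angles w = {t. (\<forall>k. \<bar>t k\<bar> \<le> w k) \<and> (\<forall>n. (\<Sum>k<n. \<bar>t k\<bar>) \<le> 2)}"

text \<open>Bounding all partial sums, rather than the infinite sum, makes the condition visibly
  closed in the product topology; the box around it is compact by Tychonoff's theorem.\<close>

lemma compact_test_angles: "compact (test_angles w)"
proof -
  have "compact (PiE UNIV (\<lambda>k. {- w k..w k}))"
    using compactin_PiE[of "\<lambda>_. euclidean" UNIV "\<lambda>k. {- w k..w k}"]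
    by (simp add: euclidean_product_topology)
  moreover have "closed {t::nat \<Rightarrow> real. \<forall>n. (\<Sum>k<n. \<bar>t k\<bar>) \<le> 2}"
    by (intro closed_Collect_all closed_Collect_le continuous_intros continuous_on_product_coordinates)
  ultimately have "compact (PiE UNIV (\<lambda>k. {- w k..w k}) \<inter> {t. \<forall>n. (\<Sum>k<n. \<bar>t k\<bar>) \<le> 2})"
    by (rule compact_Int_closed)
  moreover have "PiE UNIV (\<lambda>k. {- w k..w k}) \<inter> {t. \<forall>n. (\<Sum>k<n. \<bar>t k\<bar>) \<le> 2} = test_angles w"
    by (auto simp: test_angles_def PiE_iff abs_le_iff minus_le_iff)
  ultimately show ?thesis by simp
qed

lemma test_angles_summable:
  assumes "t \<in> test_angles w"
  shows "summable (\<lambda>k. \<bar>t k\<bar>)" "(\<Sum>k. \<bar>t k\<bar>) \<le> 2"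
proof -
  have "(\<Sum>k<Suc n. \<bar>t k\<bar>) \<le> 2" for n using assms unfolding test_angles_def by blast
  then have "(\<Sum>k\<le>n. \<bar>t k\<bar>) \<le> 2" for n by (simp only: lessThan_Suc_atMost)
  then show s: "summable (\<lambda>k. \<bar>t k\<bar>)"
    by (intro bounded_imp_summable[where B=2]) auto
  show "(\<Sum>k. \<bar>t k\<bar>) \<le> 2"
    using assms by (intro suminf_le_const s) (auto simp: test_angles_def)
qed

text \<open>Far out the angles are below the threshold of flatness, where the l1-bound alone gives
  membership and closeness; the finitely many remaining coordinates are handled by truncation and by
  the product topology. So \<open>cis_seq\<close> is continuous from the product topology to the
  metric.\<close>

lemma compact_test_set:
  assumes w: "null_weights w"
  shows "cis_seq ` test_angles w \<subseteq> C" "compactin mtopology (cis_seq ` test_angles w)"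
proof -
  show sub: "cis_seq ` test_angles w \<subseteq> C"
  proof clarify
    fix t assume t: "t \<in> test_angles w"
    obtain c where c: "c > 0" "\<And>t. small_angles c t \<Longrightarrow> cis_seq t \<in> C"
      using flat[of 1] by auto
    obtain N where N: "\<And>k. k \<ge> N \<Longrightarrow> w k < c"
      using w c(1) order_tendstoD(2)[of w 0 sequentially c] by (auto simp: null_weights_def eventually_sequentially)
    \<comment> \<open>Flatness applies to the tail; multiplying by a truncation restores the
      head.\<close>
    define s where "s k = (if k < N then 0 else t k)" for k
    have s: "\<bar>s k\<bar> \<le> \<bar>t k\<bar>" for k by (simp add: s_def)
    have ss: "summable (\<lambda>k. \<bar>s k\<bar>)"
      by (rule summable_comparison_test'[OF test_angles_summable(1)[OF t], of 0]) (use s in auto)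
    have "(\<Sum>k. \<bar>s k\<bar>) \<le> (\<Sum>k. \<bar>t k\<bar>)" using s ss test_angles_summable(1)[OF t] by (intro suminf_le) auto
    then have "(\<Sum>k. \<bar>s k\<bar>) \<le> 4" using test_angles_summable(2)[OF t] by simp
    moreover have "\<bar>s k\<bar> \<le> c" for k
    proof (cases "k < N")
      case False
      then have "\<bar>t k\<bar> \<le> w k" "w k < c" using t N by (auto simp: test_angles_def)
      then show ?thesis using False by (simp add: s_def)
    qed (use c in \<open>simp add: s_def\<close>)
    ultimately have "cis_seq s \<in> C" using c(2)[of s] ss by (simp add: small_angles_def)
    moreover have "trunc N (cis_seq t) \<in> C" by (rule trunc_mem_unit) (simp add: cis_seq_def)
    ultimately have "(\<lambda>k. trunc N (cis_seq t) k * cis_seq s k) \<in> C" by (intro mult_mem)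
    moreover have "(\<lambda>k. trunc N (cis_seq t) k * cis_seq s k) = cis_seq t"
      by (auto simp: trunc_def cis_seq_def s_def)
    ultimately show "cis_seq t \<in> C" by simp
  qed
  have "continuous_map (top_of_set (test_angles w)) mtopology cis_seq"
    unfolding continuous_map_to_metric
  proof (intro ballI allI impI)
    fix t e assume "t \<in> topspace (top_of_set (test_angles w))" and e: "(0::real) < e"
    then have t: "t \<in> test_angles w" by simp
    obtain c where c: "c > 0" "\<And>t. small_angles c t \<Longrightarrow>
      cis_seq t \<in> C \<and> d (cis_seq t) (\<lambda>k. 1) < e"
      using flat[OF e] by auto
    obtain N where N: "\<And>k. k \<ge> N \<Longrightarrow> w k < c / 2"
      using w c(1) order_tendstoD(2)[of w 0 sequentially "c/2"] by (auto simp: null_weights_def eventually_sequentially)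
    \<comment> \<open>Below \<open>N\<close> the neighbourhood controls the difference of the
      angles; from \<open>N\<close> on both vectors are bounded by \<open>c / 2\<close>.\<close>
    define U where "U = {s::nat \<Rightarrow> real. \<forall>k\<in>{..<N}. \<bar>s k - t k\<bar> < c}"
    have "U = (\<Inter>k\<in>{..<N}. {s. \<bar>s k - t k\<bar> < c})" by (auto simp: U_def)
    then have "open U"
      by (auto intro!: open_INT open_Collect_less continuous_intros continuous_on_product_coordinates)
    moreover have "t \<in> U" using c by (simp add: U_def)
    moreover have "cis_seq s \<in> mball (cis_seq t) e" if s: "s \<in> test_angles w" "s \<in> U" for s
    proof -
      have le: "\<bar>t k - s k\<bar> \<le> \<bar>t k\<bar> + \<bar>s k\<bar>" for k by simp
      have sm: "summable (\<lambda>k. \<bar>t k\<bar> + \<bar>s k\<bar>)"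
        using test_angles_summable(1) s(1) t by (intro summable_add)
      have sm': "summable (\<lambda>k. \<bar>t k - s k\<bar>)"
        by (rule summable_comparison_test'[OF sm, of 0]) (use le in auto)
      have "(\<Sum>k. \<bar>t k - s k\<bar>) \<le> (\<Sum>k. \<bar>t k\<bar> + \<bar>s k\<bar>)" by (intro suminf_le le sm sm')
      also have "\<dots> \<le> 4"
        using test_angles_summable[OF t] test_angles_summable[OF s(1)] by (subst suminf_add[symmetric]) auto
      finally have "(\<Sum>k. \<bar>t k - s k\<bar>) \<le> 4" .
      moreover have "\<bar>t k - s k\<bar> \<le> c" for k
      proof (cases "k < N")
        case True
        then have "\<bar>s k - t k\<bar> < c" using s(2) by (auto simp: U_def)
        then show ?thesis by (simp add: abs_minus_commute)
      next
        case False
        then show ?thesis using t s(1) N[of k] le[of k] by (auto simp: test_angles_def) (smt (verit, best) field_sum_of_halves)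
      qed
      ultimately have "d (cis_seq (\<lambda>k. t k - s k)) (\<lambda>k. 1) < e"
        using c(2)[of "\<lambda>k. t k - s k"] sm' by (simp add: small_angles_def)
      moreover have "cis_seq (\<lambda>k. t k - s k) = (\<lambda>k. cnj (cis_seq s k) * cis_seq t k)"
        by (simp add: cis_seq_def cis_cnj cis_mult)
      moreover have "cis_seq t \<in> C" "cis_seq s \<in> C" using sub t s(1) by auto
      ultimately show ?thesis using dist_one[of "cis_seq t" "cis_seq s"] by simp
    qed
    ultimately show "\<exists>U. openin (top_of_set (test_angles w)) U \<and> t \<in> U \<and> (\<forall>s\<in>U. cis_seq s \<in> mball (cis_seq t) e)"
      using t by (intro exI[of _ "test_angles w \<inter> U"]) (auto simp: openin_open_Int)
  qed
  then show "compactin mtopology (cis_seq ` test_angles w)"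
    using image_compactin[of "top_of_set (test_angles w)" "test_angles w"] compact_test_angles[of w]
    by (simp add: compactin_subtopology)
qed

text \<open>Doubled weights turn the phase bound \<open>pi / 2 < 2\<close> into
  \<open>wsum w a < 1\<close>.\<close>

lemma fin_character_small_imp_wsum_small:
  assumes w: "null_weights w" and a: "a \<in> carrier Z0"
    and small: "\<And>z. z \<in> cis_seq ` test_angles (\<lambda>k. 2 * w k) \<Longrightarrow> cmod (fin_character G a z - 1) < 1"
  shows "wsum w a < 1"
proof -
  let ?F = "{k. a k \<noteq> 0}"
  have F: "finite ?F" using a by (simp add: carrier_Z0)
  have w2: "null_weights (\<lambda>k. 2 * w k)" using w null_weights_scale[of w 2] by simp
  have "(\<Sum>k\<in>?F. \<bar>of_int (a k)\<bar> * (2 * w k)) \<le> pi / 2"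
  proof (rule weighted_sum_le_half_pi[OF F])
    fix t :: "nat \<Rightarrow> real" assume t: "\<And>k. k \<notin> ?F \<Longrightarrow> t k = 0" "\<And>k. \<bar>t k\<bar> \<le> 2 * w k" "(\<Sum>k\<in>?F. \<bar>t k\<bar>) \<le> 2"
    have "(\<Sum>k<n. \<bar>t k\<bar>) \<le> 2" for n
    proof -
      have "(\<Sum>k<n. \<bar>t k\<bar>) = (\<Sum>k\<in>{..<n} \<inter> ?F. \<bar>t k\<bar>)"
        using t(1) by (intro sum.mono_neutral_right) auto
      also have "\<dots> \<le> (\<Sum>k\<in>?F. \<bar>t k\<bar>)" using F by (intro sum_mono2) auto
      finally show ?thesis using t(3) by simp
    qed
    then have *: "t \<in> test_angles (\<lambda>k. 2 * w k)" using t(2) by (simp add: test_angles_def)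
    then have "cmod (fin_character G a (cis_seq t) - 1) < 1" using small by blast
    then have "Re (fin_character G a (cis_seq t)) \<ge> 0"
      using abs_Re_le_cmod[of "fin_character G a (cis_seq t) - 1"] by simp
    moreover have "cis_seq t \<in> C" using compact_test_set(1)[OF w2] * by blast
    ultimately show "Re (\<Prod>k\<in>?F. cis (t k) powi a k) \<ge> 0"
      by (simp add: fin_character_def cis_seq_def)
  qed (use w in \<open>auto simp: null_weights_def\<close>)
  then have "2 * wsum w a \<le> pi / 2" by (simp add: wsum_def sum_distrib_left algebra_simps)
  then show ?thesis using pi_less_4 by simp
qed

text \<open>Compact sets correspond to null weights: the largest deviation from 1 in each coordinate
  over a compact set forms a null sequence, and conversely null weights bound the angles of a
  compact test set.\<close>

lemma topological_iso_fin_character: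
  "topological_iso (with_topology Z0 Z0_topology) (dual G) (fin_character G)"
proof (rule topological_isoI)
  let ?Z = "with_topology Z0 Z0_topology"
  define g where "g = inv_into (carrier Z0) (fin_character G)"
  note D = topological_group_dual[OF topological_group_G]
  interpret Z: comm_group ?Z by (rule comm_group_Z0)
  have surj: "fin_character G ` carrier Z0 = characters G"
    using fin_character_character character_is_fin_character by (auto simp: image_iff) metis
  show gf: "g (fin_character G a) = a" if "a \<in> carrier ?Z" for a
    using that fin_character_inj by (simp add: g_def)
  show fg: "fin_character G (g \<xi>) = \<xi>" if "\<xi> \<in> carrier (dual G)" for \<xi>
    using that surj by (simp add: g_def f_inv_into_f)
  have g_mem: "g \<xi> \<in> carrier Z0" if "\<xi> \<in> characters G" for \<xi>
    unfolding g_def using that surj by (simp add: inv_into_into)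
  have bij: "bij_betw (fin_character G) (carrier ?Z) (carrier (dual G))"
    using surj fin_character_inj by (simp add: bij_betw_def)
  show hom: "fin_character G \<in> hom ?Z (dual G)" by (rule fin_character_hom)
  have g_hom: "g \<in> hom (dual G) ?Z"
    using Z.iso_set_sym[of "fin_character G" "dual G"] hom bij by (simp add: iso_def g_def)
  show "continuous_map (topo ?Z) (topo (dual G)) (fin_character G)"
  proof (rule hom_continuous_at_one[OF topological_group_Z0 D hom])
    fix V assume "openin (topo (dual G)) V" "\<one>\<^bsub>dual G\<^esub> \<in> V"
    then obtain K e where K: "compactin mtopology K" "e > 0" "char_near G K \<one>\<^bsub>dual G\<^esub> e \<subseteq> V"
      by (auto simp: openin_dual)
    have K_sub: "K \<subseteq> C" using compactin_subset_topspace[OF K(1)] by simp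
    define v where "v k = (SUP z\<in>K. cmod (z k - 1))" for k
    have bdd: "bdd_above ((\<lambda>z. cmod (z k - 1)) ` K)" for k
    proof (rule bdd_aboveI2)
      fix z assume "z \<in> K"
      then have "cmod (z k) = 1" using K_sub unit by auto
      then show "cmod (z k - 1) \<le> 2" using norm_triangle_ineq4[of "z k" 1] by simp
    qed
    show "\<exists>U. openin (topo ?Z) U \<and> \<one>\<^bsub>?Z\<^esub> \<in> U \<and> fin_character G ` U \<subseteq> V"
    \<comment> \<open>The supremum over the empty set is unspecified, so this case is
      separate.\<close>
    proof (cases "K = {}")
      case True
      then have "fin_character G a \<in> V" if "a \<in> carrier Z0" for a
        using K(3) fin_character_character[OF that] by (auto simp: char_near_def)
      then show ?thesis
        by (intro exI[of _ "carrier Z0"]) (use openin_topspace[of Z0_topology] in auto)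
    next
      case False
      have v_ge: "cmod (z k - 1) \<le> v k" if "z \<in> K" for z k
        unfolding v_def using bdd that by (rule cSUP_upper2) auto
      have v0: "v k \<ge> 0" for k
        using False v_ge norm_ge_zero order_trans by blast
      \<comment> \<open>By \<open>compact_tail\<close>, as the \<open>n\<close>-th coordinate of
        \<open>trunc n z\<close> is 1.\<close>
      have "v \<longlonglongrightarrow> 0"
      proof (rule LIMSEQ_I)
        fix r :: real assume r: "r > 0"
        obtain N where N: "\<And>n z. n \<ge> N \<Longrightarrow> z \<in> K \<Longrightarrow> d (trunc n z) z < r / 2"
          using compact_tail[OF K(1), of "r/2"] r by auto
        have "v n \<le> r / 2" if "n \<ge> N" for n
          unfolding v_def
        proof (rule cSUP_least[OF False])
          fix z assume z: "z \<in> K"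
          then have "cmod (trunc n z n - z n) \<le> d (trunc n z) z"
            using K_sub trunc_mem by (intro coord_le) auto
          then show "cmod (z n - 1) \<le> r / 2"
            using N[OF that z] by (simp add: trunc_def norm_minus_commute)
        qed
        then show "\<exists>N. \<forall>n\<ge>N. norm (v n - 0) < r"
          using v0 r by (intro exI[of _ N]) fastforce
      qed
      then have vw: "null_weights v" using v0 by (simp add: null_weights_def)
      then have w: "null_weights (\<lambda>k. (1/e) * v k)" using K(2) null_weights_scale[of v "1/e"] by simp
      define U where "U = {b \<in> carrier Z0. wsum (\<lambda>k. (1/e) * v k) (\<lambda>k. b k - 0) < 1}"
      have "fin_character G a \<in> V" if "a \<in> U" for a
      proof -
        have a: "a \<in> carrier Z0" "wsum v a < e"
          using that K(2) unfolding U_def wsum_scale by (auto simp: field_simps)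
        have "cmod (fin_character G a z - 1) < e" if z: "z \<in> K" for z
        proof -
          have zC: "z \<in> C" using z K_sub by auto
          have "cmod (fin_character G a z - 1) \<le> (\<Sum>k | a k \<noteq> 0. \<bar>of_int (a k)\<bar> * cmod (z k - 1))"
            unfolding fin_character_def using zC unit by (simp add: norm_prod_powi_diff_one_le)
          also have "\<dots> \<le> wsum v a"
            unfolding wsum_def using v_ge[OF z] by (intro sum_mono mult_left_mono) auto
          finally show ?thesis using a(2) by simp
        qed
        then have "fin_character G a \<in> char_near G K \<one>\<^bsub>dual G\<^esub> e"
          using fin_character_character[OF a(1)] K_sub by (auto simp: char_near_def one_dual subset_iff)
        with K(3) show ?thesis by blast
      qed
      moreover have "openin Z0_topology U" unfolding U_def by (rule Z0_ball_open[OF w]) simp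
      moreover have "(\<lambda>k. 0) \<in> U" by (simp add: U_def)
      ultimately show ?thesis by auto
    qed
  qed
  show "continuous_map (topo (dual G)) (topo ?Z) g"
  proof (rule hom_continuous_at_one[OF D topological_group_Z0 g_hom])
    fix V assume V: "openin (topo ?Z) V" "\<one>\<^bsub>?Z\<^esub> \<in> V"
    then have V': "\<forall>a\<in>V. \<exists>w. null_weights w \<and> (\<forall>b\<in>carrier Z0. wsum w (\<lambda>k. b k - a k) < 1 \<longrightarrow> b \<in> V)"
      "(\<lambda>k. 0) \<in> V"
      by (auto simp: openin_Z0)
    obtain w where w: "null_weights w" "\<And>b. b \<in> carrier Z0 \<Longrightarrow> wsum w b < 1 \<Longrightarrow> b \<in> V"
      using bspec[OF V'] by auto
    define K where "K = cis_seq ` test_angles (\<lambda>k. 2 * w k)"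
    have w2: "null_weights (\<lambda>k. 2 * w k)" using w(1) null_weights_scale[of w 2] by simp
    have K: "compactin mtopology K" "K \<subseteq> C" unfolding K_def using compact_test_set[OF w2] by auto
    have "\<one>\<^bsub>dual G\<^esub> \<in> characters G" using dual_one_character[OF topological_group_G] by (simp add: one_dual)
    then obtain U where U: "openin (topo (dual G)) U" "\<one>\<^bsub>dual G\<^esub> \<in> U" "U \<subseteq> char_near G K \<one>\<^bsub>dual G\<^esub> 1"
      using char_near_open[of "\<one>\<^bsub>dual G\<^esub>" G K 1] K(1) by auto
    have "g \<xi> \<in> V" if "\<xi> \<in> U" for \<xi>
    proof -
      have \<xi>: "\<xi> \<in> characters G" "\<And>z. z \<in> K \<Longrightarrow> cmod (\<xi> z - 1) < 1"
        using U(3) that K(2) by (auto simp: char_near_def one_dual subset_iff)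
      have "wsum w (g \<xi>) < 1"
        using fg[of \<xi>] \<xi> g_mem by (intro fin_character_small_imp_wsum_small[OF w(1)]) (auto simp: K_def)
      then show ?thesis using w(2) g_mem \<xi>(1) by blast
    qed
    with U show "\<exists>U. openin (topo (dual G)) U \<and> \<one>\<^bsub>dual G\<^esub> \<in> U \<and> g ` U \<subseteq> V" by blast
  qed
qed auto

end

section \<open>The finest group topology making the unit sequences converge\<close>

lemma null_group_topology_Z0: "null_group_topology Z0 unit_seq Z0_topology"
  unfolding null_group_topology_def
proof (intro conjI topological_group_Z0)
  show "Hausdorff_space Z0_topology"
    unfolding Hausdorff_space_def
  proof (intro allI impI)
    fix a b assume ab: "a \<in> topspace Z0_topology \<and> b \<in> topspace Z0_topology \<and> a \<noteq> b"
    then obtain k where k: "a k \<noteq> b k" by (auto simp: fun_eq_iff)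
    \<comment> \<open>Weight 1 on a single coordinate suffices: integers at distance less than 1 are
      equal.\<close>
    define w :: "nat \<Rightarrow> real" where "w j = (if j = k then 1 else 0)" for j
    have "w \<longlonglongrightarrow> 0"
      by (rule tendsto_eventually) (auto simp: w_def eventually_sequentially intro!: exI[of _ "Suc k"])
    then have w: "null_weights w" by (simp add: null_weights_def w_def)
    have coord: "c k = a k" if "a \<in> carrier Z0" "c \<in> carrier Z0" "wsum w (\<lambda>k. c k - a k) < 1" for a c
    proof -
      have F: "finite (insert k {j. c j - a j \<noteq> 0})"
        using Z0_closed(4)[OF that(2,1)] by (simp add: carrier_Z0)
      have "wsum w (\<lambda>k. c k - a k) = (\<Sum>j\<in>insert k {j. c j - a j \<noteq> 0}. \<bar>of_int (c j - a j)\<bar> * w j)"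
        by (rule wsum_eq[OF F]) auto
      also have "\<dots> = \<bar>of_int (c k - a k)\<bar>"
        using F by (subst sum.remove[of _ k]) (auto simp: w_def)
      finally have "\<bar>of_int (c k - a k) :: real\<bar> < 1" using that(3) by simp
      then have "\<bar>c k - a k\<bar> < 1" by linarith
      then show ?thesis by simp
    qed
    let ?B = "\<lambda>a. {c \<in> carrier Z0. wsum w (\<lambda>k. c k - a k) < 1}"
    have "disjnt (?B a) (?B b)"
      using coord[of a] coord[of b] ab k unfolding disjnt_iff topspace_Z0 by (metis (no_types, lifting) mem_Collect_eq)
    then show "\<exists>U V. openin Z0_topology U \<and> openin Z0_topology V \<and> a \<in> U \<and> b \<in> V \<and> disjnt U V"
      using Z0_ball_open[OF w] ab by (intro exI[of _ "?B a"] exI[of _ "?B b"]) simp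
  qed
  have e: "unit_seq n \<in> carrier Z0" for n by (simp add: unit_seq_def carrier_Z0)
  show "limitin Z0_topology unit_seq \<one>\<^bsub>Z0\<^esub> sequentially"
    unfolding limitin_def
  proof (intro conjI allI impI)
    fix U assume "openin Z0_topology U \<and> \<one>\<^bsub>Z0\<^esub> \<in> U"
    then have U: "\<forall>a\<in>U. \<exists>w. null_weights w \<and> (\<forall>b\<in>carrier Z0. wsum w (\<lambda>k. b k - a k) < 1 \<longrightarrow> b \<in> U)"
      "(\<lambda>k. 0) \<in> U" by (auto simp: openin_Z0)
    obtain w where w: "null_weights w" "\<And>b. b \<in> carrier Z0 \<Longrightarrow> wsum w b < 1 \<Longrightarrow> b \<in> U"
      using bspec[OF U] by auto
    have "wsum w (unit_seq n) = w n" for n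
      by (subst wsum_eq[of "{n}"]) (auto simp: unit_seq_def)
    moreover have "\<forall>\<^sub>F n in sequentially. w n < 1"
      using w(1) order_tendstoD(2)[of w 0 sequentially 1] by (simp add: null_weights_def)
    ultimately show "\<forall>\<^sub>F n in sequentially. unit_seq n \<in> U"
      using w(2) e by (auto elim!: eventually_mono)
  qed simp
qed

text \<open>Isolates the part of a group topology that the combinatorial argument uses: repeated
  halving of neighbourhoods of 0.\<close>

locale halving_chain =
  fixes V :: "nat \<Rightarrow> (nat \<Rightarrow> int) set"
  assumes zero: "(\<lambda>k. 0) \<in> V i"
    and add: "x \<in> V (Suc i) \<Longrightarrow> y \<in> V (Suc i) \<Longrightarrow> (\<lambda>k. x k + y k) \<in> V i"
begin

text \<open>Binary splitting: halving the number of summands costs one index of the chain.\<close>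

lemma sum_few:
  assumes "finite I" "card I \<le> 2 ^ m" "\<And>j. j \<in> I \<Longrightarrow> f j \<in> V (m + i)"
  shows "(\<lambda>k. \<Sum>j\<in>I. f j k) \<in> V i"
  using assms
proof (induction m arbitrary: I i)
  case 0
  then have "card I \<le> 1" by simp
  then have "card I = 0 \<or> card I = 1" by linarith
  then show ?case
  proof
    assume "card I = 0"
    then show ?thesis using 0 zero by simp
  next
    assume "card I = 1"
    then obtain j where "I = {j}" by (auto simp: card_1_singleton_iff)
    then show ?thesis using 0 by simp
  qed
next
  case (Suc m)
  obtain A where A: "A \<subseteq> I" "card A \<le> 2 ^ m" "card (I - A) \<le> 2 ^ m"
  proof (cases "card I \<le> 2 ^ m")
    case True
    then show thesis using that[of I] by simp
  next
    case False
    then obtain A where A: "A \<subseteq> I" "card A = 2 ^ m"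
      by (metis nle_le obtain_subset_with_card_n)
    then show thesis
      using that[of A] Suc.prems by (simp add: card_Diff_subset finite_subset)
  qed
  have "f j \<in> V (m + Suc i)" if "j \<in> I" for j
    using Suc.prems(3)[OF that] by simp
  then have "(\<lambda>k. \<Sum>j\<in>A. f j k) \<in> V (Suc i)" "(\<lambda>k. \<Sum>j\<in>I - A. f j k) \<in> V (Suc i)"
    using A Suc.prems by (auto intro!: Suc.IH intro: finite_subset)
  moreover have "(\<Sum>j\<in>I. f j k) = (\<Sum>j\<in>A. f j k) + (\<Sum>j\<in>I - A. f j k)" for k
    using sum.subset_diff[OF A(1) Suc.prems(1)] by (simp add: add.commute)
  ultimately show ?case using add by (simp only:)
qed

text \<open>After the first summand is split off, the rest lies in \<open>V (Suc i)\<close> by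
  induction. So the number of summands is arbitrary as long as their indices increase.\<close>

lemma sum_levels:
  assumes "\<And>j. j \<ge> i \<Longrightarrow> y j \<in> V (Suc j)"
  shows "(\<lambda>k. \<Sum>j=i..<i+n. y j k) \<in> V i"
  using assms
proof (induction n arbitrary: i)
  case 0
  then show ?case using zero by simp
next
  case (Suc n)
  have "(\<lambda>k. \<Sum>j=Suc i..<Suc i+n. y j k) \<in> V (Suc i)"
    using Suc.prems by (intro Suc.IH) auto
  moreover have "(\<Sum>j=i..<i + Suc n. y j k) = y i k + (\<Sum>j=Suc i..<Suc i+n. y j k)" for k
    using sum.atLeast_Suc_lessThan[of i "i + Suc n" "\<lambda>j. y j k"] by simp
  ultimately show ?case
    using add[OF Suc.prems[OF order_refl]] by (simp only:)
qed

text \<open>With \<open>\<plusminus>e\<^sub>k \<in> V\<^bsub>2l+1\<^esub>\<close> on the \<open>l\<close>-th level and weight \<open>2\<^sup>-\<^sup>l\<close> there, a vector of weight less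
  than 1 has fewer than \<open>2\<^sup>l\<close> summands on that level, which add up to an element of \<open>V\<^bsub>l+1\<^esub>\<close>.\<close>

lemma weights_exist:
  assumes ev: "\<And>i. \<forall>\<^sub>F n in sequentially. unit_seq n \<in> V i \<and> (\<lambda>k. - unit_seq n k) \<in> V i"
  obtains w where "null_weights w" "\<And>a. a \<in> carrier Z0 \<Longrightarrow> wsum w a < 1 \<Longrightarrow> a \<in> V 0"
proof -
  have "\<exists>N. \<forall>n\<ge>N. unit_seq n \<in> V i \<and> (\<lambda>k. - unit_seq n k) \<in> V i" for i
    using ev[of i] by (simp add: eventually_sequentially)
  then obtain N where N: "\<And>i n. n \<ge> N i \<Longrightarrow> unit_seq n \<in> V i \<and> (\<lambda>k. - unit_seq n k) \<in> V i"
    by metis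
  \<comment> \<open>Monotone thresholds above \<open>N (2 * l + 1)\<close>; the summand
    \<open>l\<close> makes them unbounded, so that \<open>level\<close> is well defined.\<close>
  define M where "M l = l + (\<Sum>i\<le>l. N (2 * i + 1))" for l
  have M_mono: "M l \<le> M l'" if "l \<le> l'" for l l'
    unfolding M_def using that by (intro add_mono sum_mono2) auto
  have M_ge: "N (2 * l + 1) \<le> M l" for l
    unfolding M_def using member_le_sum[of l "{..l}" "\<lambda>i. N (2 * i + 1)"] by simp
  define level where "level k = (LEAST l. k < M l)" for k
  have level_lt: "k < M (level k)" for k
    unfolding level_def by (rule LeastI[of _ "Suc k"]) (simp add: M_def)
  have level_gt: "level k > l" if "M l \<le> k" for k l
    using level_lt[of k] M_mono[of "level k" l] that by (meson leD le_less_trans not_le_imp_less order_trans)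
  have level_Suc: "M l \<le> k" if "level k = Suc l" for k l
    using not_less_Least[of l "\<lambda>l. k < M l"] that by (simp add: level_def not_less)
  \<comment> \<open>Indices with \<open>level k = Suc l\<close> get weight \<open>(1/2) ^ l\<close>.
    On level 0 the truncated subtraction gives weight 1, which forces \<open>a\<close> to vanish
    there.\<close>
  define w :: "nat \<Rightarrow> real" where "w k = (1/2) ^ (level k - 1)" for k
  have "w \<longlonglongrightarrow> 0"
  proof (rule LIMSEQ_I)
    fix r :: real assume r: "r > 0"
    obtain n where n: "(1/2) ^ n < r" using real_arch_pow_inv[of r "1/2"] r by auto
    have "w k < r" if "k \<ge> M n" for k
    proof -
      have "w k \<le> (1/2) ^ n" unfolding w_def using level_gt[OF that] by (intro power_decreasing) auto
      with n show ?thesis by simp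
    qed
    then show "\<exists>m. \<forall>k\<ge>m. norm (w k - 0) < r" by (auto simp: w_def)
  qed
  then have w: "null_weights w" by (simp add: null_weights_def w_def)
  moreover have "a \<in> V 0" if a: "a \<in> carrier Z0" "wsum w a < 1" for a
  proof -
    let ?F = "{k. a k \<noteq> 0}"
    have F: "finite ?F" using a by (simp add: carrier_Z0)
    have partial: "(\<Sum>k\<in>K. \<bar>of_int (a k)\<bar> * w k) < 1" if "K \<subseteq> ?F" for K
      using sum_mono2[OF F that, of "\<lambda>k. \<bar>of_int (a k)\<bar> * w k"] a(2) by (auto simp: wsum_def w_def)
    have level_pos: "level k > 0" if "a k \<noteq> 0" for k
    proof (rule ccontr)
      assume "\<not> level k > 0"
      then have "\<bar>of_int (a k)\<bar> < (1::real)" using partial[of "{k}"] that by (simp add: w_def)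
      then have "\<bar>a k\<bar> < 1" by linarith
      with that show False by simp
    qed
    define y where "y l k = (if level k = Suc l then a k else 0)" for l k
    have "y l \<in> V (Suc l)" for l
    proof -
      let ?K = "{k \<in> ?F. level k = Suc l}"
      \<comment> \<open>Each entry \<open>a k\<close> is split into \<open>\<bar>a k\<bar>\<close>
        signed unit vectors; the weighted sum over the level counts them.\<close>
      let ?I = "Sigma ?K (\<lambda>k. {..<nat \<bar>a k\<bar>})"
      let ?f = "\<lambda>(k, r::nat). \<lambda>x. sgn (a k) * unit_seq k x"
      have K: "finite ?K" using F by simp
      have "real (card ?I) * (1/2) ^ l = (\<Sum>k\<in>?K. \<bar>of_int (a k)\<bar> * w k)"
        using K by (simp add: card_SigmaI w_def sum_distrib_right)
      also have "\<dots> < 1" by (rule partial) auto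
      finally have "real (card ?I) < 2 ^ l" by (simp add: field_simps power_divide)
      then have "real (card ?I) \<le> real (2 ^ l)" by simp
      then have "card ?I \<le> 2 ^ l" by (simp only: of_nat_le_iff)
      moreover have "?f j \<in> V (l + Suc l)" if jI: "j \<in> ?I" for j
      proof -
        obtain k r where j: "j = (k, r)" "a k \<noteq> 0" "level k = Suc l" using jI by auto
        have "N (2 * l + 1) \<le> k" using level_Suc[OF j(3)] M_ge[of l] by simp
        then show ?thesis
          using N[of "2 * l + 1" k] j(1,2) by (cases "a k > 0") (auto simp: sgn_if mult_2)
      qed
      ultimately have "(\<lambda>x. \<Sum>j\<in>?I. ?f j x) \<in> V (Suc l)"
        using K by (intro sum_few) auto
      moreover have "(\<Sum>j\<in>?I. ?f j x) = y l x" for x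
      proof -
        have "(\<Sum>j\<in>?I. ?f j x) = (\<Sum>k\<in>?K. \<Sum>r<nat \<bar>a k\<bar>. sgn (a k) * unit_seq k x)"
          using K by (subst sum.Sigma) (auto simp: case_prod_beta)
        also have "\<dots> = (\<Sum>k\<in>?K. if k = x then a k else 0)"
          by (intro sum.cong) (auto simp: unit_seq_def sgn_if)
        also have "\<dots> = y l x" using K by (auto simp: y_def)
        finally show ?thesis .
      qed
      ultimately show ?thesis by (simp add: fun_eq_iff[symmetric])
    qed
    then have "(\<lambda>k. \<Sum>l=0..<0 + n. y l k) \<in> V 0" for n by (intro sum_levels)
    moreover obtain n where n: "\<And>k. k \<in> ?F \<Longrightarrow> level k \<le> n"
      using F finite_nat_set_iff_bounded_le[of "level ` ?F"] by auto
    have "(\<Sum>l=0..<0 + n. y l k) = a k" for k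
    proof (cases "a k = 0")
      case True
      then show ?thesis by (auto simp: y_def intro!: sum.neutral)
    next
      case False
      then obtain l where l: "level k = Suc l" using level_pos gr0_implies_Suc by blast
      then have "l < n" using n[of k] False by simp
      then show ?thesis using l by (simp add: y_def)
    qed
    ultimately show ?thesis by (metis (no_types, lifting) ext)
  qed
  ultimately show thesis using that by blast
qed

end

text \<open>A competing topology supplies, by dependent choice, a halving chain inside any given
  neighbourhood of 0, and \<open>weights_exist\<close> fits a weighted ball into its first
  member.\<close>

lemma finest_Z0_topology: "finest_null_group_topology Z0 unit_seq Z0_topology"
  unfolding finest_null_group_topology_def
proof (intro conjI allI impI null_group_topology_Z0)
  fix S U assume S: "null_group_topology Z0 unit_seq S" and U: "openin S U"
  let ?Z = "with_topology Z0 S"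
  have Z: "topological_group ?Z" and lim: "limitin S unit_seq (\<lambda>k. 0) sequentially"
    using S by (auto simp: null_group_topology_def)
  have tS: "topspace S = carrier Z0" using topological_groupD(2)[OF Z] by simp
  have mult: "continuous_map (prod_topology S S) S (\<lambda>(x, y). x \<otimes>\<^bsub>?Z\<^esub> y)"
    using topological_groupD(3)[OF Z] unfolding with_topology_simps(4) .
  have inv: "continuous_map S S (\<lambda>x. inv\<^bsub>?Z\<^esub> x)"
    using topological_groupD(4)[OF Z] unfolding with_topology_simps(4) .
  have half: "\<exists>V'. (openin S V' \<and> (\<lambda>k. 0) \<in> V') \<and> (\<forall>x\<in>V'. \<forall>y\<in>V'. (\<lambda>k. x k + y k) \<in> V)"
    if V: "openin S V" "(\<lambda>k. 0) \<in> V" for V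
  proof -
    define P where "P = {p \<in> topspace (prod_topology S S). (\<lambda>(x, y). x \<otimes>\<^bsub>?Z\<^esub> y) p \<in> V}"
    have "openin (prod_topology S S) P"
      unfolding P_def by (rule openin_continuous_map_preimage[OF mult V(1)])
    moreover have "((\<lambda>k. 0), (\<lambda>k. 0)) \<in> P" using V(2) tS by (simp add: P_def)
    ultimately have "\<exists>A B. openin S A \<and> openin S B \<and> (\<lambda>k. 0) \<in> A \<and> (\<lambda>k. 0) \<in> B \<and> A \<times> B \<subseteq> P"
      by (rule openin_prod_topology_alt[THEN iffD1, rule_format])
    then obtain A B where AB: "openin S A" "openin S B" "(\<lambda>k. 0) \<in> A" "(\<lambda>k. 0) \<in> B" "A \<times> B \<subseteq> P"
      by (elim exE conjE)
    have "(\<lambda>k. x k + y k) \<in> V" if "x \<in> A \<inter> B" "y \<in> A \<inter> B" for x y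
    proof -
      have "(x, y) \<in> P" using that AB(5) by auto
      then show ?thesis by (simp add: P_def)
    qed
    then show ?thesis
      using AB by (intro exI[of _ "A \<inter> B"]) auto
  qed
  show "openin Z0_topology U"
    unfolding openin_Z0
  proof (intro conjI ballI)
    show "U \<subseteq> carrier Z0" using openin_subset[OF U] tS by simp
    fix a assume a: "a \<in> U"
    have aZ: "a \<in> carrier Z0" using a \<open>U \<subseteq> carrier Z0\<close> by auto
    define U' where "U' = {x \<in> topspace S. a \<otimes>\<^bsub>?Z\<^esub> x \<in> U}"
    have cm: "continuous_map S S (\<lambda>x. a \<otimes>\<^bsub>?Z\<^esub> x)"
      using continuous_map_left_mult[OF Z, of a] aZ unfolding with_topology_simps(1,4) by blast
    have U': "openin S U'"
      unfolding U'_def by (rule openin_continuous_map_preimage[OF cm U])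
    have U'0: "(\<lambda>k. 0) \<in> U'" using a tS by (simp add: U'_def)
    \<comment> \<open>The implication from \<open>n = 0\<close> anchors the chain inside
      \<open>U'\<close>, the translate of \<open>U\<close> that contains 0.\<close>
    have "\<exists>V. \<forall>n. (openin S (V n) \<and> (\<lambda>k. 0) \<in> V n \<and> (n = 0 \<longrightarrow> V n \<subseteq> U')) \<and>
        (\<forall>x\<in>V (Suc n). \<forall>y\<in>V (Suc n). (\<lambda>k. x k + y k) \<in> V n)"
    proof (rule dependent_nat_choice)
      show "\<exists>V. openin S V \<and> (\<lambda>k. 0) \<in> V \<and> (0 = (0::nat) \<longrightarrow> V \<subseteq> U')" using U' U'0 by blast
    next
      fix V and n :: nat assume "openin S V \<and> (\<lambda>k. 0) \<in> V \<and> (n = 0 \<longrightarrow> V \<subseteq> U')"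
      then obtain W where "openin S W \<and> (\<lambda>k. 0) \<in> W" "\<forall>x\<in>W. \<forall>y\<in>W. (\<lambda>k. x k + y k) \<in> V"
        using half[of V] by (elim conjE exE) blast
      then show "\<exists>W. (openin S W \<and> (\<lambda>k. 0) \<in> W \<and> (Suc n = 0 \<longrightarrow> W \<subseteq> U')) \<and>
          (\<forall>x\<in>W. \<forall>y\<in>W. (\<lambda>k. x k + y k) \<in> V)"
        by (intro exI[of _ W]) simp
    qed
    then obtain V where "\<forall>n. (openin S (V n) \<and> (\<lambda>k. 0) \<in> V n \<and> (n = 0 \<longrightarrow> V n \<subseteq> U')) \<and>
        (\<forall>x\<in>V (Suc n). \<forall>y\<in>V (Suc n). (\<lambda>k. x k + y k) \<in> V n)"
      by (elim exE)
    then have V: "\<And>n. openin S (V n) \<and> (\<lambda>k. 0) \<in> V n \<and> (n = 0 \<longrightarrow> V n \<subseteq> U')"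
      "\<And>n. \<forall>x\<in>V (Suc n). \<forall>y\<in>V (Suc n). (\<lambda>k. x k + y k) \<in> V n"
      by blast+
    interpret halving_chain V by unfold_locales (use V in auto)
    have "\<forall>\<^sub>F n in sequentially. unit_seq n \<in> V i \<and> (\<lambda>k. - unit_seq n k) \<in> V i" for i
    proof -
      have "limitin S ((\<lambda>x. inv\<^bsub>?Z\<^esub> x) \<circ> unit_seq) (inv\<^bsub>?Z\<^esub> (\<lambda>k. 0)) sequentially"
        using continuous_map_limit[OF inv lim] .
      moreover have "inv\<^bsub>?Z\<^esub> (unit_seq n) = (\<lambda>k. - unit_seq n k)" for n
        by (rule inv_Z0) (simp add: unit_seq_def carrier_Z0)
      moreover have "inv\<^bsub>?Z\<^esub> (\<lambda>k. 0) = (\<lambda>k. 0)" by (subst inv_Z0) auto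
      ultimately have "limitin S (\<lambda>n. \<lambda>k. - unit_seq n k) (\<lambda>k. 0) sequentially" by (simp add: o_def)
      then show ?thesis
        using lim V(1)[of i] by (auto simp: limitin_def intro!: eventually_conj)
    qed
    then obtain w where w: "null_weights w" "\<And>a. a \<in> carrier Z0 \<Longrightarrow> wsum w a < 1 \<Longrightarrow> a \<in> V 0"
      using weights_exist by blast
    have "b \<in> U" if b: "b \<in> carrier Z0" "wsum w (\<lambda>k. b k - a k) < 1" for b
    proof -
      have "(\<lambda>k. b k - a k) \<in> U'" using w(2)[OF Z0_closed(4)[OF b(1) aZ] b(2)] V(1)[of 0] by auto
      then show ?thesis by (simp add: U'_def)
    qed
    with w(1) show "\<exists>w. null_weights w \<and> (\<forall>b\<in>carrier Z0. wsum w (\<lambda>k. b k - a k) < 1 \<longrightarrow> b \<in> U)"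
      by blast
  qed
qed

section \<open>Failure of local quasi-convexity\<close>

text \<open>A character in the polar of a small ball has exponents of bounded l1-norm, so at a point
  with all angles 0 or \<open>\<theta>\<close> its phase is at most \<open>pi / 2\<close>,
  regardless of the number of nonzero angles. By \<open>big\<close> such points leave the unit ball,
  hence no quasi-convex set fits between the two balls. For the supremum metric \<open>big\<close>
  is false.\<close>

lemma (in flat_sequences) not_locally_quasi_convex:
  assumes big: "\<And>\<theta>. 0 < \<theta> \<Longrightarrow> \<theta> \<le> 1 \<Longrightarrow> \<exists>N. d (trunc N (\<lambda>k. cis \<theta>)) (\<lambda>k. 1) \<ge> 1"
  shows "\<not> locally_quasi_convex G"
proof
  assume lqc: "locally_quasi_convex G"
  have "openin (topo G) (mball (\<lambda>k. 1) 1) \<and> \<one>\<^bsub>G\<^esub> \<in> mball (\<lambda>k. 1) 1" using one_mem by simp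
  then obtain A V where AV: "quasi_convex G A" "openin mtopology V" "(\<lambda>k. 1) \<in> V" "V \<subseteq> A" "A \<subseteq> mball (\<lambda>k. 1) 1"
    using lqc[unfolded locally_quasi_convex_def, rule_format, of "mball (\<lambda>k. 1) 1"] by auto
  obtain r where r: "r > 0" "mball (\<lambda>k. 1) r \<subseteq> V"
    using AV(2,3) by (auto simp: openin_mtopology)
  obtain c where c: "c > 0" "\<And>a F. finite F \<Longrightarrow>
    (\<And>z. z \<in> C \<Longrightarrow> (\<And>k. k \<notin> F \<Longrightarrow> z k = 1) \<Longrightarrow> d z (\<lambda>k. 1) < r \<Longrightarrow> Re (\<Prod>k\<in>F. z k powi a k) \<ge> 0) \<Longrightarrow>
    (\<Sum>k\<in>F. \<bar>of_int (a k)\<bar>) * c \<le> pi / 2"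
    using flat_character_bound[OF r(1)] by blast
  \<comment> \<open>At most \<open>c\<close> for the phase estimate, at most 1 for
    \<open>big\<close>.\<close>
  define \<theta> where "\<theta> = min c 1"
  have \<theta>: "0 < \<theta>" "\<theta> \<le> 1" "\<theta> \<le> c" using c(1) by (auto simp: \<theta>_def)
  obtain N where N: "d (trunc N (\<lambda>k. cis \<theta>)) (\<lambda>k. 1) \<ge> 1" using big \<theta> by blast
  define g where "g = trunc N (\<lambda>k. cis \<theta>)"
  have gC: "g \<in> C" unfolding g_def by (rule trunc_mem_unit) simp
  have "g \<notin> A" using AV(5) N by (auto simp: g_def commute)
  then obtain \<xi> where \<xi>: "\<xi> \<in> polar G A" "Re (\<xi> g) < 0"
    using AV(1) gC by (auto simp: quasi_convex_def)
  then have \<xi>_char: "\<xi> \<in> characters G" and pos: "\<And>z. z \<in> A \<Longrightarrow> Re (\<xi> z) \<ge> 0"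
    by (auto simp: polar_def)
  obtain a where a: "a \<in> carrier Z0" "\<xi> = fin_character G a"
    using character_is_fin_character[OF \<xi>_char] by blast
  let ?F = "{k. a k \<noteq> 0}"
  have F: "finite ?F" using a by (simp add: carrier_Z0)
  have "(\<Sum>k\<in>?F. \<bar>of_int (a k)\<bar>) * c \<le> pi / 2"
  proof (rule c(2)[OF F])
    fix z assume z: "z \<in> C" "d z (\<lambda>k. 1) < r"
    then have "z \<in> A" using r(2) AV(4) one_mem by (auto simp: commute)
    then have "Re (\<xi> z) \<ge> 0" by (rule pos)
    then show "Re (\<Prod>k\<in>?F. z k powi a k) \<ge> 0" using z(1) by (simp add: a(2) fin_character_def)
  qed
  moreover have "(\<Sum>k\<in>?F. \<bar>of_int (a k)\<bar>) * \<theta> \<le> (\<Sum>k\<in>?F. \<bar>of_int (a k)\<bar>) * c"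
    using \<theta>(3) by (intro mult_left_mono sum_nonneg) auto
  ultimately have le: "(\<Sum>k\<in>?F. \<bar>of_int (a k)\<bar>) * \<theta> \<le> pi / 2" by simp
  define t where "t k = (if k < N then \<theta> else 0)" for k
  have "g = (\<lambda>k. cis (t k))" by (auto simp: g_def t_def trunc_def)
  then have "\<xi> g = cis (\<Sum>k\<in>?F. of_int (a k) * t k)"
    using gC by (simp add: a(2) fin_character_def prod_cis_powi)
  moreover have "\<bar>\<Sum>k\<in>?F. of_int (a k) * t k\<bar> \<le> (\<Sum>k\<in>?F. \<bar>of_int (a k)\<bar> * \<theta>)"
    using \<theta>(1) by (intro order_trans[OF sum_abs] sum_mono) (auto simp: abs_mult t_def)
  ultimately have "Re (\<xi> g) \<ge> 0"
    using le by (auto simp: sum_distrib_right[symmetric] abs_le_iff intro!: cos_ge_zero)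
  with \<xi>(2) show False by simp
qed

section \<open>The groups of null sequences and of p-summable sequences\<close>

lemma norm_cis_diff_one_le: "cmod (cis t - 1) \<le> \<bar>t\<bar>"
  using dist_exp_i_1[of t] abs_sin_x_le_abs_x[of "t / 2"] by (simp add: cis_conv_exp)

section \<open>Minkowski's inequality for nonnegative sequences\<close>

definition lp_norm :: "real \<Rightarrow> (nat \<Rightarrow> real) \<Rightarrow> real" where
  "lp_norm p x = (\<Sum>k. x k powr p) powr (1 / p)"

lemma lp_norm_nonneg: "lp_norm p x \<ge> 0"
  by (simp add: lp_norm_def)

lemma lp_norm_powr:
  assumes "p > 0" "summable (\<lambda>k. x k powr p)"
  shows "lp_norm p x powr p = (\<Sum>k. x k powr p)"
  using assms by (simp add: lp_norm_def powr_powr suminf_nonneg)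

lemma lp_norm_mono:
  assumes "p > 0" "\<And>k. 0 \<le> x k" "\<And>k. x k \<le> y k" "summable (\<lambda>k. y k powr p)"
  shows "summable (\<lambda>k. x k powr p)" "lp_norm p x \<le> lp_norm p y"
proof -
  have le: "x k powr p \<le> y k powr p" for k using assms by (intro powr_mono2) auto
  show s: "summable (\<lambda>k. x k powr p)"
    by (rule summable_comparison_test'[OF assms(4), of 0]) (use le in auto)
  show "lp_norm p x \<le> lp_norm p y"
    unfolding lp_norm_def using assms(1) suminf_le[OF le s assms(4)] s
    by (intro powr_mono2 suminf_nonneg) auto
qed

lemma lp_norm_ge:
  assumes "p > 0" "x k \<ge> 0" "summable (\<lambda>k. x k powr p)"
  shows "x k \<le> lp_norm p x"
proof -
  have "x k powr p \<le> (\<Sum>k. x k powr p)"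
    using sum_le_suminf[OF assms(3), of "{k}"] by simp
  then have "(x k powr p) powr (1 / p) \<le> lp_norm p x"
    unfolding lp_norm_def using assms(1) by (intro powr_mono2) auto
  then show ?thesis using assms by (simp add: powr_powr)
qed

lemma lp_norm_eq_0_iff:
  assumes "p > 0" "\<And>k. x k \<ge> 0" "summable (\<lambda>k. x k powr p)"
  shows "lp_norm p x = 0 \<longleftrightarrow> (\<forall>k. x k = 0)"
proof
  assume "lp_norm p x = 0"
  then show "\<forall>k. x k = 0" using lp_norm_ge[OF assms(1) assms(2) assms(3)] assms(2) by (metis antisym)
qed (simp add: lp_norm_def)

lemma lp_norm_finite:
  assumes "p > 0" "finite F" "\<And>k. k \<notin> F \<Longrightarrow> x k = 0"
  shows "summable (\<lambda>k. x k powr p)" "lp_norm p x = (\<Sum>k\<in>F. x k powr p) powr (1 / p)"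
proof -
  have "(\<lambda>k. x k powr p) sums (\<Sum>k\<in>F. x k powr p)"
    using assms by (intro sums_finite) auto
  then show "summable (\<lambda>k. x k powr p)" "lp_norm p x = (\<Sum>k\<in>F. x k powr p) powr (1 / p)"
    by (auto simp: lp_norm_def sums_iff)
qed

text \<open>Positive arguments are covered by \<open>powr_convex\<close>; when one argument is 0,
  the claim reduces to \<open>s powr p \<le> s\<close> on the unit interval.\<close>

lemma powr_convex_nonneg:
  fixes x y l p :: real
  assumes p: "p \<ge> 1" and l: "0 \<le> l" "l \<le> 1" and xy: "x \<ge> 0" "y \<ge> 0"
  shows "(l * x + (1 - l) * y) powr p \<le> l * x powr p + (1 - l) * y powr p"
proof -
  have le: "s powr p \<le> s" if "0 \<le> s" "s \<le> 1" for s
    using powr_mono'[of 1 p s] that p by (cases "s = 0") auto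
  consider "x = 0" | "y = 0" | "x > 0" "y > 0" using xy by linarith
  then show ?thesis
  proof cases
    case 1
    then show ?thesis using le[of "1 - l"] l xy p by (simp add: powr_mult mult_right_mono)
  next
    case 2
    then show ?thesis using le[of l] l xy p by (simp add: powr_mult mult_right_mono)
  next
    case 3
    have "convex_on {0<..} (\<lambda>x::real. x powr p)" using p by (rule powr_convex)
    from convex_onD[OF this, of "1 - l" x y] 3 l show ?thesis by simp
  qed
qed

text \<open>Normalise both sequences and use convexity of the power with weights proportional to the
  two norms; a vanishing norm is treated first.\<close>

lemma lp_norm_add:
  assumes p: "p \<ge> 1" and x: "\<And>k. x k \<ge> 0" "summable (\<lambda>k. x k powr p)"
    and y: "\<And>k. y k \<ge> 0" "summable (\<lambda>k. y k powr p)"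
  shows "summable (\<lambda>k. (x k + y k) powr p)" "lp_norm p (\<lambda>k. x k + y k) \<le> lp_norm p x + lp_norm p y"
proof -
  have p0: "p > 0" using p by simp
  have "(x k + y k) powr p \<le> 2 powr p * (x k powr p + y k powr p)" for k
  proof -
    have "(x k + y k) powr p \<le> (2 * max (x k) (y k)) powr p"
      using x y p by (intro powr_mono2) (auto simp: max_def)
    also have "\<dots> = 2 powr p * max (x k) (y k) powr p" using x y by (simp add: powr_mult)
    also have "\<dots> \<le> 2 powr p * (x k powr p + y k powr p)" by (auto simp: max_def)
    finally show ?thesis .
  qed
  then show s: "summable (\<lambda>k. (x k + y k) powr p)"
    by (intro summable_comparison_test'[OF summable_mult[OF summable_add[OF x(2) y(2)], of "2 powr p"], of 0]) auto
  let ?A = "lp_norm p x" and ?B = "lp_norm p y"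
  show "lp_norm p (\<lambda>k. x k + y k) \<le> ?A + ?B"
  proof (cases "?A = 0 \<or> ?B = 0")
    case True
    then show ?thesis
      using lp_norm_eq_0_iff[OF p0 x] lp_norm_eq_0_iff[OF p0 y] lp_norm_nonneg by auto
  next
    case False
    then have pos: "?A > 0" "?B > 0" using lp_norm_nonneg[of p] by (auto simp: less_le)
    \<comment> \<open>With this weight the normalised sequences combine to
      \<open>(x k + y k) / (?A + ?B)\<close>.\<close>
    define l where "l = ?A / (?A + ?B)"
    have l: "0 \<le> l" "l \<le> 1" "1 - l = ?B / (?A + ?B)" using pos by (auto simp: l_def field_simps)
    have le: "(x k + y k) powr p \<le> (?A + ?B) powr p * (l * (x k powr p / ?A powr p) + (1 - l) * (y k powr p / ?B powr p))" for k
    proof -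
      have "l * (x k / ?A) = x k / (?A + ?B)" "(1 - l) * (y k / ?B) = y k / (?A + ?B)"
        unfolding l(3) using pos by (simp_all add: l_def)
      then have "x k + y k = (?A + ?B) * (l * (x k / ?A) + (1 - l) * (y k / ?B))"
        using pos by (simp flip: add_divide_distrib)
      then have "(x k + y k) powr p = (?A + ?B) powr p * (l * (x k / ?A) + (1 - l) * (y k / ?B)) powr p"
        using pos x y l by (simp add: powr_mult del: l(3))
      also have "\<dots> \<le> (?A + ?B) powr p * (l * (x k / ?A) powr p + (1 - l) * (y k / ?B) powr p)"
        using pos x y l(1,2) p by (intro mult_left_mono powr_convex_nonneg) auto
      finally show ?thesis using pos x y by (simp add: powr_divide)
    qed
    have sums: "(\<lambda>k. (?A + ?B) powr p * (l * (x k powr p / ?A powr p) + (1 - l) * (y k powr p / ?B powr p)))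
       sums ((?A + ?B) powr p * (l * (?A powr p / ?A powr p) + (1 - l) * (?B powr p / ?B powr p)))"
      using x(2) y(2) by (intro sums_mult sums_add sums_divide) (simp_all add: lp_norm_powr p0 summable_sums)
    have "(\<Sum>k. (x k + y k) powr p) \<le> (?A + ?B) powr p"
      using suminf_le[OF le s sums_summable[OF sums]] sums_unique[OF sums] pos by simp
    then have "lp_norm p (\<lambda>k. x k + y k) \<le> ((?A + ?B) powr p) powr (1 / p)"
      unfolding lp_norm_def[of p "\<lambda>k. x k + y k"] using p0 s by (intro powr_mono2 suminf_nonneg) auto
    then show ?thesis using pos p0 by (simp add: powr_powr)
  qed
qed

text \<open>The \<open>p\<close>-th powers of these norms are the remainders of a convergent
  series.\<close>

lemma lp_norm_tail_tendsto:
  assumes p: "p > 0" and x: "summable (\<lambda>k. x k powr p)"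
  shows "(\<lambda>n. lp_norm p (\<lambda>k. if k < n then 0 else x k)) \<longlonglongrightarrow> 0"
proof -
  have tail: "(\<lambda>k. (if k < n then 0 else x k) powr p) sums ((\<Sum>k. x k powr p) - (\<Sum>k<n. x k powr p))" for n
  proof -
    have 1: "(\<lambda>k. if k < n then x k powr p else 0) sums (\<Sum>k<n. x k powr p)"
      using sums_If_finite_set[of "{..<n}" "\<lambda>k. x k powr p"] by simp
    have "(\<lambda>k. x k powr p - (if k < n then x k powr p else 0)) sums ((\<Sum>k. x k powr p) - (\<Sum>k<n. x k powr p))"
      by (intro sums_diff 1 summable_sums x)
    moreover have "x k powr p - (if k < n then x k powr p else 0) = (if k < n then 0 else x k) powr p" for k
      using p by auto
    ultimately show ?thesis by simp
  qed
  have eq: "(\<Sum>k. (if k < n then 0 else x k) powr p) = (\<Sum>k. x k powr p) - (\<Sum>k<n. x k powr p)"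
    and nonneg: "(\<Sum>k. (if k < n then 0 else x k) powr p) \<ge> 0" for n
    using sums_unique[OF tail] suminf_nonneg[OF sums_summable[OF tail]] by auto
  have "(\<lambda>n. (\<Sum>k. x k powr p) - (\<Sum>k<n. x k powr p)) \<longlonglongrightarrow> (\<Sum>k. x k powr p) - (\<Sum>k. x k powr p)"
    by (intro tendsto_intros summable_LIMSEQ x)
  then have "(\<lambda>n. (\<Sum>k. (if k < n then 0 else x k) powr p)) \<longlonglongrightarrow> 0" by (simp add: eq)
  then show ?thesis
    unfolding lp_norm_def using p nonneg
    by (intro tendsto_zero_powrI[where b="1/p"]) (auto intro!: always_eventually)
qed

section \<open>The groups of p-summable sequences\<close>

lemma TH_dist_eq: "TH_dist p z w = lp_norm p (\<lambda>k. cmod (z k - w k))"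
  by (simp add: TH_dist_def lp_norm_def)

lemma TH_seq_group: "TH p = seq_group (TH_carrier p) (TH_dist p)"
  by (simp add: TH_def seq_group_def)

lemma TH0_seq_group: "TH0 = seq_group TH0_carrier TH0_dist"
  by (simp add: TH0_def seq_group_def)

lemma norm_one_diff_mult_le:
  assumes "cmod z = 1" "cmod w = 1"
  shows "cmod (1 - z * w) \<le> cmod (1 - z) + cmod (1 - w)"
proof -
  have "cmod (1 - z * w) = cmod ((1 - z) + z * (1 - w))" by (simp add: algebra_simps)
  also have "\<dots> \<le> cmod (1 - z) + cmod (z * (1 - w))" by (rule norm_triangle_ineq)
  finally show ?thesis using assms by (simp add: norm_mult)
qed

lemma circle_sequences_TH:
  assumes p: "p \<ge> 1"
  shows "circle_sequences (TH_carrier p) (TH_dist p)"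
proof -
  let ?C = "TH_carrier p"
  have p0: "p > 0" using p by simp
  have unit: "cmod (z k) = 1" if "z \<in> ?C" for z k using that by (simp add: TH_carrier_def)
  have sm1: "summable (\<lambda>k. cmod (1 - z k) powr p)" if "z \<in> ?C" for z using that by (simp add: TH_carrier_def)
  have sm: "summable (\<lambda>k. cmod (z k - w k) powr p)" if "z \<in> ?C" "w \<in> ?C" for z w
  proof (rule lp_norm_mono(1)[OF p0])
    show "summable (\<lambda>k. (cmod (1 - z k) + cmod (1 - w k)) powr p)"
      by (rule lp_norm_add(1)[OF p _ sm1 _ sm1]) (use that in auto)
    show "cmod (z k - w k) \<le> cmod (1 - z k) + cmod (1 - w k)" for k
      using norm_triangle_ineq4[of "1 - w k" "1 - z k"] by (simp add: algebra_simps)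
  qed auto
  have metric: "Metric_space ?C (TH_dist p)"
  proof
    show "0 \<le> TH_dist p x y" for x y by (simp add: TH_dist_eq lp_norm_nonneg)
    show "TH_dist p x y = TH_dist p y x" for x y by (simp add: TH_dist_eq norm_minus_commute)
    show "TH_dist p x y = 0 \<longleftrightarrow> x = y" if "x \<in> ?C" "y \<in> ?C" for x y
      unfolding TH_dist_eq using lp_norm_eq_0_iff[OF p0 _ sm[OF that]] by (auto simp: fun_eq_iff)
    show "TH_dist p x z \<le> TH_dist p x y + TH_dist p y z" if "x \<in> ?C" "y \<in> ?C" "z \<in> ?C" for x y z
    proof -
      have s: "summable (\<lambda>k. (cmod (x k - y k) + cmod (y k - z k)) powr p)"
        "lp_norm p (\<lambda>k. cmod (x k - y k) + cmod (y k - z k)) \<le> TH_dist p x y + TH_dist p y z"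
        unfolding TH_dist_eq by (rule lp_norm_add[OF p _ sm _ sm]; use that in simp)+
      have "TH_dist p x z \<le> lp_norm p (\<lambda>k. cmod (x k - y k) + cmod (y k - z k))"
        unfolding TH_dist_eq
      proof (rule lp_norm_mono(2)[OF p0 _ _ s(1)])
        show "cmod (x k - z k) \<le> cmod (x k - y k) + cmod (y k - z k)" for k
          using norm_triangle_ineq[of "x k - y k" "y k - z k"] by simp
      qed simp
      with s(2) show ?thesis by simp
    qed
  qed
  show ?thesis
    unfolding circle_sequences_def circle_sequences_axioms_def
  proof (intro conjI allI impI metric)
    show "cmod (z k) = 1" if "z \<in> ?C" for z k using unit that .
    show "(\<lambda>k. 1) \<in> ?C" by (simp add: TH_carrier_def)
    show "(\<lambda>k. z k * w k) \<in> ?C" if zw: "z \<in> ?C" "w \<in> ?C" for z w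
    proof -
      have "summable (\<lambda>k. cmod (1 - z k * w k) powr p)"
        by (rule lp_norm_mono(1)[OF p0 _ norm_one_diff_mult_le[OF unit unit] lp_norm_add(1)[OF p _ sm1 _ sm1]])
          (use zw in auto)
      moreover have "cmod (z k * w k) = 1" for k
        using unit[OF zw(1), of k] unit[OF zw(2), of k] by (simp add: norm_mult)
      ultimately show ?thesis by (simp add: TH_carrier_def)
    qed
    show "(\<lambda>k. cnj (z k)) \<in> ?C" if "z \<in> ?C" for z
    proof -
      have "cmod (1 - cnj (z k)) = cmod (1 - z k)" for k
        by (metis complex_cnj_diff complex_cnj_one complex_mod_cnj)
      then show ?thesis using that by (simp add: TH_carrier_def)
    qed
    show "single_seq k u \<in> ?C" if "cmod u = 1" for k u
    proof -
      have "summable (\<lambda>j. cmod (1 - single_seq k u j) powr p)"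
        by (rule lp_norm_finite(1)[OF p0, of "{k}"]) (auto simp: single_seq_def)
      then show ?thesis using that by (simp add: TH_carrier_def single_seq_def)
    qed
    show "TH_dist p (\<lambda>k. x k * z k) (\<lambda>k. x k * w k) = TH_dist p z w" if "x \<in> ?C" for x z w
    proof -
      have "cmod (x k * z k - x k * w k) = cmod (z k - w k)" for k
        using unit[OF that, of k] by (metis mult_1 norm_mult right_diff_distrib)
      then show ?thesis by (simp add: TH_dist_eq)
    qed
    show "cmod (z k - w k) \<le> TH_dist p z w" if "z \<in> ?C" "w \<in> ?C" for z w k
      unfolding TH_dist_eq using lp_norm_ge[OF p0 _ sm[OF that], of k] by simp
    show "TH_dist p (single_seq k u) (single_seq k v) \<le> cmod (u - v)" for k u v
      unfolding TH_dist_eq using p0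
      by (subst lp_norm_finite(2)[of p "{k}"]) (auto simp: single_seq_def powr_powr)
    show "TH_dist p (trunc n z) (trunc n w) \<le> TH_dist p z w" if "z \<in> ?C" "w \<in> ?C" for z w n
      unfolding TH_dist_eq using sm[OF that] by (intro lp_norm_mono(2) p0) (auto simp: trunc_def)
    show "(\<lambda>n. TH_dist p (trunc n z) z) \<longlonglongrightarrow> 0" if "z \<in> ?C" for z
    proof -
      have "(\<lambda>k. cmod (trunc n z k - z k)) = (\<lambda>k. if k < n then 0 else cmod (1 - z k))" for n
        by (auto simp: trunc_def)
      then show ?thesis
        unfolding TH_dist_eq using lp_norm_tail_tendsto[OF p0 sm1[OF that]] by simp
    qed
  qed
qed

lemma flat_sequences_TH:
  assumes p: "p > 1"
  shows "flat_sequences (TH_carrier p) (TH_dist p)"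
proof -
  interpret circle_sequences "TH_carrier p" "TH_dist p" using p by (intro circle_sequences_TH) simp
  show ?thesis
  proof
    fix \<delta> :: real assume \<delta>: "\<delta> > 0"
    \<comment> \<open>Since \<open>\<bar>t k\<bar> powr p \<le> c powr (p - 1) * \<bar>t
      k\<bar>\<close> and the l1-norm is at most 4, the sum of the \<open>p\<close>-th powers is at
      most half of \<open>\<delta> powr p\<close>. The exponent \<open>1 / (p - 1)\<close> is where
      \<open>p > 1\<close> enters.\<close>
    define c where "c = min 1 ((\<delta> powr p / 8) powr (1 / (p - 1)))"
    have c: "c > 0" "c \<le> 1" using \<delta> by (auto simp: c_def)
    have "c powr (p - 1) \<le> ((\<delta> powr p / 8) powr (1 / (p - 1))) powr (p - 1)"
      using c p by (intro powr_mono2) (auto simp: c_def)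
    then have c_le: "c powr (p - 1) \<le> \<delta> powr p / 8" using p \<delta> by (simp add: powr_powr)
    have "cis_seq t \<in> TH_carrier p \<and> TH_dist p (cis_seq t) (\<lambda>k. 1) < \<delta>" if t: "small_angles c t" for t
    proof -
      have tc: "\<bar>t k\<bar> \<le> c" and ts: "summable (\<lambda>k. \<bar>t k\<bar>)" "(\<Sum>k. \<bar>t k\<bar>) \<le> 4" for k
        using t by (auto simp: small_angles_def)
      have le: "cmod (cis (t k) - 1) powr p \<le> c powr (p - 1) * \<bar>t k\<bar>" for k
      proof -
        have "cmod (cis (t k) - 1) powr p \<le> \<bar>t k\<bar> powr p"
          using norm_cis_diff_one_le p by (intro powr_mono2) auto
        also have "\<dots> = \<bar>t k\<bar> powr (p - 1) * \<bar>t k\<bar>"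
          using powr_add[of "\<bar>t k\<bar>" "p - 1" 1] by simp
        also have "\<dots> \<le> c powr (p - 1) * \<bar>t k\<bar>"
          using tc p by (intro mult_right_mono powr_mono2) auto
        finally show ?thesis .
      qed
      have s: "summable (\<lambda>k. cmod (cis (t k) - 1) powr p)"
        by (rule summable_comparison_test'[OF summable_mult[OF ts(1), of "c powr (p - 1)"], of 0]) (use le in auto)
      have "(\<Sum>k. cmod (cis (t k) - 1) powr p) \<le> (\<Sum>k. c powr (p - 1) * \<bar>t k\<bar>)"
        using s ts(1) le by (intro suminf_le summable_mult) auto
      also have "\<dots> = c powr (p - 1) * (\<Sum>k. \<bar>t k\<bar>)" using ts(1) by (rule suminf_mult)
      also have "\<dots> \<le> (\<delta> powr p / 8) * 4" using ts c_le by (intro mult_mono suminf_nonneg) auto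
      also have "\<dots> < \<delta> powr p" using \<delta> by simp
      finally have "(\<Sum>k. cmod (cis (t k) - 1) powr p) powr (1 / p) < (\<delta> powr p) powr (1 / p)"
        using p s by (intro powr_less_mono2 suminf_nonneg) auto
      then have "TH_dist p (cis_seq t) (\<lambda>k. 1) < \<delta>"
        using \<delta> p by (simp add: TH_dist_def cis_seq_def powr_powr)
      moreover have "cis_seq t \<in> TH_carrier p"
        using s by (simp add: TH_carrier_def cis_seq_def norm_minus_commute)
      ultimately show ?thesis by simp
    qed
    with c(1) show "\<exists>c>0. \<forall>t. small_angles c t \<longrightarrow>
        cis_seq t \<in> TH_carrier p \<and> TH_dist p (cis_seq t) (\<lambda>k. 1) < \<delta>" by blast
  qed
qed

text \<open>However small the common angle, the distance of \<open>N\<close> equal entries from 1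
  grows like \<open>N powr (1 / p)\<close>.\<close>

lemma TH_not_locally_quasi_convex:
  assumes p: "p > 1"
  shows "\<not> locally_quasi_convex (TH p)"
proof -
  interpret flat_sequences "TH_carrier p" "TH_dist p" using p by (rule flat_sequences_TH)
  have "\<exists>N. TH_dist p (trunc N (\<lambda>k. cis \<theta>)) (\<lambda>k. 1) \<ge> 1" if \<theta>: "0 < \<theta>" "\<theta> \<le> 1" for \<theta>
  proof -
    have "cmod (cis \<theta> - 1) \<noteq> 0"
    proof
      assume "cmod (cis \<theta> - 1) = 0"
      then have "sin \<theta> = 0" by (simp add: complex_eq_iff)
      moreover have "sin \<theta> > 0" using \<theta> pi_gt3 by (intro sin_gt_zero) auto
      ultimately show False by simp
    qed
    then have e: "cmod (cis \<theta> - 1) powr p > 0" (is "?e > 0") by simp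
    obtain N where N: "1 < real N * ?e" using reals_Archimedean3[OF e] by blast
    have "TH_dist p (trunc N (\<lambda>k. cis \<theta>)) (\<lambda>k. 1) = (real N * ?e) powr (1 / p)"
      unfolding TH_dist_eq using p by (subst lp_norm_finite(2)[of p "{..<N}"]) (auto simp: trunc_def)
    also have "\<dots> \<ge> 1" using N p by (intro ge_one_powr_ge_zero) auto
    finally show ?thesis by blast
  qed
  then show ?thesis unfolding TH_seq_group by (rule not_locally_quasi_convex)
qed

section \<open>The group of null sequences\<close>

lemma TH0_dist_eq: "z \<in> TH0_carrier \<Longrightarrow> w \<in> TH0_carrier \<Longrightarrow> TH0_dist z w = (SUP n. cmod (z n - w n))"
  by (simp add: TH0_dist_def)

lemma TH0_dist_le:
  assumes "z \<in> TH0_carrier" "w \<in> TH0_carrier" "\<And>n. cmod (z n - w n) \<le> B"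
  shows "TH0_dist z w \<le> B"
  unfolding TH0_dist_eq[OF assms(1,2)] using assms(3) by (intro cSUP_least) auto

lemma TH0_dist_ge:
  assumes "z \<in> TH0_carrier" "w \<in> TH0_carrier"
  shows "cmod (z n - w n) \<le> TH0_dist z w"
  unfolding TH0_dist_eq[OF assms]
proof (rule cSUP_upper)
  have "cmod (z n - w n) \<le> 2" for n
    using assms norm_triangle_ineq4[of "z n" "w n"] by (simp add: TH0_carrier_def)
  then show "bdd_above (range (\<lambda>n. cmod (z n - w n)))" by (rule bdd_aboveI2)
qed simp

lemma circle_sequences_TH0: "circle_sequences TH0_carrier TH0_dist"
proof -
  let ?C = TH0_carrier
  have unit: "cmod (z k) = 1" if "z \<in> ?C" for z k using that by (simp add: TH0_carrier_def)
  have nonneg: "0 \<le> TH0_dist x y" for x y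
  proof (cases "x \<in> ?C \<and> y \<in> ?C")
    case True
    then show ?thesis using TH0_dist_ge[of x y 0] norm_ge_zero order_trans by blast
  next
    case False
    then show ?thesis by (auto simp: TH0_dist_def)
  qed
  have metric: "Metric_space ?C TH0_dist"
  proof
    show "0 \<le> TH0_dist x y" for x y by (rule nonneg)
    show "TH0_dist x y = TH0_dist y x" for x y by (auto simp: TH0_dist_def norm_minus_commute)
    show "TH0_dist x y = 0 \<longleftrightarrow> x = y" if xy: "x \<in> ?C" "y \<in> ?C" for x y
    proof
      assume "TH0_dist x y = 0"
      then show "x = y" using TH0_dist_ge[OF xy] by (auto simp: fun_eq_iff)
    next
      assume "x = y"
      then show "TH0_dist x y = 0" using TH0_dist_le[OF xy, of 0] nonneg[of x y] by simp
    qed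
    show "TH0_dist x z \<le> TH0_dist x y + TH0_dist y z" if "x \<in> ?C" "y \<in> ?C" "z \<in> ?C" for x y z
    proof (rule TH0_dist_le)
      fix n
      show "cmod (x n - z n) \<le> TH0_dist x y + TH0_dist y z"
        using norm_triangle_ineq[of "x n - y n" "y n - z n"] TH0_dist_ge[of x y n] TH0_dist_ge[of y z n] that by simp
    qed (use that in auto)
  qed
  have one: "(\<lambda>k. 1) \<in> ?C" by (simp add: TH0_carrier_def)
  have mult: "(\<lambda>k. z k * w k) \<in> ?C" if "z \<in> ?C" "w \<in> ?C" for z w
    using that tendsto_mult[of z 1 sequentially w 1] by (simp add: TH0_carrier_def norm_mult)
  have eventually_one: "z \<in> ?C" if "\<And>k. cmod (z k) = 1" "\<And>k. k \<ge> n \<Longrightarrow> z k = 1" for z :: "nat \<Rightarrow> complex" and n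
  proof -
    have "z \<longlonglongrightarrow> 1" by (rule tendsto_eventually) (use that(2) in \<open>auto simp: eventually_sequentially\<close>)
    then show ?thesis using that(1) by (simp add: TH0_carrier_def)
  qed
  have single: "single_seq k u \<in> ?C" if "cmod u = 1" for k u
    using that by (intro eventually_one[of _ "Suc k"]) (auto simp: single_seq_def)
  have trunc: "trunc n z \<in> ?C" if "z \<in> ?C" for n z
    using unit[OF that] by (intro eventually_one[of _ n]) (auto simp: trunc_def)
  show ?thesis
    unfolding circle_sequences_def circle_sequences_axioms_def
  proof (intro conjI allI impI metric one)
    show "cmod (z k) = 1" if "z \<in> ?C" for z k using unit that .
    show "(\<lambda>k. z k * w k) \<in> ?C" if "z \<in> ?C" "w \<in> ?C" for z w using mult that .
    show "single_seq k u \<in> ?C" if "cmod u = 1" for k u using single that .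
    show "(\<lambda>k. cnj (z k)) \<in> ?C" if "z \<in> ?C" for z
      using that tendsto_cnj[of z 1 sequentially] by (simp add: TH0_carrier_def)
    show "TH0_dist (\<lambda>k. x k * z k) (\<lambda>k. x k * w k) = TH0_dist z w" if "x \<in> ?C" "z \<in> ?C" "w \<in> ?C" for x z w
    proof -
      have "cmod (x k * z k - x k * w k) = cmod (z k - w k)" for k
        using unit[OF that(1), of k] by (metis mult_1 norm_mult right_diff_distrib)
      then show ?thesis using mult that by (simp add: TH0_dist_eq)
    qed
    show "cmod (z k - w k) \<le> TH0_dist z w" if "z \<in> ?C" "w \<in> ?C" for z w k
      using TH0_dist_ge that .
    show "TH0_dist (single_seq k u) (single_seq k v) \<le> cmod (u - v)" if "cmod u = 1" "cmod v = 1" for k u v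
      using that single by (intro TH0_dist_le) (auto simp: single_seq_def)
    show "TH0_dist (trunc n z) (trunc n w) \<le> TH0_dist z w" if "z \<in> ?C" "w \<in> ?C" for z w n
      using that trunc TH0_dist_ge nonneg by (intro TH0_dist_le) (auto simp: trunc_def)
    show "(\<lambda>n. TH0_dist (trunc n z) z) \<longlonglongrightarrow> 0" if z: "z \<in> ?C" for z
    proof (rule LIMSEQ_I)
      fix r :: real assume r: "r > 0"
      have "z \<longlonglongrightarrow> 1" using z by (simp add: TH0_carrier_def)
      then obtain N where N: "\<And>n. n \<ge> N \<Longrightarrow> cmod (z n - 1) < r / 2"
        using LIMSEQ_D[of z 1 "r/2"] r by auto
      have "TH0_dist (trunc n z) z \<le> r / 2" if "n \<ge> N" for n
        using z trunc N that r
        by (intro TH0_dist_le) (auto simp: trunc_def norm_minus_commute intro: less_imp_le)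
      then show "\<exists>N. \<forall>n\<ge>N. norm (TH0_dist (trunc n z) z - 0) < r"
        using nonneg r by (intro exI[of _ N]) fastforce
    qed
  qed
qed

text \<open>The supremum distance sees only the largest angle; summability of the angles puts the
  sequence into the carrier.\<close>

lemma flat_sequences_TH0: "flat_sequences TH0_carrier TH0_dist"
proof -
  interpret circle_sequences TH0_carrier TH0_dist by (rule circle_sequences_TH0)
  show ?thesis
  proof
    fix \<delta> :: real assume \<delta>: "\<delta> > 0"
    have "cis_seq t \<in> TH0_carrier \<and> TH0_dist (cis_seq t) (\<lambda>k. 1) < \<delta>" if t: "small_angles (\<delta> / 2) t" for t
    proof -
      have "summable (\<lambda>k. \<bar>t k\<bar>)" using t by (simp add: small_angles_def)
      then have "t \<longlonglongrightarrow> 0" using summable_LIMSEQ_zero tendsto_rabs_zero_iff by blast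
      then have "cis_seq t \<longlonglongrightarrow> cis 0" unfolding cis_seq_def by (intro tendsto_intros)
      then have C: "cis_seq t \<in> TH0_carrier" by (simp add: TH0_carrier_def cis_seq_def)
      have "TH0_dist (cis_seq t) (\<lambda>k. 1) \<le> \<delta> / 2"
      proof (rule TH0_dist_le[OF C one_mem])
        fix k
        have "\<bar>t k\<bar> \<le> \<delta> / 2" using t unfolding small_angles_def by blast
        then show "cmod (cis_seq t k - 1) \<le> \<delta> / 2"
          using norm_cis_diff_one_le[of "t k"] unfolding cis_seq_def by linarith
      qed
      with C \<delta> show ?thesis by simp
    qed
    with \<delta> show "\<exists>c>0. \<forall>t. small_angles c t \<longrightarrow>
        cis_seq t \<in> TH0_carrier \<and> TH0_dist (cis_seq t) (\<lambda>k. 1) < \<delta>"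
      by (intro exI[of _ "\<delta> / 2"]) auto
  qed
qed

section \<open>Reflexivity\<close>

lemma int_exponential_eq_powi:
  fixes f :: "int \<Rightarrow> complex"
  assumes add: "\<And>m n. f (m + n) = f m * f n" and nz: "f 0 \<noteq> 0"
  shows "f m = f 1 powi m"
proof -
  have f0: "f 0 = 1" using add[of 0 0] nz by simp
  have f1: "f 1 \<noteq> 0" using add[of 1 "-1"] f0 by auto
  show ?thesis
  proof (induction m rule: int_induct[where k=0])
    case base
    then show ?case by (simp add: f0)
  next
    case (step1 i)
    then show ?case by (simp add: add power_int_add f1)
  next
    case (step2 i)
    have "f i = f (i - 1) * f 1" using add[of "i - 1" 1] by simp
    then show ?case using step2 f1 by (simp add: power_int_diff field_simps)
  qed
qed

context circle_sequences
begin

abbreviation proj :: "nat \<Rightarrow> (nat \<Rightarrow> complex) \<Rightarrow> complex" where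
  "proj k \<equiv> fin_character G (unit_seq k)"

lemma unit_seq_Z0: "unit_seq k \<in> carrier Z0"
  by (simp add: carrier_Z0 unit_seq_def)

lemma proj_character: "proj k \<in> characters G"
  by (rule fin_character_character[OF unit_seq_Z0])

lemma proj_apply: "z \<in> C \<Longrightarrow> proj k z = z k"
  by (subst fin_character_eq[of "{k}"]) (auto simp: unit_seq_def)

lemma fin_character_add:
  assumes "a \<in> carrier Z0" "b \<in> carrier Z0"
  shows "fin_character G (\<lambda>k. a k + b k) = fin_character G a \<otimes>\<^bsub>dual G\<^esub> fin_character G b"
  using hom_mult[OF fin_character_hom, of a Z0_topology b] assms by simp

text \<open>The characters \<open>fin_character G a\<close> with \<open>a\<close> in
  \<open>Z0\<close> form the group generated by the coordinate projections, so a bidual element is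
  determined on them by its values at \<open>proj k\<close>.\<close>

lemma bidual_fin_character:
  assumes \<Phi>: "\<Phi> \<in> characters (dual G)" and F: "finite F" and a: "{k. a k \<noteq> 0} \<subseteq> F"
  shows "\<Phi> (fin_character G a) = (\<Prod>k\<in>F. \<Phi> (proj k) powi a k)"
  using F a
proof (induction F arbitrary: a rule: finite_induct)
  case empty
  then have "a = (\<lambda>k. 0)" by auto
  then have "fin_character G a = \<one>\<^bsub>dual G\<^esub>"
    by (auto simp: fin_character_def one_dual)
  then show ?case
    using character_one[OF topological_groupD(1)[OF topological_group_dual[OF topological_group_G]] \<Phi>] by simp
next
  case (insert j F)
  have Z0: "(\<lambda>k. m * unit_seq j k) \<in> carrier Z0" for m
    by (simp add: carrier_Z0 unit_seq_def)
  define b where "b = a(j := 0)"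
  have bF: "{k. b k \<noteq> 0} \<subseteq> F" using insert.prems by (auto simp: b_def)
  then have b: "b \<in> carrier Z0" using insert.hyps(1) finite_subset by (auto simp: carrier_Z0)
  define f where "f m = \<Phi> (fin_character G (\<lambda>k. m * unit_seq j k))" for m
  have mult: "\<Phi> (fin_character G (\<lambda>k. x k + y k)) = \<Phi> (fin_character G x) * \<Phi> (fin_character G y)"
    if "x \<in> carrier Z0" "y \<in> carrier Z0" for x y
    using that fin_character_character by (simp add: fin_character_add character_mult[OF \<Phi>])
  have "f (m + n) = f m * f n" for m n
    using mult[OF Z0[of m] Z0[of n]] by (simp add: f_def ring_distribs)
  moreover have "f 0 \<noteq> 0"
    using character_norm[OF \<Phi>, of "fin_character G (\<lambda>k. 0 * unit_seq j k)"] fin_character_character[OF Z0[of 0]]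
    by (auto simp: f_def)
  ultimately have f: "f m = f 1 powi m" for m by (rule int_exponential_eq_powi)
  have "a = (\<lambda>k. a j * unit_seq j k + b k)" by (auto simp: b_def unit_seq_def fun_eq_iff)
  then have "\<Phi> (fin_character G a) = f (a j) * \<Phi> (fin_character G b)"
    using mult[OF Z0[of "a j"] b] by (simp add: f_def)
  also have "\<Phi> (fin_character G b) = (\<Prod>k\<in>F. \<Phi> (proj k) powi b k)" by (rule insert.IH[OF bF])
  also have "\<dots> = (\<Prod>k\<in>F. \<Phi> (proj k) powi a k)"
    using insert.hyps(2) by (intro prod.cong) (auto simp: b_def)
  finally show ?case using insert.hyps f[of "a j"] by (simp add: f_def)
qed

lemma bidual_proj_norm: "\<Phi> \<in> characters (dual G) \<Longrightarrow> cmod (\<Phi> (proj k)) = 1"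
  using character_norm[of \<Phi> "dual G" "proj k"] proj_character by simp

text \<open>An inverse of the canonical map has to send a bidual element to its values at the
  coordinate projections. \<open>mem\<close> and \<open>eval\<close> say that this is an inverse,
  \<open>small\<close> that it is continuous: balls of \<open>G\<close> are detected by uniform
  closeness to 1 on a compact set of characters. The other direction is
  \<open>canonical_map_continuous\<close>.\<close>

lemma reflexive_criterion:
  assumes mem: "\<And>\<Phi>. \<Phi> \<in> characters (dual G) \<Longrightarrow> (\<lambda>k. \<Phi> (proj k)) \<in> C"
    and eval: "\<And>\<Phi> \<xi>. \<Phi> \<in> characters (dual G) \<Longrightarrow> \<xi> \<in> characters G \<Longrightarrow> \<Phi> \<xi> = \<xi> (\<lambda>k. \<Phi> (proj k))"
    and small: "\<And>r. r > 0 \<Longrightarrow> \<exists>Q \<epsilon>. compactin (topo (dual G)) Q \<and> \<epsilon> > 0 \<and>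
      (\<forall>z\<in>C. (\<forall>\<xi>\<in>Q. cmod (\<xi> z - 1) < \<epsilon>) \<longrightarrow> d z (\<lambda>k. 1) < r)"
  shows "reflexive G"
proof -
  note T = topological_group_G
  note D = topological_group_dual[OF T]
  note DD = topological_group_dual[OF D]
  define g where "g \<Phi> = (\<lambda>k. \<Phi> (proj k))" for \<Phi> :: "((nat \<Rightarrow> complex) \<Rightarrow> complex) \<Rightarrow> complex"
  have g_mem: "g \<Phi> \<in> C" if "\<Phi> \<in> characters (dual G)" for \<Phi> using mem[OF that] by (simp add: g_def)
  have g_hom: "g \<in> hom (dual (dual G)) G"
    using g_mem proj_character by (auto simp: hom_def g_def mult_dual)
  show ?thesis
    unfolding reflexive_def
  proof (rule topological_isoI[where g=g])
    show "canonical_map G \<in> hom G (dual (dual G))" by (rule canonical_map_hom[OF T])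
    show "continuous_map (topo G) (topo (dual (dual G))) (canonical_map G)"
      by (rule canonical_map_continuous[OF T metrizable_G])
    show "continuous_map (topo (dual (dual G))) (topo G) g"
    proof (rule hom_continuous_at_one[OF DD T g_hom])
      fix V assume "openin (topo G) V" "\<one>\<^bsub>G\<^esub> \<in> V"
      then obtain r where r: "r > 0" "mball (\<lambda>k. 1) r \<subseteq> V" by (auto simp: openin_mtopology)
      obtain Q e where Q: "compactin (topo (dual G)) Q" "e > 0"
        "\<And>z. z \<in> C \<Longrightarrow> (\<forall>\<xi>\<in>Q. cmod (\<xi> z - 1) < e) \<Longrightarrow> d z (\<lambda>k. 1) < r"
        using small[OF r(1)] by blast
      have "\<one>\<^bsub>dual (dual G)\<^esub> \<in> characters (dual G)" using dual_one_character[OF D] by (simp add: one_dual)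
      then obtain U where U: "openin (topo (dual (dual G))) U" "\<one>\<^bsub>dual (dual G)\<^esub> \<in> U"
        "U \<subseteq> char_near (dual G) Q \<one>\<^bsub>dual (dual G)\<^esub> e"
        using char_near_open[OF _ Q(1,2)] by blast
      have "g \<Phi> \<in> V" if "\<Phi> \<in> U" for \<Phi>
      proof -
        have \<Phi>: "\<Phi> \<in> characters (dual G)" "\<And>\<xi>. \<xi> \<in> Q \<Longrightarrow> cmod (\<Phi> \<xi> - \<one>\<^bsub>dual (dual G)\<^esub> \<xi>) < e"
          using U(3) that by (auto simp: char_near_def)
        have "cmod (\<xi> (g \<Phi>) - 1) < e" if \<xi>: "\<xi> \<in> Q" for \<xi>
        proof -
          have "\<xi> \<in> characters G" using compactin_subset_topspace[OF Q(1)] \<xi> by auto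
          then show ?thesis using \<Phi>(2)[OF \<xi>] eval[OF \<Phi>(1)] by (simp add: one_dual g_def)
        qed
        then have "d (g \<Phi>) (\<lambda>k. 1) < r" using Q(3) g_mem[OF \<Phi>(1)] by blast
        then show ?thesis using r(2) g_mem[OF \<Phi>(1)] one_mem by (auto simp: commute)
      qed
      with U show "\<exists>U. openin (topo (dual (dual G))) U \<and> \<one>\<^bsub>dual (dual G)\<^esub> \<in> U \<and> g ` U \<subseteq> V" by blast
    qed
    show "g (canonical_map G z) = z" if "z \<in> carrier G" for z
      using that proj_character by (auto simp: g_def canonical_map_def proj_apply)
    show "canonical_map G (g \<Phi>) = \<Phi>" if "\<Phi> \<in> carrier (dual (dual G))" for \<Phi>
    proof (rule character_eqI[of _ "dual G"])
      fix \<xi> assume "\<xi> \<in> carrier (dual G)"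
      then show "canonical_map G (g \<Phi>) \<xi> = \<Phi> \<xi>"
        using eval[of \<Phi> \<xi>] that by (simp add: canonical_map_def g_def)
    qed (use that canonical_map_character[OF T] g_mem in auto)
  qed simp_all
qed

end

lemma reflexive_TH0: "reflexive TH0"
proof -
  interpret flat_sequences TH0_carrier TH0_dist by (rule flat_sequences_TH0)
  have one: "fin_character G (\<lambda>k. 0) = \<one>\<^bsub>dual G\<^esub>"
    by (auto simp: fin_character_def one_dual)
  have "limitin Z0_topology unit_seq (\<lambda>k. 0) sequentially"
    using null_group_topology_Z0 by (simp add: null_group_topology_def)
  moreover have "continuous_map Z0_topology (topo (dual G)) (fin_character G)"
    using topological_iso_fin_character homeomorphic_imp_continuous_map by (fastforce simp: topological_iso_def)
  \<comment> \<open>Convergence of \<open>unit_seq\<close> to 0, transported to the dual, puts the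
    coordinates of a bidual element into \<open>TH0_carrier\<close>.\<close>
  ultimately have lim: "limitin (topo (dual G)) proj \<one>\<^bsub>dual G\<^esub> sequentially"
    using continuous_map_limit[of Z0_topology "topo (dual G)" "fin_character G"] by (fastforce simp: one o_def)
  have "reflexive G"
  proof (rule reflexive_criterion)
    fix \<Phi> assume \<Phi>: "\<Phi> \<in> characters (dual G)"
    have "\<Phi> \<one>\<^bsub>dual G\<^esub> = 1"
      by (rule character_one[OF topological_groupD(1)[OF topological_group_dual[OF topological_group_G]] \<Phi>])
    then have "(\<lambda>k. \<Phi> (proj k)) \<longlonglongrightarrow> 1"
      using continuous_map_limit[OF character_continuous[OF \<Phi>] lim] by (simp add: o_def)
    then show mem: "(\<lambda>k. \<Phi> (proj k)) \<in> TH0_carrier"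
      using bidual_proj_norm[OF \<Phi>] by (simp add: TH0_carrier_def)
    fix \<xi> assume "\<xi> \<in> characters G"
    then obtain a where a: "a \<in> carrier Z0" "\<xi> = fin_character G a" by (rule character_is_fin_character)
    then show "\<Phi> \<xi> = \<xi> (\<lambda>k. \<Phi> (proj k))"
      using bidual_fin_character[OF \<Phi>, of "{k. a k \<noteq> 0}" a] mem by (simp add: carrier_Z0 fin_character_def)
  next
    fix r :: real assume r: "r > 0"
    have "compactin (topo (dual G)) (insert \<one>\<^bsub>dual G\<^esub> (range proj))"
      using proj_character by (intro compactin_sequence_with_limit[OF lim]) auto
    moreover have "TH0_dist z (\<lambda>k. 1) < r"
      if z: "z \<in> TH0_carrier" "\<forall>\<xi>\<in>insert \<one>\<^bsub>dual G\<^esub> (range proj). cmod (\<xi> z - 1) < r / 2" for z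
    proof -
      have "cmod (z k - 1) \<le> r / 2" for k
        using bspec[OF z(2), of "proj k"] proj_apply[OF z(1), of k] by simp
      then have "TH0_dist z (\<lambda>k. 1) \<le> r / 2" using z(1) one_mem by (intro TH0_dist_le)
      then show ?thesis using r by simp
    qed
    ultimately show "\<exists>Q \<epsilon>. compactin (topo (dual G)) Q \<and> \<epsilon> > 0 \<and>
      (\<forall>z\<in>TH0_carrier. (\<forall>\<xi>\<in>Q. cmod (\<xi> z - 1) < \<epsilon>) \<longrightarrow> TH0_dist z (\<lambda>k. 1) < r)"
      using r by (intro exI[of _ "insert \<one>\<^bsub>dual G\<^esub> (range proj)"] exI[of _ "r/2"]) auto
  qed
  then show ?thesis by (simp add: TH0_seq_group)
qed

section \<open>The group of summable sequences\<close>

text \<open>The induction rules out winding around the circle: the earlier angles add up to at most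
  \<open>2 * \<eta> \<le> 1\<close>, so the new sum \<open>s\<close> stays below \<open>pi\<close>,
  and there closeness of \<open>cis s\<close> to 1 gives \<open>s \<le> 2 * \<eta>\<close>.\<close>

lemma cis_partial_sums_bound:
  fixes t :: "nat \<Rightarrow> real"
  assumes F: "finite F" and t: "\<And>k. k \<in> F \<Longrightarrow> 0 \<le> t k \<and> t k < pi / 2"
    and \<eta>: "\<eta> \<le> 1 / 2" and sub: "\<And>A. A \<subseteq> F \<Longrightarrow> cmod (cis (\<Sum>k\<in>A. t k) - 1) < \<eta>"
  shows "(\<Sum>k\<in>F. t k) \<le> 2 * \<eta>"
  using F t sub
proof (induction F rule: finite_induct)
  case empty
  then show ?case using empty.prems(2)[of "{}"] by simp
next
  case (insert j F)
  define s where "s = (\<Sum>k\<in>insert j F. t k)"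
  have "(\<Sum>k\<in>F. t k) \<le> 2 * \<eta>" using insert.prems by (intro insert.IH) auto
  then have "(\<Sum>k\<in>F. t k) \<le> pi / 2" using \<eta> pi_gt3 by simp
  moreover have "0 \<le> (\<Sum>k\<in>F. t k)" using insert.prems(1) by (intro sum_nonneg) auto
  moreover have "0 \<le> t j \<and> t j < pi / 2" using insert.prems(1) by blast
  moreover have "s = t j + (\<Sum>k\<in>F. t k)" using insert.hyps by (simp add: s_def)
  ultimately have s: "0 \<le> s" "s < pi" by linarith+
  have le: "cmod (cis s - 1) < \<eta>" unfolding s_def by (rule insert.prems(2)) simp
  have cos: "cos s \<ge> 1 / 2" using abs_Re_le_cmod[of "cis s - 1"] le \<eta> by simp
  have sin: "sin s < \<eta>" using abs_Im_le_cmod[of "cis s - 1"] le by simp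
  \<comment> \<open>By the mean value theorem; with \<open>cos s \<ge> 1 / 2\<close> it yields
    \<open>s \<le> 2 * sin s\<close>.\<close>
  have "s * cos s \<le> sin s"
  proof (cases "s = 0")
    case False
    then have "\<exists>x. 0 < x \<and> x < s \<and> sin s - sin 0 = (s - 0) * cos x"
      using s by (intro MVT2) auto
    then obtain x where x: "0 < x" "x < s" "sin s = s * cos x" by auto
    have "cos s \<le> cos x" using x s by (intro cos_monotone_0_pi_le) auto
    then show ?thesis using x s by (simp add: mult_left_mono)
  qed simp
  moreover have "s * (1 / 2) \<le> s * cos s" using cos s by (intro mult_left_mono) auto
  ultimately show ?case using sin by (simp add: s_def)
qed

text \<open>Splitting the indices by the sign of the argument prevents cancellation in the subproducts.\<close>

lemma unit_subproducts_bound: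
  fixes z :: "nat \<Rightarrow> complex"
  assumes F: "finite F" and z: "\<And>k. k \<in> F \<Longrightarrow> cmod (z k) = 1"
    and \<eta>: "\<eta> \<le> 1 / 2" and sub: "\<And>A. A \<subseteq> F \<Longrightarrow> cmod ((\<Prod>k\<in>A. z k) - 1) < \<eta>"
  shows "(\<Sum>k\<in>F. cmod (z k - 1)) \<le> 4 * \<eta>"
proof -
  define t where "t k = Arg (z k)" for k
  have zt: "z k = cis (t k)" if "k \<in> F" for k
  proof -
    have "z k \<noteq> 0" using z[OF that] by auto
    then show ?thesis using cis_Arg[of "z k"] z[OF that] by (simp add: t_def sgn_eq)
  qed
  \<comment> \<open>One-element subproducts already force the factors into the right
    half-plane.\<close>
  have t_lt: "\<bar>t k\<bar> < pi / 2" if k: "k \<in> F" for k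
  proof -
    have "cmod (z k - 1) < 1 / 2" using sub[of "{k}"] k \<eta> by simp
    then have "cos (t k) > 0" using abs_Re_le_cmod[of "z k - 1"] zt[OF k] by simp
    moreover have "\<bar>t k\<bar> \<le> pi" using mpi_less_Arg[of "z k"] Arg_le_pi[of "z k"] by (simp add: t_def)
    ultimately show ?thesis
      using cos_monotone_0_pi_le[of "pi / 2" "\<bar>t k\<bar>"] by (force simp: not_less[symmetric])
  qed
  have prod: "(\<Prod>k\<in>A. z k) = cis (\<Sum>k\<in>A. t k)" if "A \<subseteq> F" for A
  proof -
    have "(\<Prod>k\<in>A. z k) = (\<Prod>k\<in>A. cis (t k) powi 1)" using that zt by (intro prod.cong) auto
    also have "\<dots> = cis (\<Sum>k\<in>A. t k)" by (subst prod_cis_powi[of t "\<lambda>_. 1"]) simp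
    finally show ?thesis .
  qed
  let ?P = "{k \<in> F. t k \<ge> 0}" and ?N = "{k \<in> F. t k < 0}"
  have "(\<Sum>k\<in>?P. t k) \<le> 2 * \<eta>"
  proof (rule cis_partial_sums_bound[OF _ _ \<eta>])
    fix A assume "A \<subseteq> ?P"
    then have "A \<subseteq> F" by auto
    then show "cmod (cis (\<Sum>k\<in>A. t k) - 1) < \<eta>" using sub prod by metis
  qed (use F t_lt in force)+
  moreover have "(\<Sum>k\<in>?N. - t k) \<le> 2 * \<eta>"
  proof (rule cis_partial_sums_bound[OF _ _ \<eta>])
    fix A assume "A \<subseteq> ?N"
    then have "A \<subseteq> F" by auto
    then have "cmod (cis (\<Sum>k\<in>A. t k) - 1) < \<eta>" using sub prod by metis
    moreover have "cis (\<Sum>k\<in>A. - t k) - 1 = cnj (cis (\<Sum>k\<in>A. t k) - 1)"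
      by (simp add: sum_negf cis_cnj)
    ultimately show "cmod (cis (\<Sum>k\<in>A. - t k) - 1) < \<eta>" by (metis complex_mod_cnj)
  qed (use F t_lt in force)+
  moreover have "(\<Sum>k\<in>F. cmod (z k - 1)) \<le> (\<Sum>k\<in>F. \<bar>t k\<bar>)"
    using zt norm_cis_diff_one_le by (intro sum_mono) simp
  moreover have "(\<Sum>k\<in>F. \<bar>t k\<bar>) = (\<Sum>k\<in>?P. t k) + (\<Sum>k\<in>?N. - t k)"
  proof -
    have "F = ?P \<union> ?N" by auto
    then have "(\<Sum>k\<in>F. \<bar>t k\<bar>) = (\<Sum>k\<in>?P. \<bar>t k\<bar>) + (\<Sum>k\<in>?N. \<bar>t k\<bar>)"
      using F by (subst sum.union_disjoint[symmetric]) auto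
    moreover have "(\<Sum>k\<in>?P. \<bar>t k\<bar>) = (\<Sum>k\<in>?P. t k)" "(\<Sum>k\<in>?N. \<bar>t k\<bar>) = (\<Sum>k\<in>?N. - t k)"
      by (intro sum.cong; simp)+
    ultimately show ?thesis by (simp only:)
  qed
  ultimately show ?thesis by simp
qed

section \<open>Bounded integer sequences as characters of the group of summable sequences\<close>

lemma carrier_Zb: "a \<in> carrier Zb \<longleftrightarrow> (\<exists>B. \<forall>k. \<bar>a k\<bar> \<le> B)"
  and mult_Zb [simp]: "a \<otimes>\<^bsub>Zb\<^esub> b = (\<lambda>k. a k + b k)"
  and one_Zb [simp]: "\<one>\<^bsub>Zb\<^esub> = (\<lambda>k. 0)"
  by (simp_all add: Zb_def)

lemma Zb_closed:
  "(\<lambda>k. 0) \<in> carrier Zb"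
  "a \<in> carrier Zb \<Longrightarrow> (\<lambda>k. - a k) \<in> carrier Zb"
  "a \<in> carrier Zb \<Longrightarrow> b \<in> carrier Zb \<Longrightarrow> (\<lambda>k. a k + b k) \<in> carrier Zb"
proof -
  show "(\<lambda>k. 0) \<in> carrier Zb" "a \<in> carrier Zb \<Longrightarrow> (\<lambda>k. - a k) \<in> carrier Zb"
    by (auto simp: carrier_Zb)
  assume "a \<in> carrier Zb" "b \<in> carrier Zb"
  then obtain A B where "\<And>k. \<bar>a k\<bar> \<le> A" "\<And>k. \<bar>b k\<bar> \<le> B" by (auto simp: carrier_Zb)
  then have "\<bar>a k + b k\<bar> \<le> A + B" for k
    by (meson abs_triangle_ineq add_mono order_trans)
  then show "(\<lambda>k. a k + b k) \<in> carrier Zb" by (auto simp: carrier_Zb)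
qed

lemma group_Zb: "group Zb"
proof (rule groupI)
  fix a assume "a \<in> carrier Zb"
  then show "\<exists>b\<in>carrier Zb. b \<otimes>\<^bsub>Zb\<^esub> a = \<one>\<^bsub>Zb\<^esub>"
    using Zb_closed(2) by (intro bexI[of _ "\<lambda>k. - a k"]) auto
qed (auto simp: Zb_closed algebra_simps)

abbreviation T1 where "T1 \<equiv> TH_carrier 1"
abbreviation d1 where "d1 \<equiv> TH_dist 1"

interpretation TH1: circle_sequences T1 d1
  by (rule circle_sequences_TH) simp

text \<open>For bounded exponents the infinite product converges absolutely, since the deviations of
  \<open>z\<close> from 1 are summable.\<close>

definition bchar :: "(nat \<Rightarrow> int) \<Rightarrow> (nat \<Rightarrow> complex) \<Rightarrow> complex" where
  "bchar a = (\<lambda>z\<in>T1. \<Prod>k. z k powi a k)"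

lemma TH1_summable: "z \<in> T1 \<Longrightarrow> summable (\<lambda>k. cmod (z k - 1))"
  by (simp add: TH_carrier_def norm_minus_commute)

lemma TH1_memI: "(\<And>k. cmod (z k) = 1) \<Longrightarrow> summable (\<lambda>k. cmod (z k - 1)) \<Longrightarrow> z \<in> T1"
  by (simp add: TH_carrier_def norm_minus_commute)

lemma TH1_dist: "z \<in> T1 \<Longrightarrow> w \<in> T1 \<Longrightarrow> d1 z w = (\<Sum>k. cmod (z k - w k))"
proof -
  assume "z \<in> T1" "w \<in> T1"
  then have "summable (\<lambda>k. cmod (z k - 1) + cmod (w k - 1))" by (intro summable_add TH1_summable)
  then have "summable (\<lambda>k. cmod (z k - w k))"
  proof (rule summable_comparison_test'[where N=0])
    fix k show "norm (cmod (z k - w k)) \<le> cmod (z k - 1) + cmod (w k - 1)"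
      using norm_triangle_ineq4[of "z k - 1" "w k - 1"] by simp
  qed
  then show ?thesis by (simp add: TH_dist_def suminf_nonneg)
qed

lemma bchar_terms_summable:
  assumes a: "\<And>k. \<bar>a k\<bar> \<le> B" and z: "z \<in> T1"
  shows "summable (\<lambda>k. \<bar>of_int (a k)\<bar> * cmod (z k - 1))"
proof (rule summable_comparison_test'[where N=0])
  show "summable (\<lambda>k. of_int B * cmod (z k - 1))" using TH1_summable[OF z] by (rule summable_mult)
  fix k
  have "\<bar>of_int (a k) :: real\<bar> \<le> of_int B" using a[of k] by linarith
  then show "norm (\<bar>of_int (a k)\<bar> * cmod (z k - 1)) \<le> of_int B * cmod (z k - 1)"
    by (simp add: abs_mult mult_right_mono)
qed

lemma bchar_tendsto:
  assumes a: "a \<in> carrier Zb" and z: "z \<in> T1"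
  shows "(\<lambda>n. \<Prod>k<n. z k powi a k) \<longlonglongrightarrow> bchar a z"
proof -
  obtain B where B: "\<And>k. \<bar>a k\<bar> \<le> B" using a by (auto simp: carrier_Zb)
  have "summable (\<lambda>k. norm (z k powi a k - 1))"
    by (rule summable_comparison_test'[OF bchar_terms_summable[OF B z], of 0])
      (use norm_powi_diff_one_le TH1.unit[OF z] in auto)
  then have "convergent_prod (\<lambda>k. z k powi a k)"
    by (intro abs_convergent_prod_imp_convergent_prod) (simp add: abs_convergent_prod_conv_summable)
  then have "(\<lambda>n. \<Prod>k\<le>n. z k powi a k) \<longlonglongrightarrow> bchar a z"
    using z by (simp add: bchar_def convergent_prod_LIMSEQ)
  then show ?thesis by (simp only: LIMSEQ_lessThan_iff_atMost)
qed

lemma bchar_estimate: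
  assumes a: "a \<in> carrier Zb" and z: "z \<in> T1"
  shows "cmod (bchar a z - 1) \<le> (\<Sum>k. \<bar>of_int (a k)\<bar> * cmod (z k - 1))"
proof (rule LIMSEQ_le_const2)
  show "(\<lambda>n. cmod ((\<Prod>k<n. z k powi a k) - 1)) \<longlonglongrightarrow> cmod (bchar a z - 1)"
    by (intro tendsto_intros bchar_tendsto a z)
  obtain B where B: "\<And>k. \<bar>a k\<bar> \<le> B" using a by (auto simp: carrier_Zb)
  have "cmod ((\<Prod>k<n. z k powi a k) - 1) \<le> (\<Sum>k. \<bar>of_int (a k)\<bar> * cmod (z k - 1))" for n
  proof -
    have "cmod ((\<Prod>k<n. z k powi a k) - 1) \<le> (\<Sum>k<n. \<bar>of_int (a k)\<bar> * cmod (z k - 1))"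
      using TH1.unit[OF z] by (intro norm_prod_powi_diff_one_le)
    also have "\<dots> \<le> (\<Sum>k. \<bar>of_int (a k)\<bar> * cmod (z k - 1))"
      using bchar_terms_summable[OF B z] by (intro sum_le_suminf) auto
    finally show ?thesis .
  qed
  then show "\<exists>N. \<forall>n\<ge>N. cmod ((\<Prod>k<n. z k powi a k) - 1) \<le> (\<Sum>k. \<bar>of_int (a k)\<bar> * cmod (z k - 1))"
    by blast
qed

text \<open>The distance to the truncation is uniformly small on compact sets by
  \<open>compact_tail\<close>. Applied to differences, this shows that uniformly bounded exponent
  sequences with a long common initial segment give characters that are close in the compact-open
  topology.\<close>

lemma bchar_tail_estimate:
  assumes a: "\<And>k. \<bar>a k\<bar> \<le> B" "\<And>k. k < n \<Longrightarrow> a k = 0" and z: "z \<in> T1"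
  shows "cmod (bchar a z - 1) \<le> of_int B * d1 (trunc n z) z"
proof -
  have aZ: "a \<in> carrier Zb" using a by (auto simp: carrier_Zb)
  have tz: "trunc n z \<in> T1" using TH1.trunc_mem[OF z] .
  have s: "summable (\<lambda>k. cmod (trunc n z k - z k))"
    by (rule summable_comparison_test'[OF TH1_summable[OF z], of 0]) (auto simp: trunc_def norm_minus_commute)
  have le: "\<bar>of_int (a k)\<bar> * cmod (z k - 1) \<le> of_int B * cmod (trunc n z k - z k)" for k
  proof (cases "k < n")
    case False
    have "\<bar>of_int (a k) :: real\<bar> \<le> of_int B" using a(1)[of k] by linarith
    then show ?thesis using False by (simp add: trunc_def norm_minus_commute mult_right_mono)
  qed (simp add: a trunc_def)
  have "cmod (bchar a z - 1) \<le> (\<Sum>k. \<bar>of_int (a k)\<bar> * cmod (z k - 1))" by (rule bchar_estimate[OF aZ z])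
  also have "\<dots> \<le> (\<Sum>k. of_int B * cmod (trunc n z k - z k))"
    using le s by (intro suminf_le bchar_terms_summable[OF a(1) z] summable_mult)
  also have "\<dots> = of_int B * d1 (trunc n z) z" using s by (simp add: suminf_mult TH1_dist[OF tz z])
  finally show ?thesis .
qed

lemma bchar_norm: assumes "a \<in> carrier Zb" "z \<in> T1" shows "cmod (bchar a z) = 1"
proof (rule LIMSEQ_unique)
  show "(\<lambda>n. cmod (\<Prod>k<n. z k powi a k)) \<longlonglongrightarrow> cmod (bchar a z)"
    by (intro tendsto_norm bchar_tendsto assms)
  show "(\<lambda>n. cmod (\<Prod>k<n. z k powi a k)) \<longlonglongrightarrow> 1"
    using TH1.unit[OF assms(2)] by (simp add: norm_powi_unit flip: prod_norm)
qed

lemma bchar_add: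
  assumes a: "a \<in> carrier Zb" and b: "b \<in> carrier Zb" and z: "z \<in> T1"
  shows "bchar (\<lambda>k. a k + b k) z = bchar a z * bchar b z"
proof (rule LIMSEQ_unique)
  have nz: "z k \<noteq> 0" for k using TH1.unit[OF z, of k] by auto
  show "(\<lambda>n. \<Prod>k<n. z k powi (a k + b k)) \<longlonglongrightarrow> bchar (\<lambda>k. a k + b k) z"
    by (intro bchar_tendsto Zb_closed a b z)
  show "(\<lambda>n. \<Prod>k<n. z k powi (a k + b k)) \<longlonglongrightarrow> bchar a z * bchar b z"
    using tendsto_mult[OF bchar_tendsto[OF a z] bchar_tendsto[OF b z]]
    by (simp add: power_int_add nz prod.distrib)
qed

lemma bchar_character: assumes a: "a \<in> carrier Zb" shows "bchar a \<in> characters TH1.G"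
proof -
  obtain B where B: "\<And>k. \<bar>a k\<bar> \<le> B" using a by (auto simp: carrier_Zb)
  show ?thesis
  proof (rule TH1.characterI[where M="of_int B"])
    show "bchar a \<in> extensional T1" by (simp add: bchar_def)
    show "cmod (bchar a z) = 1" if "z \<in> T1" for z by (rule bchar_norm[OF a that])
    show "bchar a (\<lambda>k. z k * w k) = bchar a z * bchar a w" if zw: "z \<in> T1" "w \<in> T1" for z w
    proof (rule LIMSEQ_unique)
      show "(\<lambda>n. \<Prod>k<n. (z k * w k) powi a k) \<longlonglongrightarrow> bchar a (\<lambda>k. z k * w k)"
        by (intro bchar_tendsto a TH1.mult_mem zw)
      show "(\<lambda>n. \<Prod>k<n. (z k * w k) powi a k) \<longlonglongrightarrow> bchar a z * bchar a w"
        using tendsto_mult[OF bchar_tendsto[OF a zw(1)] bchar_tendsto[OF a zw(2)]]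
        by (simp add: power_int_mult_distrib prod.distrib)
    qed
    show "cmod (bchar a z - 1) \<le> of_int B * d1 z (\<lambda>k. 1)" if z: "z \<in> T1" for z
    proof -
      have "trunc 0 z = (\<lambda>k. 1)" by (simp add: trunc_def)
      then show ?thesis using bchar_tail_estimate[where a=a and B=B and n=0 and z=z] B z TH1.commute[of z "\<lambda>k. 1"] by simp
    qed
  qed
qed

lemma bchar_single:
  assumes a: "a \<in> carrier Zb" and u: "cmod u = 1"
  shows "bchar a (single_seq k u) = u powi a k"
proof (rule LIMSEQ_unique[OF bchar_tendsto[OF a TH1.single_mem[OF u]]])
  have "(\<Prod>j<n. single_seq k u j powi a j) = u powi a k" if "n \<ge> Suc k" for n
  proof -
    have "(\<Prod>j<n. single_seq k u j powi a j) = (\<Prod>j\<in>{k}. single_seq k u j powi a j)"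
      using that by (intro prod.mono_neutral_right) (auto simp: single_seq_def)
    then show ?thesis by (simp add: single_seq_def)
  qed
  then show "(\<lambda>n. \<Prod>j<n. single_seq k u j powi a j) \<longlonglongrightarrow> u powi a k"
    by (intro tendsto_eventually) (auto simp: eventually_sequentially intro!: exI[of _ "Suc k"])
qed

text \<open>One coordinate is tested at a time: all angles up to \<open>r / 2\<close> in it keep the
  point in the ball, which bounds each exponent by \<open>pi / r\<close>.\<close>

lemma TH1_character_is_bchar:
  assumes \<xi>: "\<xi> \<in> characters TH1.G"
  obtains a where "a \<in> carrier Zb" "\<xi> = bchar a"
proof -
  obtain a where a: "\<And>k u. cmod u = 1 \<Longrightarrow> \<xi> (single_seq k u) = u powi a k"
    "\<And>z. z \<in> T1 \<Longrightarrow> (\<lambda>n. \<Prod>k<n. z k powi a k) \<longlonglongrightarrow> \<xi> z"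
    using TH1.character_exponents[OF \<xi>] by metis
  have "\<exists>r>0. \<forall>z. z \<in> T1 \<and> d1 (\<lambda>k. 1) z < r \<longrightarrow> \<xi> z \<in> ball 1 1"
    using character_continuous[OF \<xi>] character_one[OF TH1.group_G \<xi>] TH1.one_mem
    unfolding seq_group_simps TH1.continuous_map_from_metric by (metis centre_in_ball open_ball open_openin zero_less_one)
  then obtain r where r: "r > 0" "\<And>z. z \<in> T1 \<Longrightarrow> d1 (\<lambda>k. 1) z < r \<Longrightarrow> cmod (\<xi> z - 1) < 1"
    by (auto simp: dist_norm norm_minus_commute)
  have "\<bar>of_int (a k)\<bar> * (r / 2) \<le> pi / 2" for k
  proof -
    have "\<bar>of_int (a k) * (r / 2)\<bar> \<le> pi / 2"
    proof (rule cos_scaled_nonneg_imp_le)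
      fix s :: real assume s: "s \<in> {0..1}"
      define u where "u = cis (s * (r / 2))"
      have "single_seq k (1::complex) = (\<lambda>k. 1)" by (auto simp: single_seq_def)
      then have "d1 (\<lambda>k. 1) (single_seq k u) \<le> cmod (1 - u)"
        using TH1.single_le[of 1 u k] by (simp add: u_def)
      also have "\<dots> \<le> \<bar>s * (r / 2)\<bar>"
        using norm_cis_diff_one_le[of "s * (r / 2)"] by (simp add: u_def norm_minus_commute)
      also have "\<dots> < r" using s r(1) mult_left_le_one_le[of "r / 2" s] by (simp add: abs_mult)
      finally have "cmod (\<xi> (single_seq k u) - 1) < 1" by (intro r(2) TH1.single_mem) (simp_all add: u_def)
      then have "Re (\<xi> (single_seq k u)) \<ge> 0"
        using abs_Re_le_cmod[of "\<xi> (single_seq k u) - 1"] by simp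
      moreover have "\<xi> (single_seq k u) = cis (of_int (a k) * (s * (r / 2)))"
        using a(1)[of u k] by (simp add: u_def cis_power_int)
      ultimately show "0 \<le> cos (s * (of_int (a k) * (r / 2)))" by (simp add: algebra_simps)
    qed
    then show ?thesis using r(1) by (simp add: abs_mult)
  qed
  then have "\<bar>of_int (a k)\<bar> \<le> pi / r" for k using r(1) by (simp add: field_simps)
  then have "\<bar>a k\<bar> \<le> \<lfloor>pi / r\<rfloor>" for k by (simp add: le_floor_iff)
  then have aZ: "a \<in> carrier Zb" by (auto simp: carrier_Zb)
  moreover have "\<xi> = bchar a"
    using LIMSEQ_unique[OF a(2) bchar_tendsto[OF aZ]]
    by (intro character_eqI[OF \<xi> bchar_character[OF aZ]]) auto
  ultimately show thesis using that by blast
qed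

lemma dual_TH1_iso_Zb: "dual (TH 1) \<cong> Zb"
proof -
  have "bchar \<in> hom Zb (dual TH1.G)"
  proof (rule homI)
    fix a b assume ab: "a \<in> carrier Zb" "b \<in> carrier Zb"
    show "bchar (a \<otimes>\<^bsub>Zb\<^esub> b) = bchar a \<otimes>\<^bsub>dual TH1.G\<^esub> bchar b"
    proof
      fix z show "bchar (a \<otimes>\<^bsub>Zb\<^esub> b) z = (bchar a \<otimes>\<^bsub>dual TH1.G\<^esub> bchar b) z"
        using bchar_add[OF ab, of z] by (cases "z \<in> T1") (auto simp: mult_dual bchar_def)
    qed
  qed (use bchar_character in auto)
  moreover have "inj_on bchar (carrier Zb)"
  proof (rule inj_onI)
    fix a b assume ab: "a \<in> carrier Zb" "b \<in> carrier Zb" "bchar a = bchar b"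
    show "a = b"
    proof
      fix k
      show "a k = b k"
        by (rule power_int_unit_eq_imp_eq) (metis ab bchar_single)
    qed
  qed
  moreover have "bchar ` carrier Zb = characters TH1.G"
    using bchar_character TH1_character_is_bchar by (auto simp: image_iff) metis
  ultimately have "Zb \<cong> dual TH1.G"
    by (auto simp: is_iso_def iso_def bij_betw_def)
  then show ?thesis
    using group.iso_sym[OF group_Zb] by (simp add: TH_seq_group)
qed

lemma bchar_fin_character:
  assumes "finite {k. a k \<noteq> 0}"
  shows "a \<in> carrier Zb" "bchar a = fin_character TH1.G a"
proof -
  let ?F = "{k. a k \<noteq> 0}"
  have "\<bar>a k\<bar> \<le> (\<Sum>j\<in>?F. \<bar>a j\<bar>)" for k
    using member_le_sum[of k ?F "\<lambda>j. \<bar>a j\<bar>"] assms by (cases "a k = 0") (auto intro: sum_nonneg)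
  then show aZ: "a \<in> carrier Zb" by (auto simp: carrier_Zb)
  show "bchar a = fin_character TH1.G a"
  proof (rule character_eqI[of _ TH1.G])
    fix z assume z: "z \<in> carrier TH1.G"
    obtain n where n: "?F \<subseteq> {..<n}" using assms finite_nat_bounded by blast
    have "(\<Prod>k<m. z k powi a k) = fin_character TH1.G a z" if "m \<ge> n" for m
      using n that z by (subst TH1.fin_character_eq[of "{..<m}"]) auto
    then have "(\<lambda>m. \<Prod>k<m. z k powi a k) \<longlonglongrightarrow> fin_character TH1.G a z"
      by (intro tendsto_eventually) (auto simp: eventually_sequentially)
    then show "bchar a z = fin_character TH1.G a z"
      using LIMSEQ_unique bchar_tendsto[OF aZ] z by auto
  qed (use aZ bchar_character TH1.fin_character_character assms in \<open>auto simp: carrier_Z0\<close>)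
qed

lemma bchar_diff:
  assumes "a \<in> carrier Zb" "b \<in> carrier Zb" "z \<in> T1"
  shows "cmod (bchar b z - bchar a z) = cmod (bchar (\<lambda>k. b k - a k) z - 1)"
proof -
  have "(\<lambda>k. b k - a k) \<in> carrier Zb" using Zb_closed(3)[OF assms(2) Zb_closed(2)[OF assms(1)]] by simp
  from bchar_add[OF assms(1) this assms(3)] have "bchar b z - bchar a z = bchar a z * (bchar (\<lambda>k. b k - a k) z - 1)"
    by (simp add: algebra_simps)
  then show ?thesis using bchar_norm[OF assms(1,3)] by (simp add: norm_mult)
qed

text \<open>The index set is compact by Tychonoff's theorem, and \<open>bchar\<close> is continuous
  on it for the product topology: two such sequences that agree below \<open>N\<close> have a
  difference with entries of modulus at most 1 and zero below \<open>N\<close>, so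
  \<open>bchar_tail_estimate\<close> applies.\<close>

lemma compactin_zero_one_characters:
  "compactin (topo (dual TH1.G)) (bchar ` {a. \<forall>k. a k \<in> {0, 1}})"
proof -
  let ?E = "{a::nat \<Rightarrow> int. \<forall>k. a k \<in> {0, 1}}"
  have E: "a \<in> carrier Zb" if "a \<in> ?E" for a
  proof -
    have "\<bar>a k\<bar> \<le> 1" for k using that by (cases "a k = 0") auto
    then show ?thesis by (auto simp: carrier_Zb)
  qed
  have "?E = PiE UNIV (\<lambda>k. {0, 1})" by (auto simp: PiE_iff)
  then have "compact ?E"
    using compactin_PiE[of "\<lambda>_. euclidean" UNIV "\<lambda>k. {0, 1::int}"] by (simp add: euclidean_product_topology)
  moreover have "continuous_map (top_of_set ?E) (topo (dual TH1.G)) bchar"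
    unfolding continuous_map_eq_topcontinuous_at topcontinuous_at_def
  proof (intro ballI conjI allI impI)
    fix a V assume "a \<in> topspace (top_of_set ?E)" and V: "openin (topo (dual TH1.G)) V \<and> bchar a \<in> V"
    then have a: "a \<in> ?E" by simp
    obtain K e where K: "compactin TH1.mtopology K" "e > 0" "char_near TH1.G K (bchar a) e \<subseteq> V"
      using V by (auto simp: openin_dual)
    have K_sub: "K \<subseteq> T1" using compactin_subset_topspace[OF K(1)] by simp
    obtain N where N: "\<And>z. z \<in> K \<Longrightarrow> d1 (trunc N z) z < e" using TH1.compact_tail[OF K(1,2)] by blast
    define U where "U = (\<Inter>k\<in>{..<N}. {b::nat \<Rightarrow> int. b k = a k})"
    have "open {b::nat \<Rightarrow> int. b k = a k}" for k
    proof -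
      have "open ((\<lambda>b::nat \<Rightarrow> int. b k) -` {a k})"
        by (intro open_vimage continuous_on_product_coordinates discrete_topology_class.open_discrete)
      then show ?thesis by (simp add: vimage_def)
    qed
    then have "open U" unfolding U_def by (intro open_INT) auto
    moreover have "bchar b \<in> V" if b: "b \<in> ?E" "b \<in> U" for b
    proof -
      have "cmod (bchar b z - bchar a z) < e" if z: "z \<in> K" for z
      proof -
        have zT: "z \<in> T1" using z K_sub by auto
        have "cmod (bchar (\<lambda>k. b k - a k) z - 1) \<le> of_int 1 * d1 (trunc N z) z"
        proof (rule bchar_tail_estimate[OF _ _ zT])
          fix k
          have "a k \<in> {0, 1}" "b k \<in> {0, 1}" using a b(1) by auto
          then show "\<bar>b k - a k\<bar> \<le> 1" by auto
        qed (use b in \<open>auto simp: U_def\<close>)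
        then show ?thesis using N[OF z] bchar_diff[OF E[OF a] E[OF b(1)] zT] by simp
      qed
      then have "bchar b \<in> char_near TH1.G K (bchar a) e"
        using bchar_character[OF E[OF b(1)]] by (simp add: char_near_def)
      with K(3) show ?thesis by blast
    qed
    ultimately show "\<exists>U. openin (top_of_set ?E) U \<and> a \<in> U \<and> (\<forall>b\<in>U. bchar b \<in> V)"
      using a by (intro exI[of _ "?E \<inter> U"]) (auto simp: openin_open_Int U_def)
  qed (use bchar_character E in auto)
  ultimately show ?thesis
    using image_compactin[of "top_of_set ?E" ?E] by (simp add: compactin_subtopology)
qed

text \<open>Continuity of a bidual element controls the products of its coordinates over all finite
  sets far out, because the corresponding 0-1 characters are uniformly close to 1 on a given compact
  set; \<open>unit_subproducts_bound\<close> converts this into summability.\<close>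

lemma reflexive_TH1: "reflexive (TH 1)"
proof -
  note D = topological_group_dual[OF TH1.topological_group_G]
  have "reflexive TH1.G"
  proof (rule TH1.reflexive_criterion)
    fix \<Phi> assume \<Phi>: "\<Phi> \<in> characters (dual TH1.G)"
    define z where "z k = \<Phi> (TH1.proj k)" for k
    have zn: "cmod (z k) = 1" for k unfolding z_def by (rule TH1.bidual_proj_norm[OF \<Phi>])
    have fin: "\<Phi> (bchar a) = (\<Prod>k\<in>F. z k powi a k)" if "finite F" "{k. a k \<noteq> 0} \<subseteq> F" for a F
    proof -
      have "finite {k. a k \<noteq> 0}" using that finite_subset by blast
      then show ?thesis
        unfolding z_def using TH1.bidual_fin_character[OF \<Phi> that] bchar_fin_character(2) by simp
    qed
    have "z \<in> T1"
    proof (rule TH1_memI[OF zn])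
      define W where "W = {\<xi> \<in> topspace (topo (dual TH1.G)). \<Phi> \<xi> \<in> ball 1 (1/2)}"
      have "openin (topo (dual TH1.G)) W"
        unfolding W_def by (rule openin_continuous_map_preimage[OF character_continuous[OF \<Phi>]]) simp
      moreover have "\<one>\<^bsub>dual TH1.G\<^esub> \<in> W"
        using character_one[OF topological_groupD(1)[OF D] \<Phi>] dual_one_character[OF TH1.topological_group_G]
        by (simp add: W_def one_dual)
      ultimately obtain K e where K: "compactin TH1.mtopology K" "e > 0" "char_near TH1.G K \<one>\<^bsub>dual TH1.G\<^esub> e \<subseteq> W"
        by (auto simp: openin_dual)
      have K_sub: "K \<subseteq> T1" using compactin_subset_topspace[OF K(1)] by simp
      obtain N where N: "\<And>x. x \<in> K \<Longrightarrow> d1 (trunc N x) x < e" using TH1.compact_tail[OF K(1,2)] by blast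
      have small: "cmod ((\<Prod>k\<in>A. z k) - 1) < 1 / 2" if A: "finite A" "A \<subseteq> {N..}" for A
      proof -
        define a :: "nat \<Rightarrow> int" where "a k = (if k \<in> A then 1 else 0)" for k
        have aZ: "a \<in> carrier Zb" using A(1) by (intro bchar_fin_character(1)) (simp add: a_def)
        have "cmod (bchar a x - 1) < e" if x: "x \<in> K" for x
        proof -
          have "cmod (bchar a x - 1) \<le> of_int 1 * d1 (trunc N x) x"
            by (rule bchar_tail_estimate) (use A(2) x K_sub in \<open>auto simp: a_def\<close>)
          with N[OF x] show ?thesis by simp
        qed
        then have "bchar a \<in> char_near TH1.G K \<one>\<^bsub>dual TH1.G\<^esub> e"
          using bchar_character[OF aZ] K_sub by (auto simp: char_near_def one_dual subset_iff)
        then have "\<Phi> (bchar a) \<in> ball 1 (1/2)" using K(3) by (auto simp: W_def)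
        moreover have "\<Phi> (bchar a) = (\<Prod>k\<in>A. z k)"
          by (subst fin[OF A(1)]) (auto simp: a_def)
        ultimately show ?thesis by (simp add: dist_norm norm_minus_commute)
      qed
      have "(\<Sum>k<n. cmod (z (k + N) - 1)) \<le> 2" for n
      proof -
        have "(\<Sum>k<n. cmod (z (k + N) - 1)) = (\<Sum>k\<in>(\<lambda>k. k + N) ` {..<n}. cmod (z k - 1))"
          by (subst sum.reindex) auto
        also have "\<dots> \<le> 4 * (1 / 2)"
        proof (rule unit_subproducts_bound)
          fix A assume A: "A \<subseteq> (\<lambda>k. k + N) ` {..<n}"
          then show "cmod ((\<Prod>k\<in>A. z k) - 1) < 1 / 2"
            by (intro small) (auto intro: finite_subset)
        qed (use zn in auto)
        finally show ?thesis by simp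
      qed
      note le = this
      have "(\<Sum>k\<le>n. cmod (z (k + N) - 1)) \<le> 2" for n
        using le[of "Suc n"] by (simp only: lessThan_Suc_atMost)
      then have "summable (\<lambda>k. cmod (z (k + N) - 1))"
        by (intro bounded_imp_summable[where B=2]) auto
      then show "summable (\<lambda>k. cmod (z k - 1))"
        using summable_iff_shift[of "\<lambda>k. cmod (z k - 1)" N] by simp
    qed
    then show mem: "(\<lambda>k. \<Phi> (TH1.proj k)) \<in> T1" by (simp add: z_def[abs_def])
    fix \<xi> assume "\<xi> \<in> characters TH1.G"
    then obtain a where a: "a \<in> carrier Zb" "\<xi> = bchar a" by (rule TH1_character_is_bchar)
    obtain B where B: "\<And>k. \<bar>a k\<bar> \<le> B" using a(1) by (auto simp: carrier_Zb)
    have B0: "B \<ge> 0" using B[of 0] by simp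
    define an where "an n k = (if k < n then a k else 0)" for n k
    have anF: "{k. an n k \<noteq> 0} \<subseteq> {..<n}" for n by (auto simp: an_def)
    have anZ: "an n \<in> carrier Zb" for n
      using finite_subset[OF anF] by (intro bchar_fin_character(1)) simp
    \<comment> \<open>Truncated exponent sequences converge in the compact-open topology, so a
      bidual element is determined by its values at finitely supported exponents.\<close>
    have "limitin (topo (dual TH1.G)) (\<lambda>n. bchar (an n)) (bchar a) sequentially"
      unfolding limitin_def
    proof (intro conjI allI impI)
      fix V assume "openin (topo (dual TH1.G)) V \<and> bchar a \<in> V"
      then obtain K e where K: "compactin TH1.mtopology K" "e > 0" "char_near TH1.G K (bchar a) e \<subseteq> V"
        by (auto simp: openin_dual)
      have K_sub: "K \<subseteq> T1" using compactin_subset_topspace[OF K(1)] by simp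
      \<comment> \<open>The added 1 keeps the denominator positive when
        \<open>B = 0\<close>.\<close>
      have e': "e / (of_int B + 1) > 0" using K(2) B0 by simp
      obtain N where N: "\<And>n x. n \<ge> N \<Longrightarrow> x \<in> K \<Longrightarrow> d1 (trunc n x) x < e / (of_int B + 1)"
        using TH1.compact_tail[OF K(1) e'] by blast
      have "bchar (an n) \<in> V" if n: "n \<ge> N" for n
      proof -
        have "cmod (bchar (an n) x - bchar a x) < e" if x: "x \<in> K" for x
        proof -
          have xT: "x \<in> T1" using x K_sub by auto
          have "cmod (bchar (\<lambda>k. an n k - a k) x - 1) \<le> of_int B * d1 (trunc n x) x"
            using B B0 by (intro bchar_tail_estimate xT) (auto simp: an_def)
          also have "\<dots> \<le> (of_int B + 1) * d1 (trunc n x) x"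
            by (intro mult_right_mono TH1.nonneg) simp
          also have "\<dots> < e" using N[OF n x] B0 by (simp add: field_simps)
          finally show ?thesis using bchar_diff[OF a(1) anZ xT] by simp
        qed
        then have "bchar (an n) \<in> char_near TH1.G K (bchar a) e"
          using bchar_character[OF anZ] by (simp add: char_near_def)
        with K(3) show ?thesis by blast
      qed
      then show "\<forall>\<^sub>F n in sequentially. bchar (an n) \<in> V" by (auto simp: eventually_sequentially)
    qed (use bchar_character a(1) in simp)
    then have "(\<lambda>n. \<Phi> (bchar (an n))) \<longlonglongrightarrow> \<Phi> (bchar a)"
      using continuous_map_limit[OF character_continuous[OF \<Phi>]] by (fastforce simp: o_def)
    moreover have "\<Phi> (bchar (an n)) = (\<Prod>k<n. z k powi a k)" for n
      by (subst fin[OF _ anF]) (auto simp: an_def)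
    ultimately have "(\<lambda>n. \<Prod>k<n. z k powi a k) \<longlonglongrightarrow> \<Phi> (bchar a)" by simp
    moreover have "(\<lambda>n. \<Prod>k<n. z k powi a k) \<longlonglongrightarrow> bchar a z"
      by (rule bchar_tendsto[OF a(1)]) (use mem in \<open>simp add: z_def[abs_def]\<close>)
    ultimately show "\<Phi> \<xi> = \<xi> (\<lambda>k. \<Phi> (TH1.proj k))"
      using LIMSEQ_unique a(2) by (simp add: z_def[abs_def])
  next
    fix r :: real assume r: "r > 0"
    \<comment> \<open>\<open>unit_subproducts_bound\<close> asks for at most \<open>1 / 2\<close>,
      and \<open>4 * \<eta>\<close> must stay below \<open>r\<close>.\<close>
    define \<eta> where "\<eta> = min (1 / 2) (r / 8)"
    have \<eta>: "\<eta> > 0" "\<eta> \<le> 1 / 2" "4 * \<eta> < r" using r by (auto simp: \<eta>_def)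
    let ?Q = "bchar ` {a. \<forall>k. a k \<in> {0, 1}}"
    have "d1 z (\<lambda>k. 1) < r" if z: "z \<in> T1" "\<forall>\<xi>\<in>?Q. cmod (\<xi> z - 1) < \<eta>" for z
    proof -
      have "(\<Sum>k<n. cmod (z k - 1)) \<le> 4 * \<eta>" for n
      proof (rule unit_subproducts_bound[OF _ _ \<eta>(2)])
        fix A assume A: "A \<subseteq> {..<n}"
        then have finA: "finite A" using finite_subset by blast
        define a :: "nat \<Rightarrow> int" where "a k = (if k \<in> A then 1 else 0)" for k
        have "{k. a k \<noteq> 0} = A" by (auto simp: a_def)
        then have "bchar a z = (\<Prod>k\<in>A. z k powi a k)"
          using bchar_fin_character(2)[of a] finA z(1) by (simp add: fin_character_def)
        then have "bchar a z = (\<Prod>k\<in>A. z k)" by (simp add: a_def)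
        moreover have "bchar a \<in> ?Q" by (auto simp: a_def)
        ultimately show "cmod ((\<Prod>k\<in>A. z k) - 1) < \<eta>" using z(2) by metis
      qed (use TH1.unit[OF z(1)] in auto)
      then have "(\<Sum>k. cmod (z k - 1)) \<le> 4 * \<eta>" by (intro suminf_le_const TH1_summable[OF z(1)])
      then show ?thesis using \<eta>(3) z(1) TH1.one_mem by (simp add: TH1_dist)
    qed
    then show "\<exists>Q \<epsilon>. compactin (topo (dual TH1.G)) Q \<and> \<epsilon> > 0 \<and>
      (\<forall>z\<in>T1. (\<forall>\<xi>\<in>Q. cmod (\<xi> z - 1) < \<epsilon>) \<longrightarrow> d1 z (\<lambda>k. 1) < r)"
      using compactin_zero_one_characters \<eta>(1) by (intro exI[of _ ?Q] exI[of _ \<eta>]) blast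
  qed
  then show ?thesis by (simp add: TH_seq_group)
qed

section \<open>Quasi-invariant measures\<close>

lemma limitin_group_mult:
  assumes G: "topological_group G" and f: "limitin (topo G) f a F" and g: "limitin (topo G) g b F"
  shows "limitin (topo G) (\<lambda>x. f x \<otimes>\<^bsub>G\<^esub> g x) (a \<otimes>\<^bsub>G\<^esub> b) F"
proof -
  have "limitin (prod_topology (topo G) (topo G)) (\<lambda>x. (f x, g x)) (a, b) F"
    using f g by (simp add: limitin_pairwise o_def)
  from continuous_map_limit[OF topological_groupD(3)[OF G] this] show ?thesis by (simp add: o_def)
qed

lemma limitin_nat_pow:
  assumes "topological_group G" "limitin (topo G) f a F"
  shows "limitin (topo G) (\<lambda>x. f x [^]\<^bsub>G\<^esub> (n::nat)) (a [^]\<^bsub>G\<^esub> n) F"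
  using continuous_map_limit[OF continuous_map_nat_pow[OF assms(1)] assms(2)] by (simp add: o_def)

section \<open>Borel sets and regularity\<close>

lemma space_borel_of: "sets \<mu> = sets (borel_of T) \<Longrightarrow> space \<mu> = topspace T"
  using sets_eq_imp_space_eq[of \<mu> "borel_of T"] by (simp add: borel_of_def space_measure_of_conv)

lemma sets_borel_of: "sets (borel_of T) = sigma_sets (topspace T) {U. openin T U}"
  unfolding borel_of_def by (rule sets_measure_of) (auto dest: openin_subset)

lemma openin_sets_borel_of: "openin T U \<Longrightarrow> U \<in> sets (borel_of T)"
  by (auto simp: sets_borel_of)

lemma closedin_sets_borel_of: "closedin T S \<Longrightarrow> S \<in> sets (borel_of T)"
  using openin_sets_borel_of[of T "topspace T - S"] sets.compl_sets[of "topspace T - S" "borel_of T"]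
    closedin_subset[of T S]
  by (simp add: space_borel_of[OF refl] openin_diff double_diff)

text \<open>Approximating from both sides at once lets the induction over the generated
  sigma-algebra go through: complementation exchanges the roles of closed and open sets.\<close>

lemma borel_regular:
  assumes \<mu>: "finite_measure \<mu>" "sets \<mu> = sets (borel_of T)" and met: "metrizable_space T"
    and E: "E \<in> sets \<mu>" and e: "\<epsilon> > 0"
  shows "\<exists>F U. closedin T F \<and> openin T U \<and> F \<subseteq> E \<and> E \<subseteq> U \<and> measure \<mu> (U - F) < \<epsilon>"
proof -
  interpret finite_measure \<mu> by (rule \<mu>(1))
  have op: "U \<in> sets \<mu>" if "openin T U" for U using that openin_sets_borel_of \<mu>(2) by blast
  have cl: "S \<in> sets \<mu>" if "closedin T S" for S using that closedin_sets_borel_of \<mu>(2) by blast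
  have "E \<in> sigma_sets (topspace T) {U. openin T U}" using E \<mu>(2) by (simp add: sets_borel_of)
  then show ?thesis using e
  proof (induction arbitrary: \<epsilon> rule: sigma_sets.induct)
    case (Basic U)
    then have U: "openin T U" by simp
    \<comment> \<open>In a metrizable space an open set is an increasing union of closed
      sets.\<close>
    obtain C where C: "\<And>n. closedin T (C n)" "\<And>n::nat. C n \<subseteq> C (Suc n)" "\<Union>(range C) = U"
      using open_imp_fsigma_in[OF met U] unfolding fsigma_in_ascending by blast
    have "(\<lambda>n. measure \<mu> (C n)) \<longlonglongrightarrow> measure \<mu> (\<Union>n. C n)"
      using C cl by (intro finite_Lim_measure_incseq) (auto intro: incseq_SucI)
    then obtain n where n: "measure \<mu> U - measure \<mu> (C n) < \<epsilon>"
      using LIMSEQ_D[of "\<lambda>n. measure \<mu> (C n)" "measure \<mu> U" \<epsilon>] Basic.prems C(3) by (fastforce simp: abs_less_iff)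
    have "C n \<subseteq> U" using C(3) by blast
    then have "measure \<mu> (U - C n) < \<epsilon>" using n op[OF U] cl[OF C(1)] by (simp add: finite_measure_Diff)
    with \<open>C n \<subseteq> U\<close> U C(1) show ?case by blast
  next
    case Empty
    then show ?case by (intro exI[of _ "{}"]) auto
  next
    case (Compl A)
    obtain F U where FU: "closedin T F" "openin T U" "F \<subseteq> A" "A \<subseteq> U" "measure \<mu> (U - F) < \<epsilon>"
      using Compl.IH[OF Compl.prems] by blast
    have "(topspace T - F) - (topspace T - U) = U - F" using openin_subset[OF FU(2)] by auto
    then show ?case
      using FU by (intro exI[of _ "topspace T - U"] exI[of _ "topspace T - F"]) auto
  next
    case (Union A)
    define \<delta> where "\<delta> n = \<epsilon> / 2 * (1/2) ^ Suc n" for n :: nat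
    have "\<delta> n > 0" for n using Union.prems by (simp add: \<delta>_def)
    then have "\<exists>F U. closedin T F \<and> openin T U \<and> F \<subseteq> A n \<and> A n \<subseteq> U \<and> measure \<mu> (U - F) < \<delta> n" for n
      using Union.IH by blast
    then obtain F U where FU: "\<And>n. closedin T (F n)" "\<And>n. openin T (U n)" "\<And>n. F n \<subseteq> A n" "\<And>n. A n \<subseteq> U n"
      "\<And>n. measure \<mu> (U n - F n) < \<delta> n"
      by metis
    have mF: "F n \<in> sets \<mu>" and mU: "U n \<in> sets \<mu>" for n using FU cl op by auto
    have \<delta>_sums: "\<delta> sums (\<epsilon> / 2)"
      using sums_mult[OF power_half_series, of "\<epsilon>/2"] by (simp add: \<delta>_def[abs_def])
    define V where "V = (\<Union>n. U n)"
    have V: "openin T V" unfolding V_def using FU(2) by blast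
    have sm: "summable (\<lambda>n. measure \<mu> (U n - F n))"
    proof (rule summable_comparison_test'[of \<delta> 0])
      show "summable \<delta>" using \<delta>_sums by (rule sums_summable)
      show "norm (measure \<mu> (U n - F n)) \<le> \<delta> n" for n using FU(5)[of n] by simp
    qed
    have "measure \<mu> (V - (\<Union>n. F n)) \<le> measure \<mu> (\<Union>n. U n - F n)"
      unfolding V_def using mF mU by (intro finite_measure_mono) auto
    also have "\<dots> \<le> (\<Sum>n. measure \<mu> (U n - F n))"
      using mF mU by (intro finite_measure_subadditive_countably sm) auto
    also have "\<dots> \<le> (\<Sum>n. \<delta> n)"
      using FU(5) by (intro suminf_le sm sums_summable[OF \<delta>_sums]) (simp add: less_imp_le)
    also have "\<dots> = \<epsilon> / 2" using \<delta>_sums by (simp add: sums_iff)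
    finally have le: "measure \<mu> (V - (\<Union>n. F n)) \<le> \<epsilon> / 2" .
    \<comment> \<open>The union of all \<open>F i\<close> need not be closed; finitely many of them
      exhaust it up to \<open>\<epsilon> / 2\<close>, the other half being spent on the
      \<open>\<delta> n\<close>.\<close>
    define P where "P n = (\<Union>i<n. F i)" for n
    have P: "closedin T (P n)" for n unfolding P_def using FU(1) by (intro closedin_Union) auto
    have "(\<Union>n. P n) = (\<Union>n. F n)" unfolding P_def by auto
    moreover have "incseq P" unfolding P_def by (intro incseq_SucI) (auto simp: less_Suc_eq)
    ultimately have "(\<lambda>n. measure \<mu> (P n)) \<longlonglongrightarrow> measure \<mu> (\<Union>n. F n)"
      using finite_Lim_measure_incseq[of P] cl[OF P] by (simp add: image_subset_iff)
    then have "\<forall>\<^sub>F n in sequentially. measure \<mu> (\<Union>n. F n) - \<epsilon> / 2 < measure \<mu> (P n)"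
      by (rule order_tendstoD(1)) (use Union.prems in simp)
    then obtain n where "measure \<mu> (\<Union>n. F n) - \<epsilon> / 2 < measure \<mu> (P n)"
      by (auto simp: eventually_sequentially)
    then have n: "measure \<mu> (\<Union>n. F n) - measure \<mu> (P n) < \<epsilon> / 2" by simp
    have "F n \<subseteq> U n" for n using FU(3,4) by blast
    then have sub: "P n \<subseteq> (\<Union>n. F n)" "(\<Union>n. F n) \<subseteq> V" unfolding P_def V_def by blast+
    have mUF: "(\<Union>n. F n) \<in> sets \<mu>" using mF by auto
    have "measure \<mu> (V - P n) = measure \<mu> V - measure \<mu> (P n)"
      using sub op[OF V] cl[OF P] by (intro finite_measure_Diff) auto
    moreover have "measure \<mu> (V - (\<Union>n. F n)) = measure \<mu> V - measure \<mu> (\<Union>n. F n)"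
      using sub op[OF V] mUF by (intro finite_measure_Diff) auto
    ultimately have "measure \<mu> (V - P n) < \<epsilon>" using n le by simp
    moreover have "P n \<subseteq> (\<Union>n. A n)" "(\<Union>n. A n) \<subseteq> V"
      using FU(3,4) unfolding P_def V_def by blast+
    ultimately show ?case using P[of n] V by (intro exI[of _ "P n"] exI[of _ V]) simp
  qed
qed

section \<open>Translates of a measure on a topological group\<close>

locale group_with_measure =
  fixes X :: "'x tgroup" and \<mu> :: "'x measure"
  assumes tgX: "topological_group X" and metX: "metrizable_space (topo X)"
    and sets_mu: "sets \<mu> = sets (borel_of (topo X))" and probM: "prob_space \<mu>"
begin

sublocale prob_space \<mu> by (rule probM)

lemma topspace_X: "topspace (topo X) = carrier X" by (rule topological_groupD(2)[OF tgX])

lemma space_mu: "space \<mu> = carrier X" using space_borel_of[OF sets_mu] topspace_X by simp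

text \<open>Real-valued form of \<open>translate_measure\<close>, see
  \<open>measure_translate\<close>.\<close>

definition shifted :: "'x \<Rightarrow> 'x set \<Rightarrow> real" where
  "shifted g U = measure \<mu> {x \<in> carrier X. g \<otimes>\<^bsub>X\<^esub> x \<in> U}"

lemma open_measurable: "openin (topo X) U \<Longrightarrow> U \<in> sets \<mu>"
  using openin_sets_borel_of sets_mu by blast

lemma left_mult_measurable: assumes g: "g \<in> carrier X" shows "(\<lambda>x. g \<otimes>\<^bsub>X\<^esub> x) \<in> measurable \<mu> \<mu>"
proof (rule measurable_sigma_sets)
  interpret group X using tgX by (rule topological_groupD)
  show "sets \<mu> = sigma_sets (topspace (topo X)) {U. openin (topo X) U}" by (simp add: sets_mu sets_borel_of)
  show "{U. openin (topo X) U} \<subseteq> Pow (topspace (topo X))" by (auto dest: openin_subset)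
  show "(\<lambda>x. g \<otimes>\<^bsub>X\<^esub> x) \<in> space \<mu> \<rightarrow> topspace (topo X)" using g by (simp add: space_mu topspace_X)
  fix U assume "U \<in> {U. openin (topo X) U}"
  then have "openin (topo X) {x \<in> topspace (topo X). g \<otimes>\<^bsub>X\<^esub> x \<in> U}"
    using openin_continuous_map_preimage[OF continuous_map_left_mult[OF tgX g]] by blast
  moreover have "(\<lambda>x. g \<otimes>\<^bsub>X\<^esub> x) -` U \<inter> space \<mu> = {x \<in> topspace (topo X). g \<otimes>\<^bsub>X\<^esub> x \<in> U}"
    by (auto simp: space_mu topspace_X)
  ultimately show "(\<lambda>x. g \<otimes>\<^bsub>X\<^esub> x) -` U \<inter> space \<mu> \<in> sets \<mu>" using open_measurable by simp
qed

lemma shift_set_measurable: "g \<in> carrier X \<Longrightarrow> U \<in> sets \<mu> \<Longrightarrow> {x \<in> carrier X. g \<otimes>\<^bsub>X\<^esub> x \<in> U} \<in> sets \<mu>"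
  using measurable_sets[OF left_mult_measurable, of g U] by (simp add: vimage_def space_mu Int_def conj_commute)

lemma translate_simps [simp]: "sets (translate_measure X \<mu> g) = sets \<mu>" "space (translate_measure X \<mu> g) = space \<mu>"
  by (simp_all add: translate_measure_def)

lemma measure_translate:
  assumes "g \<in> carrier X" "U \<in> sets \<mu>"
  shows "measure (translate_measure X \<mu> g) U = shifted g U"
proof -
  have "(\<lambda>x. g \<otimes>\<^bsub>X\<^esub> x) -` U \<inter> space \<mu> = {x \<in> carrier X. g \<otimes>\<^bsub>X\<^esub> x \<in> U}" by (auto simp: space_mu)
  then show ?thesis
    unfolding translate_measure_def shifted_def
    using measure_distr[OF left_mult_measurable[OF assms(1)] assms(2)] by simp
qed

lemma prob_space_translate: "g \<in> carrier X \<Longrightarrow> prob_space (translate_measure X \<mu> g)"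
  unfolding translate_measure_def by (rule prob_space_distr[OF left_mult_measurable])

text \<open>Elements whose translate of \<open>\<mu>\<close> has total variation distance at most \<open>1 - \<delta>\<close> from \<open>\<mu>\<close>, measured on open sets only:
  there \<open>g \<mapsto> shifted g U\<close> is lower semicontinuous.\<close>

definition near_set :: "real \<Rightarrow> 'x set" where
  "near_set \<delta> = {g \<in> carrier X. \<forall>U. openin (topo X) U \<longrightarrow> shifted g U \<le> 1 - \<delta> + measure \<mu> U}"

text \<open>For open \<open>U\<close>, a point moved into \<open>U\<close> by \<open>l\<close> is
  eventually moved into \<open>U\<close> by every sequence tending to \<open>l\<close>. So the
  preimage for \<open>l\<close> lies in the lower limit of the preimages along the sequence, and the
  defining inequalities pass to the limit.\<close>

lemma near_set_closed: "closedin (topo X) (near_set \<delta>)"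
proof -
  obtain M d where "Metric_space M d" and topo: "topo X = Metric_space.mtopology M d"
    using metX by (auto simp: metrizable_space_def)
  then interpret Metric_space M d by simp
  interpret group X using tgX by (rule topological_groupD)
  have MX: "M = carrier X" using topspace_X topo by simp
  have "l \<in> near_set \<delta>" if s: "range \<sigma> \<subseteq> near_set \<delta>" and lim: "limitin (topo X) \<sigma> l sequentially" for \<sigma> l
  proof -
    have \<sigma>: "\<sigma> n \<in> carrier X" "openin (topo X) U \<Longrightarrow> shifted (\<sigma> n) U \<le> 1 - \<delta> + measure \<mu> U" for n U
      using s by (auto simp: near_set_def image_subset_iff)
    have l: "l \<in> carrier X" using lim topspace_X by (auto simp: limitin_def)
    have "shifted l U \<le> 1 - \<delta> + measure \<mu> U" if U: "openin (topo X) U" for U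
    proof -
      define B where "B n = {x \<in> carrier X. \<sigma> n \<otimes>\<^bsub>X\<^esub> x \<in> U}" for n
      have B: "B n \<in> sets \<mu>" for n unfolding B_def using \<sigma>(1) open_measurable[OF U] by (rule shift_set_measurable)
      \<comment> \<open>Increasing in \<open>k\<close>, with the lower limit of the
        \<open>B n\<close> as union.\<close>
      define A where "A k = (\<Inter>n\<in>{k..}. B n)" for k
      have A: "A k \<in> sets \<mu>" for k unfolding A_def using B by (intro sets.countable_INT') auto
      have inc: "incseq A" unfolding A_def by (intro incseq_SucI) auto
      have "{x \<in> carrier X. l \<otimes>\<^bsub>X\<^esub> x \<in> U} \<subseteq> (\<Union>k. A k)"
      proof
        fix x assume x: "x \<in> {x \<in> carrier X. l \<otimes>\<^bsub>X\<^esub> x \<in> U}"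
        have "limitin (topo X) ((\<lambda>g. g \<otimes>\<^bsub>X\<^esub> x) \<circ> \<sigma>) (l \<otimes>\<^bsub>X\<^esub> x) sequentially"
          using continuous_map_right_mult[OF tgX] x lim by (intro continuous_map_limit) auto
        then have "\<forall>\<^sub>F n in sequentially. \<sigma> n \<otimes>\<^bsub>X\<^esub> x \<in> U"
          using U x by (auto simp: limitin_def)
        then show "x \<in> (\<Union>k. A k)" using x by (auto simp: eventually_sequentially A_def B_def)
      qed
      then have "shifted l U \<le> measure \<mu> (\<Union>k. A k)"
        unfolding shifted_def using A by (intro finite_measure_mono) auto
      also have "\<dots> \<le> 1 - \<delta> + measure \<mu> U"
      proof (rule LIMSEQ_le_const2)
        show "(\<lambda>k. measure \<mu> (A k)) \<longlonglongrightarrow> measure \<mu> (\<Union>k. A k)"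
          using A inc by (intro finite_Lim_measure_incseq) auto
        have "measure \<mu> (A k) \<le> 1 - \<delta> + measure \<mu> U" for k
        proof -
          have "measure \<mu> (A k) \<le> measure \<mu> (B k)" using B by (intro finite_measure_mono) (auto simp: A_def)
          also have "\<dots> \<le> 1 - \<delta> + measure \<mu> U" using \<sigma>(2)[OF U, of k] by (simp add: shifted_def B_def)
          finally show ?thesis .
        qed
        then show "\<exists>N. \<forall>k\<ge>N. measure \<mu> (A k) \<le> 1 - \<delta> + measure \<mu> U" by blast
      qed
      finally show ?thesis .
    qed
    with l show ?thesis by (simp add: near_set_def)
  qed
  note limits = this
  have "near_set \<delta> \<subseteq> M" unfolding MX by (auto simp: near_set_def)
  then show ?thesis
    unfolding topo metric_closedin_iff_sequentially_closed using limits[unfolded topo] by blast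
qed

text \<open>Singularity concentrates the translate on a \<open>\<mu>\<close>-null Borel set;
  regularity encloses that set in an open one of measure below \<open>\<delta>\<close>, for which
  the defining inequality fails.\<close>

lemma near_set_not_singular:
  assumes "\<delta> > 0" "g \<in> near_set \<delta>"
  shows "\<not> mutually_singular (translate_measure X \<mu> g) \<mu>"
proof
  have g: "g \<in> carrier X" using assms(2) by (simp add: near_set_def)
  interpret T: prob_space "translate_measure X \<mu> g" by (rule prob_space_translate[OF g])
  assume "mutually_singular (translate_measure X \<mu> g) \<mu>"
  then obtain E where E: "E \<in> sets \<mu>" "emeasure (translate_measure X \<mu> g) E = 0" "emeasure \<mu> (space \<mu> - E) = 0"
    by (auto simp: mutually_singular_def)
  define E' where "E' = space \<mu> - E"
  have E': "E' \<in> sets \<mu>" "measure \<mu> E' = 0" using E by (auto simp: E'_def measure_def)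
  obtain F U where U: "openin (topo X) U" "closedin (topo X) F" "E' \<subseteq> U" "F \<subseteq> E'" "measure \<mu> (U - F) < \<delta>"
    using borel_regular[OF finite_measure_axioms sets_mu metX E'(1) assms(1)] by blast
  have F: "F \<in> sets \<mu>" using U(2) closedin_sets_borel_of sets_mu by blast
  have "measure \<mu> U \<le> measure \<mu> ((U - F) \<union> E')"
    using U(4) E'(1) F open_measurable[OF U(1)] by (intro finite_measure_mono) auto
  also have "\<dots> \<le> measure \<mu> (U - F) + measure \<mu> E'"
    using E'(1) F open_measurable[OF U(1)] by (intro measure_Un_le) auto
  finally have small: "measure \<mu> U < \<delta>" using U(5) E'(2) by simp
  have "1 = measure (translate_measure X \<mu> g) E'"
    using T.prob_compl[of E] E(1,2) by (simp add: E'_def measure_def)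
  also have "\<dots> \<le> measure (translate_measure X \<mu> g) U"
    using U(3) open_measurable[OF U(1)] by (intro T.finite_measure_mono) auto
  also have "\<dots> = shifted g U" by (rule measure_translate[OF g open_measurable[OF U(1)]])
  also have "\<dots> \<le> 1 - \<delta> + measure \<mu> U" using assms(2) U(1) by (simp add: near_set_def)
  finally show False using small by simp
qed

text \<open>Otherwise there are open sets of measure below \<open>(1/2) ^ n\<close> that carry all
  but \<open>(1/2) ^ n\<close> of the translate. Their upper limit is null for \<open>\<mu>\<close>
  by Borel-Cantelli and of full measure for the translate, against absolute continuity.\<close>

lemma quasi_invariance_subset_near:
  assumes "g \<in> quasi_invariance_set X \<mu>"
  shows "\<exists>n. g \<in> near_set ((1/2) ^ n)"
proof (rule ccontr)
  have g: "g \<in> carrier X" and ac: "absolutely_continuous \<mu> (translate_measure X \<mu> g)"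
    using assms by (auto simp: quasi_invariance_set_def equivalent_measures_def)
  interpret T: prob_space "translate_measure X \<mu> g" by (rule prob_space_translate[OF g])
  assume "\<not> ?thesis"
  then have "\<exists>U. openin (topo X) U \<and> shifted g U > 1 - (1/2) ^ n + measure \<mu> U" for n
    using g by (auto simp: near_set_def not_le)
  then obtain U where U: "\<And>n. openin (topo X) (U n)" "\<And>n. shifted g (U n) > 1 - (1/2) ^ n + measure \<mu> (U n)"
    by metis
  have mU: "U n \<in> sets \<mu>" for n using U(1) by (rule open_measurable)
  have shifted_le: "shifted g A \<le> 1" for A by (simp add: shifted_def)
  have le: "norm (measure \<mu> (U n)) \<le> (1/2) ^ n" for n using U(2)[of n] shifted_le[of "U n"] by simp
  have "summable (\<lambda>n. measure \<mu> (U n))"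
    by (rule summable_comparison_test'[OF _ le]) (simp add: summable_geometric)
  then have "limsup U \<in> null_sets \<mu>"
    using mU by (intro borel_cantelli_limsup1) (auto simp: less_top[symmetric])
  then have "limsup U \<in> null_sets (translate_measure X \<mu> g)" using ac by (auto simp: absolutely_continuous_def)
  then have 1: "AE x in translate_measure X \<mu> g. x \<notin> limsup U" by (rule AE_not_in)
  have "AE x in translate_measure X \<mu> g. x \<in> (\<Union>n\<in>{m..}. U n)" for m
  proof (rule T.AE_prob_1)
    have big: "1 - (1/2) ^ n \<le> measure (translate_measure X \<mu> g) (\<Union>n\<in>{m..}. U n)" if "n \<ge> m" for n
    proof -
      have "1 - (1/2) ^ n \<le> shifted g (U n)" using U(2)[of n] measure_nonneg[of \<mu> "U n"] by linarith
      also have "\<dots> = measure (translate_measure X \<mu> g) (U n)" using measure_translate[OF g mU] by simp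
      also have "\<dots> \<le> measure (translate_measure X \<mu> g) (\<Union>n\<in>{m..}. U n)"
        using mU that by (intro T.finite_measure_mono) auto
      finally show ?thesis .
    qed
    have "(\<lambda>n. 1 - (1/2) ^ n) \<longlonglongrightarrow> 1 - (0::real)"
      by (intro tendsto_intros LIMSEQ_power_zero) auto
    then have "1 - 0 \<le> measure (translate_measure X \<mu> g) (\<Union>n\<in>{m..}. U n)"
      by (rule LIMSEQ_le_const2) (use big in blast)
    then have "1 \<le> measure (translate_measure X \<mu> g) (\<Union>n\<in>{m..}. U n)" by simp
    then show "measure (translate_measure X \<mu> g) (\<Union>n\<in>{m..}. U n) = 1"
      using T.prob_le_1 by (intro antisym)
  qed
  then have "AE x in translate_measure X \<mu> g. \<forall>m. x \<in> (\<Union>n\<in>{m..}. U n)"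
    by (simp add: AE_all_countable)
  with 1 have "AE x in translate_measure X \<mu> g. False"
    by eventually_elim (auto simp: limsup_INF_SUP)
  then show False by (simp add: T.AE_False)
qed

end

section \<open>The group of null sequences is not a group of quasi-invariance\<close>

text \<open>Used with finite \<open>F\<close>: the distance from 1 in \<open>TH0\<close> is then at
  most \<open>\<bar>c\<bar>\<close>, however large \<open>F\<close> is.\<close>

definition block :: "real \<Rightarrow> nat set \<Rightarrow> nat \<Rightarrow> complex" where
  "block c F = (\<lambda>k. if k \<in> F then cis c else 1)"

interpretation T0: flat_sequences TH0_carrier TH0_dist
  by (rule flat_sequences_TH0)

lemma block_mem: assumes "finite F" shows "block c F \<in> TH0_carrier"
proof -
  obtain n where "F \<subseteq> {..<n}" using assms finite_nat_bounded by blast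
  then have "trunc n (block c F) = block c F" by (auto simp: trunc_def block_def fun_eq_iff)
  moreover have "trunc n (block c F) \<in> TH0_carrier" by (rule T0.trunc_mem_unit) (simp add: block_def)
  ultimately show ?thesis by simp
qed

lemma block_dist: assumes "finite F" shows "TH0_dist (block c F) (\<lambda>k. 1) \<le> \<bar>c\<bar>"
  using norm_cis_diff_one_le[of c] by (intro TH0_dist_le block_mem assms T0.one_mem) (auto simp: block_def)

lemma block_union: "F \<inter> F' = {} \<Longrightarrow> block c (F \<union> F') = block c F \<otimes>\<^bsub>TH0\<^esub> block c F'"
  by (auto simp: block_def TH0_def fun_eq_iff)

lemma block_pow: "block c F [^]\<^bsub>TH0\<^esub> (n::nat) = block (real n * c) F"
proof (induction n)
  case 0
  then show ?case by (auto simp: block_def TH0_def fun_eq_iff)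
next
  case (Suc n)
  then show ?case by (auto simp: block_def TH0_def cis_mult algebra_simps fun_eq_iff)
qed

lemma TH0_pow: "y [^]\<^bsub>TH0\<^esub> (n::nat) = (\<lambda>k. y k ^ n)"
  by (induction n) (auto simp: TH0_def mult.commute)

text \<open>A sequence converging to 1 with values in a finite set is eventually 1, hence encoded by
  a finite list of roots of unity.\<close>

lemma countable_torsion:
  assumes "m > 0"
  shows "countable {y \<in> TH0_carrier. y [^]\<^bsub>TH0\<^esub> (m::nat) = (\<lambda>k. 1)}"
proof -
  define R where "R = {u::complex. u ^ m = 1}"
  have R: "finite R" unfolding R_def using assms by (intro finite_roots_unity) simp
  have "{y \<in> TH0_carrier. y [^]\<^bsub>TH0\<^esub> m = (\<lambda>k. 1)} \<subseteq> (\<lambda>l k. if k < length l then l ! k else 1) ` lists R"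
  proof clarify
    fix y assume y: "y \<in> TH0_carrier" "y [^]\<^bsub>TH0\<^esub> m = (\<lambda>k. 1)"
    have yR: "y k \<in> R" for k using fun_cong[OF y(2), of k] by (simp add: TH0_pow R_def)
    have "open (- (R - {1}))" using R by (intro open_Compl finite_imp_closed) simp
    then have "\<forall>\<^sub>F k in sequentially. y k \<in> - (R - {1})"
      using y(1) topological_tendstoD[of y 1 sequentially "- (R - {1})"] by (simp add: TH0_carrier_def)
    then obtain n where n: "\<And>k. k \<ge> n \<Longrightarrow> y k = 1" using yR by (auto simp: eventually_sequentially)
    have "y = (\<lambda>k. if k < length (map y [0..<n]) then map y [0..<n] ! k else 1)"
      using n by (auto simp: fun_eq_iff not_less)
    moreover have "map y [0..<n] \<in> lists R" using yR by auto
    ultimately show "y \<in> (\<lambda>l k. if k < length l then l ! k else 1) ` lists R" by blast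
  qed
  then show ?thesis
    using R by (meson countable_finite countable_image countable_lists countable_subset)
qed

text \<open>A metric for the topology of \<open>X\<close> is fixed so that compactness and
  closedness can be used through sequences.\<close>

locale injected_TH0 =
  fixes X :: "'x tgroup" and \<iota> :: "(nat \<Rightarrow> complex) \<Rightarrow> 'x" and M d
  assumes tgX: "topological_group X" and metric: "Metric_space M d" and topo_X: "topo X = Metric_space.mtopology M d"
    and lc: "locally_compact_space (topo X)"
    and hom: "\<iota> \<in> hom TH0 X" and inj: "inj_on \<iota> (carrier TH0)" and cont: "continuous_map (topo TH0) (topo X) \<iota>"
begin

sublocale Metric_space M d by (rule metric)
sublocale group X using tgX by (rule topological_groupD)

lemma M_eq: "M = carrier X"
  using topological_groupD(2)[OF tgX] topo_X by simp

sublocale \<iota>: group_hom TH0 X \<iota>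
  using T0.group_G hom is_group by (auto simp: group_hom_def group_hom_axioms_def TH0_seq_group)

lemma carrier_TH0: "carrier TH0 = TH0_carrier" and one_TH0: "\<one>\<^bsub>TH0\<^esub> = (\<lambda>k. 1)"
  by (simp_all add: TH0_def)

lemma \<iota>_block_mem: "finite F \<Longrightarrow> \<iota> (block c F) \<in> carrier X"
  using \<iota>.hom_closed block_mem by (simp add: carrier_TH0)

lemma \<iota>_block_union: "finite F \<Longrightarrow> finite F' \<Longrightarrow> F \<inter> F' = {} \<Longrightarrow> \<iota> (block c (F \<union> F')) = \<iota> (block c F) \<otimes>\<^bsub>X\<^esub> \<iota> (block c F')"
  using \<iota>.hom_mult[of "block c F" "block c F'"] block_mem by (simp add: block_union carrier_TH0)

lemma \<iota>_block_pow: "finite F \<Longrightarrow> \<iota> (block c F) [^]\<^bsub>X\<^esub> (n::nat) = \<iota> (block (real n * c) F)"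
  using \<iota>.hom_nat_pow[of "block c F" n] block_mem[of F c] by (simp add: block_pow carrier_TH0)

text \<open>One threshold for the angle serves all finite index sets, because the bound in
  \<open>block_dist\<close> does not involve \<open>F\<close>.\<close>

lemma small_blocks:
  assumes "openin (topo X) W" "\<one>\<^bsub>X\<^esub> \<in> W"
  obtains r where "r > 0" "\<And>c F. finite F \<Longrightarrow> \<bar>c\<bar> < r \<Longrightarrow> \<iota> (block c F) \<in> W"
proof -
  have "\<iota> (\<lambda>k. 1) \<in> W" using \<iota>.hom_one assms(2) by (simp add: one_TH0)
  moreover note bspec[OF conjunct2[OF cont[unfolded TH0_seq_group seq_group_simps T0.continuous_map_from_metric]] T0.one_mem]
  ultimately have "\<exists>r>0. \<forall>z. z \<in> TH0_carrier \<and> TH0_dist (\<lambda>k. 1) z < r \<longrightarrow> \<iota> z \<in> W"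
    using assms(1) by simp
  then obtain r where r: "r > 0" "\<And>z. z \<in> TH0_carrier \<Longrightarrow> TH0_dist (\<lambda>k. 1) z < r \<Longrightarrow> \<iota> z \<in> W"
    by blast
  have "\<iota> (block c F) \<in> W" if "finite F" "\<bar>c\<bar> < r" for c F
    using that block_dist[of F c] block_mem[of F c] by (intro r(2)) (auto simp: T0.commute)
  with r(1) that show thesis by blast
qed

text \<open>Disjoint blocks can be multiplied without leaving a small ball of \<open>TH0\<close>. Hence if
  \<open>\<iota> (block (c / m) (F n)) \<longlonglongrightarrow> y\<close> along disjoint \<open>F n\<close>, then the limit \<open>y\<^sup>m\<close> of \<open>\<iota> (block c (F n))\<close> is also
  the limit of \<open>\<iota> (block (c / m) (F (n+1) \<union> \<dots> \<union> F (n+m)))\<close>, which is close to 1 for large \<open>m\<close>.\<close>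

lemma tail_blocks_small:
  assumes L: "compactin (topo X) L" and c: "\<And>b F. finite F \<Longrightarrow> \<bar>b\<bar> \<le> \<bar>c\<bar> \<Longrightarrow> \<iota> (block b F) \<in> L"
    and W: "openin (topo X) W" "\<one>\<^bsub>X\<^esub> \<in> W"
  shows "\<exists>N. \<forall>F. finite F \<and> F \<subseteq> {N..} \<longrightarrow> \<iota> (block c F) \<in> W"
proof (rule ccontr)
  assume "\<not> ?thesis"
  then have "\<exists>F. finite F \<and> F \<subseteq> {N..} \<and> \<iota> (block c F) \<notin> W" for N by blast
  then obtain A where A: "\<And>N. finite (A N)" "\<And>N. A N \<subseteq> {N..}" "\<And>N. \<iota> (block c (A N)) \<notin> W" by metis
  \<comment> \<open>Starting each new index set beyond the preceding one makes the sets
    disjoint.\<close>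
  define s where "s = rec_nat 0 (\<lambda>_ N. Suc (Max (insert N (A N))))"
  have s_Suc: "s (Suc n) = Suc (Max (insert (s n) (A (s n))))" for n by (simp add: s_def)
  have s_lt: "k < s (Suc n)" if "k \<in> insert (s n) (A (s n))" for k n
    unfolding s_Suc using that A(1) by (simp add: less_Suc_eq_le del: Max_insert)
  define F where "F n = A (s n)" for n
  have F: "finite (F n)" "F n \<subseteq> {s n..<s (Suc n)}" "\<iota> (block c (F n)) \<notin> W" for n
    using A(1,3) A(2)[of "s n"] s_lt[of _ n] by (auto simp: F_def)
  have s_mono: "s m \<le> s n" if "m \<le> n" for m n
    using that by (rule lift_Suc_mono_le[of s, rotated]) (use s_lt in \<open>simp add: less_imp_le\<close>)
  have disj: "F m \<inter> F n = {}" if "m < n" for m n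
    using F(2)[of m] F(2)[of n] s_mono[of "Suc m" n] that by (fastforce)
  obtain e where e: "e > 0" "mcball \<one>\<^bsub>X\<^esub> e \<subseteq> W"
    using W unfolding topo_X openin_mtopology_mcball by blast
  have "\<one>\<^bsub>X\<^esub> \<in> M" unfolding M_eq by simp
  then have "openin (topo X) (mball \<one>\<^bsub>X\<^esub> e)" "\<one>\<^bsub>X\<^esub> \<in> mball \<one>\<^bsub>X\<^esub> e"
    using e(1) by (simp_all add: topo_X)
  then obtain r where r: "r > 0" "\<And>c F. finite F \<Longrightarrow> \<bar>c\<bar> < r \<Longrightarrow> \<iota> (block c F) \<in> mball \<one>\<^bsub>X\<^esub> e"
    using small_blocks by blast
  obtain m :: nat where m: "\<bar>c\<bar> < real m * r" using reals_Archimedean3[OF r(1)] by blast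
  have m0: "m > 0" using m r(1) by (cases "m = 0") auto
  \<comment> \<open>All blocks with angle \<open>b\<close> are mapped into the ball of radius
    \<open>e\<close>, while their \<open>m\<close>-th powers are the blocks with angle
    \<open>c\<close>.\<close>
  define b where "b = c / real m"
  have b: "\<bar>b\<bar> < r" "\<bar>b\<bar> \<le> \<bar>c\<bar>" "real m * b = c"
    using m m0 mult_left_mono[of 1 "real m" "\<bar>c\<bar>"] by (auto simp: b_def field_simps)
  have L_seq: "\<And>\<sigma>::nat \<Rightarrow> 'x. range \<sigma> \<subseteq> L \<Longrightarrow> \<exists>l r. l \<in> L \<and> strict_mono r \<and> limitin mtopology (\<sigma> \<circ> r) l sequentially"
    using L unfolding topo_X compactin_sequentially by blast
  have "range (\<lambda>n. \<iota> (block b (F n))) \<subseteq> L" using c F(1) b(2) by blast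
  from L_seq[OF this] obtain y \<phi> where y: "strict_mono \<phi>"
    "limitin (topo X) (\<lambda>n. \<iota> (block b (F (\<phi> n)))) y sequentially"
    by (auto simp: topo_X o_def)
  have "limitin (topo X) (\<lambda>n. \<iota> (block c (F (\<phi> n)))) (y [^]\<^bsub>X\<^esub> m) sequentially"
    using limitin_nat_pow[OF tgX y(2), of m] F(1) b(3) by (simp add: \<iota>_block_pow)
  moreover have "closedin (topo X) (carrier X - W)"
    using W(1) topological_groupD(2)[OF tgX] by (metis closedin_diff closedin_topspace)
  ultimately have not_in: "y [^]\<^bsub>X\<^esub> m \<in> carrier X - W"
    using F(1,3) \<iota>_block_mem by (intro limitin_closedin[where f="\<lambda>n. \<iota> (block c (F (\<phi> n)))"]) auto
  have disj_\<phi>: "(\<Union>i<j. F (\<phi> (n + i))) \<inter> F (\<phi> (n + j)) = {}" for n j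
    using disj y(1) by (auto simp: strict_mono_def) (metis add_less_cancel_left disjoint_iff)
  have "limitin (topo X) (\<lambda>n. \<iota> (block b (\<Union>i<j. F (\<phi> (n + i))))) (y [^]\<^bsub>X\<^esub> j) sequentially" for j :: nat
  proof (induction j)
    case 0
    have "block b {} = \<one>\<^bsub>TH0\<^esub>" by (simp add: block_def TH0_def)
    then show ?case using topological_groupD(2)[OF tgX] by simp
  next
    case (Suc j)
    have "limitin (topo X) ((\<lambda>n. \<iota> (block b (F (\<phi> n)))) \<circ> (\<lambda>n. n + j)) y sequentially"
      using y(2) by (intro limitin_subsequence) (auto simp: strict_mono_def)
    from limitin_group_mult[OF tgX Suc this]
    show ?case
      using F(1) disj_\<phi>[of _ j] by (simp add: lessThan_Suc \<iota>_block_union[symmetric] Un_commute o_def)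
  qed
  moreover have "closedin (topo X) (mcball \<one>\<^bsub>X\<^esub> e)" by (simp add: topo_X)
  moreover have "\<iota> (block b (\<Union>i<m. F (\<phi> (n + i)))) \<in> mcball \<one>\<^bsub>X\<^esub> e" for n
    using r(2)[OF _ b(1), of "\<Union>i<m. F (\<phi> (n + i))"] F(1) mball_subset_mcball by blast
  ultimately have "y [^]\<^bsub>X\<^esub> m \<in> mcball \<one>\<^bsub>X\<^esub> e"
    by (intro limitin_closedin[where f="\<lambda>n. \<iota> (block b (\<Union>i<m. F (\<phi> (n + i))))" and F=sequentially]) auto
  with e(2) not_in show False by blast
qed

text \<open>A diagonal argument: infinitely many bits can be used to avoid countably many limits.\<close>

lemma avoiding_set_exists:
  fixes q :: "nat \<Rightarrow> 'x"
  assumes tail: "\<And>W. openin (topo X) W \<Longrightarrow> \<one>\<^bsub>X\<^esub> \<in> W \<Longrightarrow> \<exists>N. \<forall>F. finite F \<and> F \<subseteq> {N..} \<longrightarrow> \<iota> (block c F) \<in> W"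
    and c: "cis c \<noteq> 1" and q: "\<And>j. q j \<in> carrier X"
  obtains I where "\<And>j. \<exists>W N. openin (topo X) W \<and> q j \<in> W \<and> (\<forall>n\<ge>N. \<iota> (block c (I \<inter> {..<n})) \<notin> W)"
proof -
  define good where "good j S n \<longleftrightarrow>
    (\<exists>W. openin (topo X) W \<and> q j \<in> W \<and> (\<forall>A. finite A \<and> A \<subseteq> {n..} \<longrightarrow> \<iota> (block c (S \<union> A)) \<notin> W))" for j S n
  have step: "\<exists>S' n'. finite S' \<and> S' \<subseteq> {..<n'} \<and> n \<le> n' \<and> S' \<inter> {..<n} = S \<and> good j S' n'"
    if S: "finite S" "S \<subseteq> {..<n}" for j S n
  proof -
    have "block c S \<noteq> block c (insert n S)"
      using S(2) c by (auto simp: block_def fun_eq_iff intro!: exI[of _ n])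
    then have "\<iota> (block c S) \<noteq> \<iota> (block c (insert n S))"
      using inj S(1) block_mem by (auto simp: inj_on_def carrier_TH0)
    \<comment> \<open>The bit at \<open>n\<close> is free: as \<open>\<iota>\<close> is injective,
      at least one of the two choices misses \<open>q j\<close>.\<close>
    then obtain S' where S': "S' = S \<or> S' = insert n S" "\<iota> (block c S') \<noteq> q j" by metis
    have S'_fin: "finite S'" "S' \<subseteq> {..<Suc n}" "S' \<inter> {..<n} = S" using S S'(1) by auto
    define p where "p = \<iota> (block c S')"
    have p: "p \<in> carrier X" unfolding p_def by (rule \<iota>_block_mem[OF S'_fin(1)])
    have pM: "p \<in> M" "q j \<in> M" using p q M_eq by auto
    \<comment> \<open>With half the distance the balls around \<open>p\<close> and
      \<open>q j\<close> are disjoint. Bits from \<open>n'\<close> on multiply \<open>p\<close> by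
      an element of \<open>V\<close> and so keep the product in the ball around
      \<open>p\<close>.\<close>
    define \<rho> where "\<rho> = d p (q j) / 2"
    have \<rho>: "\<rho> > 0" using S'(2) pM by (simp add: \<rho>_def p_def)
    define V where "V = {v \<in> topspace (topo X). p \<otimes>\<^bsub>X\<^esub> v \<in> mball p \<rho>}"
    have "openin (topo X) V"
      unfolding V_def by (rule openin_continuous_map_preimage[OF continuous_map_left_mult[OF tgX p]]) (simp add: topo_X)
    moreover have "\<one>\<^bsub>X\<^esub> \<in> V" using pM p \<rho> topological_groupD(2)[OF tgX] by (simp add: V_def)
    ultimately obtain N where "\<forall>F. finite F \<and> F \<subseteq> {N..} \<longrightarrow> \<iota> (block c F) \<in> V"
      by (rule exE[OF tail])
    then have N: "\<And>F. finite F \<Longrightarrow> F \<subseteq> {N..} \<Longrightarrow> \<iota> (block c F) \<in> V" by blast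
    define n' where "n' = max (Suc n) N"
    have "good j S' n'"
      unfolding good_def
    proof (intro exI[of _ "mball (q j) \<rho>"] conjI allI impI)
      fix A assume A: "finite A \<and> A \<subseteq> {n'..}"
      then have "\<iota> (block c A) \<in> V" by (intro N) (auto simp: n'_def)
      moreover have "S' \<inter> A = {}" using A S'_fin(2) by (fastforce simp: n'_def)
      ultimately have in_p: "\<iota> (block c (S' \<union> A)) \<in> mball p \<rho>"
        using A S'_fin(1) by (simp add: \<iota>_block_union V_def p_def)
      have "disjnt (mball p \<rho>) (mball (q j) \<rho>)" by (rule disjoint_mball) (simp add: \<rho>_def)
      with in_p show "\<iota> (block c (S' \<union> A)) \<notin> mball (q j) \<rho>" by (auto simp: disjnt_iff)
    qed (use \<rho> pM in \<open>simp_all add: topo_X\<close>)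
    then show ?thesis
      using S'_fin by (intro exI[of _ S'] exI[of _ n']) (auto simp: n'_def)
  qed
  have "\<exists>f. \<forall>j. (case f j of (S, n) \<Rightarrow> finite S \<and> S \<subseteq> {..<n}) \<and>
      (case f j of (S, n) \<Rightarrow> case f (Suc j) of (S', n') \<Rightarrow> n \<le> n' \<and> S' \<inter> {..<n} = S \<and> good j S' n')"
  proof (rule dependent_nat_choice)
    show "\<exists>x. case x of (S, n) \<Rightarrow> finite S \<and> S \<subseteq> {..<n::nat}" by (rule exI[of _ "({}, 0)"]) simp
  next
    fix x and j :: nat assume "case x of (S, n) \<Rightarrow> finite S \<and> S \<subseteq> {..<n::nat}"
    then obtain S n where x: "x = (S, n)" "finite S" "S \<subseteq> {..<n}" by (cases x) auto
    obtain S' n' where "finite S' \<and> S' \<subseteq> {..<n'} \<and> n \<le> n' \<and> S' \<inter> {..<n} = S \<and> good j S' n'"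
      using step[OF x(2,3), of j] by blast
    then show "\<exists>y. (case y of (S, n) \<Rightarrow> finite S \<and> S \<subseteq> {..<n}) \<and>
        (case x of (S, n) \<Rightarrow> case y of (S', n') \<Rightarrow> n \<le> n' \<and> S' \<inter> {..<n} = S \<and> good j S' n')"
      using x by (intro exI[of _ "(S', n')"]) simp
  qed
  then obtain f where f: "\<forall>j. (case f j of (S, n) \<Rightarrow> finite S \<and> S \<subseteq> {..<n}) \<and>
      (case f j of (S, n) \<Rightarrow> case f (Suc j) of (S', n') \<Rightarrow> n \<le> n' \<and> S' \<inter> {..<n} = S \<and> good j S' n')"
    by (elim exE)
  define S where "S j = fst (f j)" for j
  define n where "n j = snd (f j)" for j
  have S: "finite (S j)" "S j \<subseteq> {..<n j}" "n j \<le> n (Suc j)" "S (Suc j) \<inter> {..<n j} = S j" "good j (S (Suc j)) (n (Suc j))" for j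
    using spec[OF f, of j] by (auto simp: S_def n_def case_prod_beta)
  have n_mono: "n i \<le> n j" if "i \<le> j" for i j using that S(3) by (rule lift_Suc_mono_le[rotated])
  have S_int: "S j \<inter> {..<n i} = S i" if "i \<le> j" for i j
    using that
  proof (induction j rule: dec_induct)
    case base
    then show ?case using S(2)[of i] by auto
  next
    case (step j)
    have "S (Suc j) \<inter> {..<n i} = S (Suc j) \<inter> {..<n j} \<inter> {..<n i}" using n_mono[OF step(1)] by auto
    then show ?case using S(4)[of j] step by simp
  qed
  \<comment> \<open>The stages are coherent: membership below \<open>n i\<close> is settled at stage
    \<open>i\<close>.\<close>
  define I where "I = (\<Union>j. S j)"
  have I_int: "I \<inter> {..<n i} = S i" for i
  proof
    show "I \<inter> {..<n i} \<subseteq> S i"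
    proof
      fix k assume k: "k \<in> I \<inter> {..<n i}"
      then obtain j where j: "k \<in> S j" by (auto simp: I_def)
      show "k \<in> S i"
      proof (cases "i \<le> j")
        case True
        then show ?thesis using S_int[OF True] j k by blast
      next
        case False
        then show ?thesis using S_int[of j i] j by auto
      qed
    qed
    show "S i \<subseteq> I \<inter> {..<n i}" using S(2)[of i] by (auto simp: I_def)
  qed
  have "\<exists>W N. openin (topo X) W \<and> q j \<in> W \<and> (\<forall>k\<ge>N. \<iota> (block c (I \<inter> {..<k})) \<notin> W)" for j
  proof -
    obtain W where W: "openin (topo X) W" "q j \<in> W"
      "\<And>A. finite A \<Longrightarrow> A \<subseteq> {n (Suc j)..} \<Longrightarrow> \<iota> (block c (S (Suc j) \<union> A)) \<notin> W"
      using S(5)[of j] unfolding good_def by blast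
    have "\<iota> (block c (I \<inter> {..<k})) \<notin> W" if k: "k \<ge> n (Suc j)" for k
    proof -
      have "{..<k} = {..<n (Suc j)} \<union> {n (Suc j)..<k}" using k by auto
      then have "I \<inter> {..<k} = S (Suc j) \<union> (I \<inter> {n (Suc j)..<k})" using I_int[of "Suc j"] by blast
      moreover have "\<iota> (block c (S (Suc j) \<union> (I \<inter> {n (Suc j)..<k}))) \<notin> W" by (rule W(3)) auto
      ultimately show ?thesis by simp
    qed
    with W(1,2) show ?thesis by blast
  qed
  with that show thesis by blast
qed

text \<open>Two uses of a small common angle meet here: the compact set \<open>L\<close> provides
  convergent subsequences of blocks, and \<open>D\<close> keeps their limits, translated by
  \<open>g0\<close>, inside the image of \<open>TH0\<close>.\<close>

lemma no_closed_piece: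
  assumes D: "closedin (topo X) D" "D \<subseteq> \<iota> ` carrier TH0"
    and g0: "g0 \<in> carrier TH0" and r: "r > 0" "\<And>z. z \<in> TH0_carrier \<Longrightarrow> TH0_dist z (\<lambda>k. 1) < r \<Longrightarrow> \<iota> (g0 \<otimes>\<^bsub>TH0\<^esub> z) \<in> D"
  shows False
proof -
  have one: "\<one>\<^bsub>X\<^esub> \<in> topspace (topo X)" using topological_groupD(2)[OF tgX] by simp
  then obtain V L where L: "openin (topo X) V" "compactin (topo X) L" "\<one>\<^bsub>X\<^esub> \<in> V" "V \<subseteq> L"
    using lc unfolding locally_compact_space_def by blast
  obtain r' where r': "r' > 0" "\<And>c F. finite F \<Longrightarrow> \<bar>c\<bar> < r' \<Longrightarrow> \<iota> (block c F) \<in> V"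
    using small_blocks[OF L(1,3)] by blast
  define q where "q = min (min r r') 1"
  have q: "0 < q" "q \<le> r" "q \<le> r'" "q \<le> 1" using r(1) r'(1) by (auto simp: q_def)
  obtain m :: nat where m: "2 * pi < real m * q" using reals_Archimedean3[OF q(1)] by blast
  have m0: "m > 0" using m pi_gt_zero by (cases "m = 0") auto
  \<comment> \<open>\<open>c < r\<close> keeps the translated blocks in \<open>D\<close>,
    \<open>c < r'\<close> keeps the blocks in \<open>L\<close>, and \<open>0 < c < 1\<close> gives
    \<open>cis c \<noteq> 1\<close>.\<close>
  define c where "c = 2 * pi / real m"
  have c: "0 < c" "c < r" "c < r'" "c < 1" "real m * c = 2 * pi"
  proof -
    have "c < q" using m m0 by (simp add: c_def field_simps)
    then show "c < r" "c < r'" "c < 1" using q by auto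
  qed (use m0 in \<open>auto simp: c_def\<close>)
  have "sin c > 0" using c pi_gt3 by (intro sin_gt_zero) auto
  then have cis: "cis c \<noteq> 1" by (auto simp: complex_eq_iff)
  define Y where "Y = {y \<in> TH0_carrier. y [^]\<^bsub>TH0\<^esub> m = (\<lambda>k. 1)}"
  have Y: "countable Y" unfolding Y_def by (rule countable_torsion[OF m0])
  have "(\<lambda>k. 1) \<in> Y" using T0.one_mem by (simp add: Y_def TH0_pow)
  then have Yne: "Y \<noteq> {}" by auto
  have e: "from_nat_into Y j \<in> TH0_carrier" for j using from_nat_into[OF Yne, of j] by (simp add: Y_def)
  have in_L: "\<iota> (block b F) \<in> L" if "finite F" "\<bar>b\<bar> \<le> \<bar>c\<bar>" for b F
    using r'(2)[OF that(1), of b] that(2) c L(4) by auto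
  have "\<exists>N. \<forall>F. finite F \<and> F \<subseteq> {N..} \<longrightarrow> \<iota> (block c F) \<in> W"
    if "openin (topo X) W" "\<one>\<^bsub>X\<^esub> \<in> W" for W
    by (rule tail_blocks_small[OF L(2) in_L that])
  moreover have "\<iota> (from_nat_into Y j) \<in> carrier X" for j using e by (simp add: carrier_TH0)
  ultimately obtain I where I: "\<And>j. \<exists>W N. openin (topo X) W \<and> \<iota> (from_nat_into Y j) \<in> W \<and>
      (\<forall>n\<ge>N. \<iota> (block c (I \<inter> {..<n})) \<notin> W)"
    using avoiding_set_exists[OF _ cis, of "\<lambda>j. \<iota> (from_nat_into Y j)"] by blast
  define x where "x n = \<iota> (block c (I \<inter> {..<n}))" for n
  have fin: "finite (I \<inter> {..<n})" for n :: nat by simp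
  have "range x \<subseteq> L" using in_L fin by (auto simp: x_def)
  then obtain h \<phi> where h: "strict_mono \<phi>" "limitin (topo X) (x \<circ> \<phi>) h sequentially"
    using L(2) unfolding topo_X compactin_sequentially by blast
  have hX: "h \<in> carrier X" using h(2) topological_groupD(2)[OF tgX] by (auto simp: limitin_def)
  have g0X: "\<iota> g0 \<in> carrier X" using g0 by simp
  have "limitin (topo X) ((\<lambda>y. \<iota> g0 \<otimes>\<^bsub>X\<^esub> y) \<circ> (x \<circ> \<phi>)) (\<iota> g0 \<otimes>\<^bsub>X\<^esub> h) sequentially"
    by (rule continuous_map_limit[OF continuous_map_left_mult[OF tgX g0X] h(2)])
  moreover have "\<iota> g0 \<otimes>\<^bsub>X\<^esub> x n \<in> D" for n
  proof -
    have "TH0_dist (block c (I \<inter> {..<n})) (\<lambda>k. 1) < r" using block_dist[OF fin[of n], of c] c by simp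
    then have "\<iota> (g0 \<otimes>\<^bsub>TH0\<^esub> block c (I \<inter> {..<n})) \<in> D" by (intro r(2) block_mem fin)
    then show ?thesis using g0 block_mem[OF fin] by (simp add: x_def carrier_TH0)
  qed
  ultimately have "\<iota> g0 \<otimes>\<^bsub>X\<^esub> h \<in> D"
    using D(1) by (intro limitin_closedin[where f="(\<lambda>y. \<iota> g0 \<otimes>\<^bsub>X\<^esub> y) \<circ> (x \<circ> \<phi>)"]) auto
  then obtain y' where y': "y' \<in> carrier TH0" "\<iota> g0 \<otimes>\<^bsub>X\<^esub> h = \<iota> y'" using D(2) by auto
  define y where "y = inv\<^bsub>TH0\<^esub> g0 \<otimes>\<^bsub>TH0\<^esub> y'"
  have y: "y \<in> carrier TH0" unfolding y_def using g0 y'(1) by (intro \<iota>.G.m_closed \<iota>.G.inv_closed)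
  have "\<iota> y = inv\<^bsub>X\<^esub> (\<iota> g0) \<otimes>\<^bsub>X\<^esub> (\<iota> g0 \<otimes>\<^bsub>X\<^esub> h)"
    unfolding y_def y'(2) using g0 y'(1) by simp
  then have yh: "\<iota> y = h" using g0X hX by (simp flip: m_assoc)
  have "limitin (topo X) (\<lambda>n. (x \<circ> \<phi>) n [^]\<^bsub>X\<^esub> m) (h [^]\<^bsub>X\<^esub> m) sequentially"
    by (rule limitin_nat_pow[OF tgX h(2)])
  moreover have "x n [^]\<^bsub>X\<^esub> m = \<one>\<^bsub>X\<^esub>" for n
  proof -
    have "block (2 * pi) (I \<inter> {..<n}) = \<one>\<^bsub>TH0\<^esub>" by (auto simp: block_def one_TH0)
    then show ?thesis using \<iota>_block_pow[OF fin] c(5) by (simp add: x_def)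
  qed
  ultimately have "limitin (topo X) (\<lambda>n::nat. \<one>\<^bsub>X\<^esub>) (h [^]\<^bsub>X\<^esub> m) sequentially" by simp
  moreover have "limitin (topo X) (\<lambda>n::nat. \<one>\<^bsub>X\<^esub>) \<one>\<^bsub>X\<^esub> sequentially" using one by simp
  ultimately have "h [^]\<^bsub>X\<^esub> m = \<one>\<^bsub>X\<^esub>"
    unfolding topo_X by (rule limitin_metric_unique) simp
  then have "\<iota> (y [^]\<^bsub>TH0\<^esub> m) = \<iota> \<one>\<^bsub>TH0\<^esub>"
    using \<iota>.hom_nat_pow[OF y, of m] yh by simp
  then have "y [^]\<^bsub>TH0\<^esub> m = \<one>\<^bsub>TH0\<^esub>"
    using inj y by (auto simp: inj_on_def)
  then have "y \<in> Y" using y by (simp add: Y_def carrier_TH0 one_TH0)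
  \<comment> \<open>The enumeration may repeat values; it is its surjectivity onto \<open>Y\<close>
    that matters.\<close>
  then obtain j where j: "y = from_nat_into Y j" using from_nat_into_surj[OF Y] by metis
  obtain W N where W: "openin (topo X) W" "h \<in> W" "\<And>n. n \<ge> N \<Longrightarrow> x n \<notin> W"
    using I[of j] yh j by (auto simp: x_def)
  have "\<forall>\<^sub>F n in sequentially. (x \<circ> \<phi>) n \<in> W" using h(2) W(1,2) by (auto simp: limitin_def)
  then obtain n0 where n0: "\<And>n. n \<ge> n0 \<Longrightarrow> x (\<phi> n) \<in> W" by (auto simp: eventually_sequentially)
  have "\<phi> (max n0 N) \<ge> N" using seq_suble[OF h(1), of "max n0 N"] by simp
  with n0[of "max n0 N"] W(3) show False by simp
qed

end

text \<open>Baire's theorem is applied in \<open>TH0\<close>, whose completeness is part of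
  \<open>QI_group\<close>, to the preimages of the sets \<open>near_set ((1/2) ^ n)\<close>, which
  cover it by quasi-invariance. Each of these sets lies in the image of \<open>TH0\<close> because
  an element with non-singular translate is quasi-invariant.\<close>

lemma TH0_not_QI_group: "\<not> QI_group TYPE('x) TH0"
proof
  assume "QI_group TYPE('x) TH0"
  then obtain X :: "'x tgroup" and \<mu> \<iota> where polish: "polish_group TH0"
    and X: "polish_group X" "locally_compact_space (topo X)"
    and \<mu>: "sets \<mu> = sets (borel_of (topo X))" "prob_space \<mu>"
    and \<iota>: "\<iota> \<in> hom TH0 X" "inj_on \<iota> (carrier TH0)" "continuous_map (topo TH0) (topo X) \<iota>"
    and qi: "quasi_invariance_set X \<mu> = \<iota> ` carrier TH0"
    and sing: "\<forall>g \<in> carrier X - quasi_invariance_set X \<mu>. mutually_singular (translate_measure X \<mu> g) \<mu>"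
    unfolding QI_group_def by (elim conjE exE)
  have tgX: "topological_group X" and "completely_metrizable_space (topo X)"
    using X(1) by (auto simp: polish_group_def)
  then have met: "metrizable_space (topo X)" by (simp add: completely_metrizable_imp_metrizable_space)
  then obtain M d where Md: "Metric_space M d" "topo X = Metric_space.mtopology M d"
    by (auto simp: metrizable_space_def)
  interpret group_with_measure X \<mu> by (rule group_with_measure.intro[OF tgX met \<mu>])
  interpret injected_TH0 X \<iota> M d
    by (rule injected_TH0.intro[OF tgX Md X(2) \<iota>])
  have near_sub: "near_set \<delta> \<subseteq> \<iota> ` carrier TH0" if "\<delta> > 0" for \<delta>
    using near_set_not_singular[OF that] sing qi by (auto simp: near_set_def)
  define Q where "Q n = {z \<in> topspace (topo TH0). \<iota> z \<in> near_set ((1/2) ^ n)}" for n :: nat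
  have Q_closed: "closedin (topo TH0) (Q n)" for n
    unfolding Q_def using \<iota>(3) near_set_closed by (rule closedin_continuous_map_preimage)
  have tT: "topspace (topo TH0) = TH0_carrier" by (simp add: TH0_seq_group)
  have "(\<Union>n. Q n) = topspace (topo TH0)"
  proof
    show "topspace (topo TH0) \<subseteq> (\<Union>n. Q n)"
    proof
      fix z assume z: "z \<in> topspace (topo TH0)"
      then have "\<iota> z \<in> quasi_invariance_set X \<mu>" using qi tT carrier_TH0 by auto
      then show "z \<in> (\<Union>n. Q n)" using quasi_invariance_subset_near z by (auto simp: Q_def)
    qed
  qed (auto simp: Q_def)
  moreover have "topo TH0 interior_of topspace (topo TH0) \<noteq> {}"
    unfolding interior_of_topspace unfolding tT using T0.one_mem by blast
  ultimately have "topo TH0 interior_of \<Union>(range Q) \<noteq> {}" by simp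
  then obtain n where "topo TH0 interior_of (Q n) \<noteq> {}"
    using Baire_category_alt[of "topo TH0" "range Q"] polish Q_closed by (auto simp: polish_group_def)
  then obtain g0 where "g0 \<in> T0.mtopology interior_of (Q n)" by (auto simp: TH0_seq_group)
  then obtain r where r: "g0 \<in> TH0_carrier" "r > 0" "T0.mball g0 r \<subseteq> Q n"
    unfolding T0.metric_interior_of by auto
  have "\<iota> (g0 \<otimes>\<^bsub>TH0\<^esub> z) \<in> near_set ((1/2) ^ n)" if z: "z \<in> TH0_carrier" "TH0_dist z (\<lambda>k. 1) < r" for z
  proof -
    have "TH0_dist (\<lambda>k. g0 k * 1) (\<lambda>k. g0 k * z k) = TH0_dist (\<lambda>k. 1) z"
      by (rule T0.invariant[OF r(1) T0.one_mem z(1)])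
    then have "(\<lambda>k. g0 k * z k) \<in> T0.mball g0 r"
      using z r(1) T0.mult_mem by (simp add: T0.commute)
    then have "(\<lambda>k. g0 k * z k) \<in> Q n" using r(3) by blast
    then show ?thesis by (simp add: Q_def TH0_def)
  qed
  then show False
    using no_closed_piece[OF near_set_closed near_sub, of "(1/2) ^ n" g0 r] r(1,2) carrier_TH0 by auto
qed

section \<open>Comparison of the dual groups and conclusion\<close>

lemma Z0_character_eq: "Z0_character = fin_character TH0"
  by (simp add: fun_eq_iff Z0_character_def fin_character_def)

lemma topological_group_TH: "p \<ge> 1 \<Longrightarrow> topological_group (TH p)"
  using circle_sequences.topological_group_G[OF circle_sequences_TH] by (simp add: TH_seq_group)

lemma topological_group_TH0: "topological_group TH0"
  using T0.topological_group_G by (simp add: TH0_seq_group)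

lemma topological_iso_Z0_dual_TH0:
  "topological_iso (with_topology Z0 Z0_topology) (dual TH0) (fin_character TH0)"
  using T0.topological_iso_fin_character by (simp add: TH0_seq_group)

text \<open>Both duals are copies of \<open>Z0\<close> with the same topology. The isomorphism in
  the reverse direction serves to carry reflexivity from \<open>dual TH0\<close> to
  \<open>dual (TH p)\<close>.\<close>

lemma topological_iso_dual_TH_dual_TH0:
  assumes "p > 1"
  obtains f g where "topological_iso (dual (TH p)) (dual TH0) f" "topological_iso (dual TH0) (dual (TH p)) g"
proof -
  let ?Z = "with_topology Z0 Z0_topology"
  have 1: "topological_iso ?Z (dual (TH p)) (fin_character (TH p))"
    using flat_sequences.topological_iso_fin_character[OF flat_sequences_TH[OF assms]] by (simp add: TH_seq_group)
  note Z = topological_groupD(1,2)[OF topological_group_Z0]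
  obtain f where f: "topological_iso (dual (TH p)) ?Z f"
    by (rule topological_isoE[OF 1 Z]) simp_all
  obtain g where g: "topological_iso (dual TH0) ?Z g"
    by (rule topological_isoE[OF topological_iso_Z0_dual_TH0 Z]) simp_all
  show thesis
    using that topological_iso_trans[OF f topological_iso_Z0_dual_TH0] topological_iso_trans[OF g 1] by blast
qed

theorem theorem1:
  shows "(\<forall>p::real. 1 < p \<longrightarrow> \<not> locally_quasi_convex (TH p) \<and> \<not> reflexive (TH p)) \<and>
    (reflexive (TH 1) \<and> locally_quasi_convex (TH 1)) \<and>
    (reflexive TH0 \<and> locally_quasi_convex TH0 \<and> \<not> QI_group TYPE('x) TH0) \<and>
    (\<forall>p::real. 1 < p \<longrightarrow>
       (\<exists>f. topological_iso (dual (TH p)) (dual TH0) f) \<and> reflexive (dual (TH p))) \<and>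
    (\<exists>T. finest_null_group_topology Z0 unit_seq T \<and>
       topological_iso (with_topology Z0 T) (dual TH0) Z0_character) \<and>
    dual (TH 1) \<cong> Zb"
proof (intro conjI allI impI)
  fix p :: real assume p: "1 < p"
  show not_lqc: "\<not> locally_quasi_convex (TH p)" by (rule TH_not_locally_quasi_convex[OF p])
  have tg: "topological_group (TH p)" using p by (intro topological_group_TH) simp
  then show "\<not> reflexive (TH p)" using not_lqc reflexive_imp_locally_quasi_convex by blast
  obtain f g where fg: "topological_iso (dual (TH p)) (dual TH0) f" "topological_iso (dual TH0) (dual (TH p)) g"
    using p by (rule topological_iso_dual_TH_dual_TH0)
  show "\<exists>f. topological_iso (dual (TH p)) (dual TH0) f" using fg(1) by blast
  show "reflexive (dual (TH p))"
    by (rule reflexive_topological_iso[OF topological_group_dual[OF topological_group_TH0]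
          topological_group_dual[OF tg] fg(2) reflexive_dual[OF topological_group_TH0 reflexive_TH0]])
next
  show "reflexive (TH 1)" by (rule reflexive_TH1)
  show "locally_quasi_convex (TH 1)"
    by (rule reflexive_imp_locally_quasi_convex[OF topological_group_TH reflexive_TH1]) simp
  show "reflexive TH0" by (rule reflexive_TH0)
  show "locally_quasi_convex TH0"
    by (rule reflexive_imp_locally_quasi_convex[OF topological_group_TH0 reflexive_TH0])
  show "\<not> QI_group TYPE('x) TH0" by (rule TH0_not_QI_group)
  show "\<exists>T. finest_null_group_topology Z0 unit_seq T \<and>
       topological_iso (with_topology Z0 T) (dual TH0) Z0_character"
    unfolding Z0_character_eq using finest_Z0_topology topological_iso_Z0_dual_TH0 by blast
  show "dual (TH 1) \<cong> Zb" by (rule dual_TH1_iso_Zb)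
qed

end
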